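(* Let $(h,\tau,I)\in\mathcal{G}$ and let $\mathcal{M}$ be an $(h,\tau)$-compatible $(h,\tau)$-exponential family in $\mathcal{P}_I(\mu)$. Assume that $\chi_{h,\tau}\circ p\in L^1(\mu)$ for every $p\in\mathcal{M}$, that $\tau\circ p\in L^1(\mu)$ for every $p\in\mathcal{M}$ with $\mathbb{I}_\tau\in C^\infty(\mathcal{M})$, and that $$V_p(\mathbb{I}_\tau)=\int_{\mathcal{X}}V_p(\tau\circ e_x)\,d\mu(x)\quad\text{for }V\in\mathfrak{X}(\mathcal{M}),\ p\in\mathcal{M}.$$ (1) For an $(h,\tau)$-exponential coordinate representation $(\mathcal{M},\theta,T,c,\psi)$ on $\mathcal{M}$, the coordinate system $(\mathcal{M},\theta)$ is affine with respect to $\nabla^{h,\tau}$ if $\mathbb{I}_\tau$ is constant on $\mathcal{M}$. Moreover, if $\chi_{h,\tau}'>0$ on $I$ and $(\mathcal{M},\theta)$ is affine with respect to $\nabla^{h,\tau}$, then $\mathbb{I}_\tau$ is constant on $\mathcal{M}$. (2) Assume that $\mathbb{I}_\tau$ is constant on $\mathcal{M}$ and that $\mathbb{I}_{s^\star_{h,\tau}}\in C^\infty(\mathcal{M})$ satisfies $$V_p(\mathbb{I}_{s^\star_{h,\tau}})=\int_{\mathcal{X}}V_p(s^\star_{h,\tau}\circ e_x)\,d\mu(x),\qquad V_p\big(W(\mathbb{I}_{s^\star_{h,\tau}})\big)=\int_{\mathcal{X}}V_p\big(W(s^\star_{h,\tau}\circ e_x)\big)\,d\mu(x)$$ for $V,W\in\mathfrak{X}(\mathcal{M})$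 and $p\in\mathcal{M}$. Then $(g^{h,\tau},\nabla^{h,\tau})$ is a Hessian structure on $\mathcal{M}$ and its global potential is $-\mathbb{I}_{s^\star_{h,\tau}}+\psi\,\mathbb{I}_\tau$, where $\psi$ is a global $(h,\tau)$-exponential normalization of $\mathcal{M}$. Moreover, the canonical divergence of the Hessian structure $(g^{h,\tau},\nabla^{h,\tau})$ on $\mathcal{M}$ is the $(h,\tau)$-divergence $D_{h,\tau}$.
   Context: Setting: $\mathcal{X}$ is a topological space and $\mu$ is a Radon measure on $\mathcal{X}$ with support $\mathcal{X}$. Manifolds are smooth, Hausdorff, second countable, connected, without boundary. For an open interval $I\subset(0,\infty)$, $\mathcal{P}_I(\mu)=\{p\in L^1(\mu)\mid p\in I\ \mu\text{-a.e.},\ \|p\|_{L^1(\mu)}=1\}$ and $\mathcal{P}(\mu)=\mathcal{P}_{(0,\infty)}(\mu)$. A manifold in $\mathcal{P}_I(\mu)$ is a manifold whose underlying set is a subset of $\mathcal{P}_I(\mu)$; its elements are evaluated pointwise, $e_x(p):=p(x)$. $\mathcal{G}$ is the set of triples $(h,\tau,I)$ with $I\subset(0,\infty)$ an open interval, $\tau\in C^\infty(I)$ with $\tau'>0$ on $I$, and $h\in C^\infty(\tau(I))$ with $h''>0$ on $\tau(I)$. Put $\ell_{h,\tau}:=h'\circ\tau$, $\chi_{h,\tau}:=1/\ell_{h,\tau}'$, $s^\star_{h,\tau}:=-\tau\cdot\ell_{h,\tau}+(h\circ\tau)$ on $I$, and $d_{h,\tau}(t,s):=h(\tau(t))-h(\tau(s))-(\tau(t)-\tau(s))h'(\tau(s))$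 for $s,t\in I$. The $(h,\tau)$-divergence is $D_{h,\tau}(p,p'):=\int_{\mathcal{X}}d_{h,\tau}(p(x),p'(x))\,d\mu(x)$. For a function $\phi$ on $I$ with $\phi\circ p\in L^1(\mu)$ for all $p\in\mathcal{M}$, $\mathbb{I}_\phi\colon\mathcal{M}\to\mathbb{R}$ is $\mathbb{I}_\phi(p):=\int_{\mathcal{X}}\phi(p(x))\,d\mu(x)$. Statistical model: a manifold $\mathcal{M}$ in $\mathcal{P}(\mu)$ is a statistical model if there is a $\mu$-null set $\mathcal{N}\subset\mathcal{X}$ such that: (a) the topology of $\mathcal{M}$ is the one induced by $(e_x)_{x\in\mathcal{X}\setminus\mathcal{N}}$; (b) $e_x\colon\mathcal{M}\to\mathbb{R}$ is smooth for $x\in\mathcal{X}\setminus\mathcal{N}$; (c) for $p\in\mathcal{M}$, the derivatives of $e_x$ of any order at $p$ are Borel functions of $x$; (d) for $V\in\mathfrak{X}(\mathcal{M})$, $p\in\mathcal{M}$, $V_p(e_x)=0$ for all $x\in\mathcal{X}\setminus\mathcal{N}$ iff $V_p=0$; (e) for $V,W\in\mathfrak{X}(\mathcal{M})$, $p\in\mathcal{M}$, $x\mapsto V_p(e_x)$ and $x\mapsto V_p(We_x)$ are in $L^1(\mu)$ with integral $0$. $(h,\tau)$-exponential function: $\exp_{h,\tau}(u)=\ell_{h,\tau}^{-1}(u)$ for $u\in\ell_{h,\tau}(I)$, $=\infty$ for $u\ge\sup\ell_{h,\tau}(I)$, $=0$ for $u\le\inf\ell_{h,\tau}(I)$. For an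 $n$-dimensional manifold $\mathcal{M}$ in $\mathcal{P}_I(\mu)$, an $(h,\tau)$-exponential coordinate representation is $(U,\theta,T,c,\psi)$ with $(U,\theta)$ a coordinate system on $\mathcal{M}$, $T\colon\mathcal{X}\to\mathbb{R}^n$ and $c\colon\mathcal{X}\to\mathbb{R}$ continuous, $\psi\colon U\to\mathbb{R}$ smooth, and $p(x)=\exp_{h,\tau}(\langle\theta(p),T(x)\rangle-c(x)-\psi(p))$ for all $p\in U$, $x\in\mathcal{X}$, where elements of $\mathcal{M}$ are regarded as functions with values in $I$ at every point. When $U=\mathcal{M}$ it is global and $\psi$ is a global $(h,\tau)$-exponential normalization. $\mathcal{M}$ is an $(h,\tau)$-exponential family if it is a statistical model each point of which lies in the domain $U$ of such a representation (a global one then exists). Compatibility: for $V\in\mathfrak{X}(\mathcal{M})$ put $\widetilde V:=(V,0)$, $\widehat V:=(0,V)\in\mathfrak{X}(\mathcal{M}\times\mathcal{M})$, and let $d_{h,\tau}\circ(e_x,e_x)$ denote $(p,p')\mapsto d_{h,\tau}(p(x),p'(x))$. A statistical model $\mathcal{M}$ in $\mathcal{P}_I(\mu)$ is $(h,\tau)$-compatible if for all $V,W,Z\in\mathfrak{X}(\mathcal{M})$ and $p\in\mathcal{M}$ the functions $x\mapsto\widetilde V_{(p,p)}(\widehat W(d_{h,\tau}\circ(e_x,e_x)))$ and $x\mapsto\widehat V_{(p,p)}(\widehat W\widetilde Z(d_{h,\tau}\circ(e_x,e_x)))$ are in $L^1(\mu)$ and the following are smooth functions of $p$: $$g^{h,\tau}_p(V,W):=-\int_{\mathcal{X}}\widetilde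 V_{(p,p)}\big(\widehat W(d_{h,\tau}\circ(e_x,e_x))\big)d\mu(x),\qquad g^{h,\tau}_p(\nabla^{h,\tau}_ZV,W):=-\int_{\mathcal{X}}\widehat Z_{(p,p)}\big(\widehat V\widetilde W(d_{h,\tau}\circ(e_x,e_x))\big)d\mu(x).$$ These formulas define $g^{h,\tau}$ and $\nabla^{h,\tau}$. Hessian geometry: a coordinate system is affine with respect to a connection $\nabla$ if all its Christoffel symbols vanish. A Hessian structure is a pair $(g,\nabla)$ of a Riemannian metric and a flat connection (torsion and curvature vanish) such that locally $g=\nabla d\Psi$ for some smooth $\Psi$; a global potential is such a $\Psi$ defined on all of $\mathcal{M}$. For an affine coordinate system $\xi$ and potential $\Psi$ on $\mathcal{M}$, with $\eta:=(\partial\Psi/\partial\xi^i)_{i=1}^n$, the canonical divergence is $\overline D(p,p'):=\Psi(p')-\Psi(p)+\langle\xi(p)-\xi(p'),\eta(p)\rangle$; here it is taken with $\xi=\theta$ and $\Psi$ the global potential above. *)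

theory Defs
  imports "HOL-Analysis.Analysis"
begin

section \<open>Smooth maps between open subsets of normed spaces\<close>

text \<open>Only used for open \<open>S\<close>, where \<open>frechet_derivative f (at x)\<close> depends on \<open>f\<close> restricted to \<open>S\<close> only.\<close>

fun Ck_on :: "nat \<Rightarrow> 'a::real_normed_vector set \<Rightarrow> ('a \<Rightarrow> 'b::real_normed_vector) \<Rightarrow> bool" where
  "Ck_on 0 S f \<longleftrightarrow> continuous_on S f"
| "Ck_on (Suc k) S f \<longleftrightarrow>
     (\<forall>x\<in>S. f differentiable (at x)) \<and> (\<forall>v. Ck_on k S (\<lambda>x. frechet_derivative f (at x) v))"

definition smooth_on :: "'a::real_normed_vector set \<Rightarrow> ('a \<Rightarrow> 'b::real_normed_vector) \<Rightarrow> bool" where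
  "smooth_on S f \<longleftrightarrow> (\<forall>k. Ck_on k S f)"

fun iter_partial :: "'n::finite list \<Rightarrow> (real^'n \<Rightarrow> real) \<Rightarrow> real^'n \<Rightarrow> real" where
  "iter_partial [] f = f"
| "iter_partial (i # is) f = (\<lambda>y. frechet_derivative (iter_partial is f) (at y) (axis i 1))"


section \<open>Manifolds and vector fields\<close>

text \<open>\<open>charts\<close> is the maximal atlas, i.e. the set of all coordinate systems \<open>(U, \<phi>)\<close>;
  \<open>\<phi>\<close> is a total function, only its values on \<open>U\<close> matter.\<close>

record ('p, 'n::finite) manifold =
  mtop :: "'p topology"
  charts :: "('p set \<times> ('p \<Rightarrow> real^'n)) set"

abbreviation pts :: "('p, 'n::finite) manifold \<Rightarrow> 'p set" where
  "pts M \<equiv> topspace (mtop M)"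

definition is_chart :: "'p topology \<Rightarrow> 'p set \<times> ('p \<Rightarrow> real^'n::finite) \<Rightarrow> bool" where
  "is_chart X = (\<lambda>(U, \<phi>). openin X U \<and> open (\<phi> ` U) \<and>
     homeomorphic_map (subtopology X U) (top_of_set (\<phi> ` U)) \<phi>)"

definition compatible_charts ::
  "'p set \<times> ('p \<Rightarrow> real^'n::finite) \<Rightarrow> 'p set \<times> ('p \<Rightarrow> real^'n) \<Rightarrow> bool" where
  "compatible_charts = (\<lambda>(U, \<phi>) (U', \<phi>').
     smooth_on (\<phi> ` (U \<inter> U')) (\<phi>' \<circ> inv_into U \<phi>) \<and>
     smooth_on (\<phi>' ` (U \<inter> U')) (\<phi> \<circ> inv_into U' \<phi>'))"

definition smooth_manifold :: "('p, 'n::finite) manifold \<Rightarrow> bool" where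
  "smooth_manifold M \<longleftrightarrow>
     Hausdorff_space (mtop M) \<and> second_countable (mtop M) \<and>
     connected_space (mtop M) \<and> pts M \<noteq> {} \<and>
     (\<forall>c\<in>charts M. is_chart (mtop M) c) \<and>
     (\<Union>c\<in>charts M. fst c) = pts M \<and>
     (\<forall>c\<in>charts M. \<forall>c'\<in>charts M. compatible_charts c c') \<and>
     (\<forall>c. is_chart (mtop M) c \<and> (\<forall>c'\<in>charts M. compatible_charts c c') \<longrightarrow> c \<in> charts M)"

definition smooth_fun ::
  "('p, 'n::finite) manifold \<Rightarrow> 'p set \<Rightarrow> ('p \<Rightarrow> 'b::real_normed_vector) \<Rightarrow> bool" where
  "smooth_fun M W f \<longleftrightarrow> (\<forall>(U, \<phi>)\<in>charts M. smooth_on (\<phi> ` (U \<inter> W)) (f \<circ> inv_into U \<phi>))"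

definition smooth_at :: "('p, 'n::finite) manifold \<Rightarrow> 'p \<Rightarrow> ('p \<Rightarrow> real) \<Rightarrow> bool" where
  "smooth_at M p f \<longleftrightarrow> (\<exists>W. openin (mtop M) W \<and> p \<in> W \<and> smooth_fun M W f)"

text \<open>A tangent vector at \<open>p\<close> is the operator \<open>f \<mapsto> \<Sum>\<^sub>i w\<^sub>i \<partial>f/\<partial>\<phi>\<^sup>i(p)\<close> on functions smooth near \<open>p\<close>.
  It is given the value 0 on all other functions, so that equality of tangent vectors is equality
  of operators; likewise vector fields are 0 outside the manifold.\<close>

definition coord_vec ::
  "('p, 'n::finite) manifold \<Rightarrow> 'p set \<times> ('p \<Rightarrow> real^'n) \<Rightarrow> 'p \<Rightarrow> real^'n \<Rightarrow> ('p \<Rightarrow> real) \<Rightarrow> real" where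
  "coord_vec M = (\<lambda>(U, \<phi>) p w f.
     if smooth_at M p f then frechet_derivative (f \<circ> inv_into U \<phi>) (at (\<phi> p)) w else 0)"

definition tangent_space :: "('p, 'n::finite) manifold \<Rightarrow> 'p \<Rightarrow> (('p \<Rightarrow> real) \<Rightarrow> real) set" where
  "tangent_space M p = {coord_vec M c p w | c w. c \<in> charts M \<and> p \<in> fst c}"

text \<open>\<open>V p f\<close> is the derivative of \<open>f\<close> at \<open>p\<close> in direction \<open>V\<^sub>p\<close>, and \<open>\<lambda>p. V p f\<close> is the function \<open>V f\<close>.\<close>

type_synonym 'p vfield = "'p \<Rightarrow> ('p \<Rightarrow> real) \<Rightarrow> real"

definition vector_fields :: "('p, 'n::finite) manifold \<Rightarrow> 'p vfield set" where
  "vector_fields M = {V.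
     (\<forall>p. p \<notin> pts M \<longrightarrow> V p = (\<lambda>_. 0)) \<and>
     (\<forall>p\<in>pts M. V p \<in> tangent_space M p) \<and>
     (\<forall>W f. openin (mtop M) W \<and> smooth_fun M W f \<longrightarrow> smooth_fun M W (\<lambda>p. V p f))}"

definition vadd :: "'p vfield \<Rightarrow> 'p vfield \<Rightarrow> 'p vfield" where
  "vadd V W = (\<lambda>p f. V p f + W p f)"

definition vscale :: "('p \<Rightarrow> real) \<Rightarrow> 'p vfield \<Rightarrow> 'p vfield" where
  "vscale u V = (\<lambda>p f. u p * V p f)"

definition lie_bracket :: "('p, 'n::finite) manifold \<Rightarrow> 'p vfield \<Rightarrow> 'p vfield \<Rightarrow> 'p vfield" where
  "lie_bracket M V W = (\<lambda>p f.
     if smooth_at M p f then V p (\<lambda>q. W q f) - W p (\<lambda>q. V q f) else 0)"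

text \<open>The coordinate vector field \<open>\<partial>/\<partial>\<xi>\<^sup>i\<close> of a coordinate system \<open>\<xi>\<close> defined on the whole manifold.\<close>

definition coord_field ::
  "('p, 'n::finite) manifold \<Rightarrow> ('p \<Rightarrow> real^'n) \<Rightarrow> 'n \<Rightarrow> 'p vfield" where
  "coord_field M \<xi> i = (\<lambda>p. if p \<in> pts M then coord_vec M (pts M, \<xi>) p (axis i 1) else (\<lambda>_. 0))"

text \<open>The vector fields \<open>(V, 0)\<close> and \<open>(0, V)\<close> on \<open>M \<times> M\<close>, as operators on functions on \<open>M \<times> M\<close>.\<close>

definition vtilde :: "'p vfield \<Rightarrow> ('p \<times> 'p \<Rightarrow> real) \<Rightarrow> 'p \<times> 'p \<Rightarrow> real" where
  "vtilde V F = (\<lambda>(p, p'). V p (\<lambda>q. F (q, p')))"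

definition vhat :: "'p vfield \<Rightarrow> ('p \<times> 'p \<Rightarrow> real) \<Rightarrow> 'p \<times> 'p \<Rightarrow> real" where
  "vhat V F = (\<lambda>(p, p'). V p' (\<lambda>q'. F (p, q')))"


section \<open>Hessian structures\<close>

definition riemannian_metric ::
  "('p, 'n::finite) manifold \<Rightarrow> ('p \<Rightarrow> 'p vfield \<Rightarrow> 'p vfield \<Rightarrow> real) \<Rightarrow> bool" where
  "riemannian_metric M g \<longleftrightarrow>
     (\<forall>V\<in>vector_fields M. \<forall>W\<in>vector_fields M.
        smooth_fun M (pts M) (\<lambda>p. g p V W) \<and>
        (\<forall>p\<in>pts M. g p V W = g p W V) \<and>
        (\<forall>Z\<in>vector_fields M. \<forall>p\<in>pts M. g p (vadd V Z) W = g p V W + g p Z W) \<and>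
        (\<forall>u. smooth_fun M (pts M) u \<longrightarrow> (\<forall>p\<in>pts M. g p (vscale u V) W = u p * g p V W))) \<and>
     (\<forall>V\<in>vector_fields M. \<forall>p\<in>pts M. V p \<noteq> (\<lambda>_. 0) \<longrightarrow> g p V V > 0)"

definition affine_connection ::
  "('p, 'n::finite) manifold \<Rightarrow> ('p vfield \<Rightarrow> 'p vfield \<Rightarrow> 'p vfield) \<Rightarrow> bool" where
  "affine_connection M nabla \<longleftrightarrow>
     (\<forall>Z\<in>vector_fields M. \<forall>V\<in>vector_fields M.
        nabla Z V \<in> vector_fields M \<and>
        (\<forall>Y\<in>vector_fields M. nabla (vadd Z Y) V = vadd (nabla Z V) (nabla Y V)) \<and>
        (\<forall>W\<in>vector_fields M. nabla Z (vadd V W) = vadd (nabla Z V) (nabla Z W)) \<and>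
        (\<forall>u. smooth_fun M (pts M) u \<longrightarrow>
           nabla (vscale u Z) V = vscale u (nabla Z V) \<and>
           nabla Z (vscale u V) = vadd (vscale (\<lambda>p. Z p u) V) (vscale u (nabla Z V))))"

definition torsion_free ::
  "('p, 'n::finite) manifold \<Rightarrow> ('p vfield \<Rightarrow> 'p vfield \<Rightarrow> 'p vfield) \<Rightarrow> bool" where
  "torsion_free M nabla \<longleftrightarrow>
     (\<forall>V\<in>vector_fields M. \<forall>W\<in>vector_fields M. \<forall>p\<in>pts M. \<forall>f.
        nabla V W p f - nabla W V p f - lie_bracket M V W p f = 0)"

definition curvature_free ::
  "('p, 'n::finite) manifold \<Rightarrow> ('p vfield \<Rightarrow> 'p vfield \<Rightarrow> 'p vfield) \<Rightarrow> bool" where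
  "curvature_free M nabla \<longleftrightarrow>
     (\<forall>V\<in>vector_fields M. \<forall>W\<in>vector_fields M. \<forall>Z\<in>vector_fields M. \<forall>p\<in>pts M. \<forall>f.
        nabla V (nabla W Z) p f - nabla W (nabla V Z) p f - nabla (lie_bracket M V W) Z p f = 0)"

definition flat_connection ::
  "('p, 'n::finite) manifold \<Rightarrow> ('p vfield \<Rightarrow> 'p vfield \<Rightarrow> 'p vfield) \<Rightarrow> bool" where
  "flat_connection M nabla \<longleftrightarrow>
     affine_connection M nabla \<and> torsion_free M nabla \<and> curvature_free M nabla"

text \<open>\<open>(\<nabla>d\<Psi>)(V, W) = V(W\<Psi>) - (\<nabla>\<^sub>V W)\<Psi>\<close>\<close>

definition hess ::
  "('p vfield \<Rightarrow> 'p vfield \<Rightarrow> 'p vfield) \<Rightarrow> ('p \<Rightarrow> real) \<Rightarrow> 'p \<Rightarrow> 'p vfield \<Rightarrow> 'p vfield \<Rightarrow> real" where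
  "hess nabla \<Psi> p V W = V p (\<lambda>q. W q \<Psi>) - nabla V W p \<Psi>"

definition hessian_potential_on ::
  "('p, 'n::finite) manifold \<Rightarrow> ('p \<Rightarrow> 'p vfield \<Rightarrow> 'p vfield \<Rightarrow> real) \<Rightarrow>
   ('p vfield \<Rightarrow> 'p vfield \<Rightarrow> 'p vfield) \<Rightarrow> 'p set \<Rightarrow> ('p \<Rightarrow> real) \<Rightarrow> bool" where
  "hessian_potential_on M g nabla O' \<Psi> \<longleftrightarrow>
     smooth_fun M O' \<Psi> \<and>
     (\<forall>p\<in>O'. \<forall>V\<in>vector_fields M. \<forall>W\<in>vector_fields M. g p V W = hess nabla \<Psi> p V W)"

definition hessian_structure ::
  "('p, 'n::finite) manifold \<Rightarrow> ('p \<Rightarrow> 'p vfield \<Rightarrow> 'p vfield \<Rightarrow> real) \<Rightarrow>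
   ('p vfield \<Rightarrow> 'p vfield \<Rightarrow> 'p vfield) \<Rightarrow> bool" where
  "hessian_structure M g nabla \<longleftrightarrow>
     riemannian_metric M g \<and> flat_connection M nabla \<and>
     (\<forall>p\<in>pts M. \<exists>O' \<Psi>. openin (mtop M) O' \<and> p \<in> O' \<and> hessian_potential_on M g nabla O' \<Psi>)"

definition global_potential ::
  "('p, 'n::finite) manifold \<Rightarrow> ('p \<Rightarrow> 'p vfield \<Rightarrow> 'p vfield \<Rightarrow> real) \<Rightarrow>
   ('p vfield \<Rightarrow> 'p vfield \<Rightarrow> 'p vfield) \<Rightarrow> ('p \<Rightarrow> real) \<Rightarrow> bool" where
  "global_potential M g nabla \<Psi> \<longleftrightarrow> hessian_potential_on M g nabla (pts M) \<Psi>"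

text \<open>Christoffel symbols \<open>\<Gamma>\<^sup>k\<^sub>i\<^sub>j = d\<xi>\<^sup>k(\<nabla>\<^bsub>\<partial>\<^sub>i\<^esub> \<partial>\<^sub>j)\<close>, affineness and canonical divergence for a coordinate
  system \<open>\<xi>\<close> defined on the whole manifold.\<close>

definition christoffel ::
  "('p, 'n::finite) manifold \<Rightarrow> ('p vfield \<Rightarrow> 'p vfield \<Rightarrow> 'p vfield) \<Rightarrow> ('p \<Rightarrow> real^'n) \<Rightarrow>
   'n \<Rightarrow> 'n \<Rightarrow> 'n \<Rightarrow> 'p \<Rightarrow> real" where
  "christoffel M nabla \<xi> k i j p = nabla (coord_field M \<xi> i) (coord_field M \<xi> j) p (\<lambda>q. \<xi> q $ k)"

definition affine_coords ::
  "('p, 'n::finite) manifold \<Rightarrow> ('p vfield \<Rightarrow> 'p vfield \<Rightarrow> 'p vfield) \<Rightarrow> ('p \<Rightarrow> real^'n) \<Rightarrow> bool" where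
  "affine_coords M nabla \<xi> \<longleftrightarrow>
     (pts M, \<xi>) \<in> charts M \<and> (\<forall>k i j. \<forall>p\<in>pts M. christoffel M nabla \<xi> k i j p = 0)"

definition canonical_divergence ::
  "('p, 'n::finite) manifold \<Rightarrow> ('p \<Rightarrow> real^'n) \<Rightarrow> ('p \<Rightarrow> real) \<Rightarrow> 'p \<Rightarrow> 'p \<Rightarrow> real" where
  "canonical_divergence M \<xi> \<Psi> p p' =
     \<Psi> p' - \<Psi> p + (\<xi> p - \<xi> p') \<bullet> (\<chi> i. coord_field M \<xi> i p \<Psi>)"


section \<open>Radon measures and statistical models\<close>

text \<open>Compact sets need not be Borel in a non-Hausdorff space, hence the explicit condition.\<close>

definition radon_measure :: "'x::topological_space measure \<Rightarrow> bool" where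
  "radon_measure \<mu> \<longleftrightarrow> sets \<mu> = sets borel \<and>
     (\<forall>x. \<exists>U. open U \<and> x \<in> U \<and> emeasure \<mu> U < \<infinity>) \<and>
     (\<forall>A\<in>sets borel. emeasure \<mu> A = (SUP K\<in>{K. compact K \<and> K \<in> sets borel \<and> K \<subseteq> A}. emeasure \<mu> K))"

definition measure_support :: "'x::topological_space measure \<Rightarrow> 'x set" where
  "measure_support \<mu> = {x. \<forall>U. open U \<and> x \<in> U \<longrightarrow> emeasure \<mu> U > 0}"

definition densities :: "'x measure \<Rightarrow> real set \<Rightarrow> ('x \<Rightarrow> real) set" where
  "densities \<mu> I = {p. integrable \<mu> p \<and> (AE x in \<mu>. p x \<in> I) \<and> (LINT x|\<mu>. \<bar>p x\<bar>) = 1}"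

text \<open>The points of a manifold in \<open>densities \<mu> I\<close> are representatives of elements of \<open>L\<^sup>1(\<mu>)\<close>, one for each
  class, so that they can be evaluated pointwise.\<close>

definition manifold_in :: "'x measure \<Rightarrow> real set \<Rightarrow> ('x \<Rightarrow> real, 'n::finite) manifold \<Rightarrow> bool" where
  "manifold_in \<mu> I M \<longleftrightarrow> smooth_manifold M \<and> pts M \<subseteq> densities \<mu> I \<and>
     (\<forall>p\<in>pts M. \<forall>q\<in>pts M. (AE x in \<mu>. p x = q x) \<longrightarrow> p = q)"

abbreviation (input) ev :: "'x \<Rightarrow> ('x \<Rightarrow> real) \<Rightarrow> real" where
  "ev x \<equiv> (\<lambda>p. p x)"

text \<open>The derivatives of \<open>ev x\<close> are meaningful only for \<open>x\<close> outside a null set, where their values are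
  immaterial. Membership in \<open>L\<^sup>1(\<mu>)\<close> and integrals of such functions are therefore taken with respect to
  \<open>completion \<mu>\<close>, i.e. up to \<open>\<mu>\<close>-a.e. equality with a Borel function.\<close>

definition statistical_model ::
  "'x::topological_space measure \<Rightarrow> ('x \<Rightarrow> real, 'n::finite) manifold \<Rightarrow> bool" where
  "statistical_model \<mu> M \<longleftrightarrow> manifold_in \<mu> {0<..} M \<and>
     (\<exists>N\<in>null_sets \<mu>.
        mtop M = topology_generated_by {{p \<in> pts M. ev x p \<in> S} | x S. x \<notin> N \<and> open S} \<and>
        (\<forall>x. x \<notin> N \<longrightarrow> smooth_fun M (pts M) (ev x)) \<and>
        (\<forall>(U, \<phi>)\<in>charts M. \<forall>p\<in>U. \<forall>is.
           (\<lambda>x. iter_partial is (ev x \<circ> inv_into U \<phi>) (\<phi> p)) \<in> borel_measurable (restrict_space borel (- N))) \<and>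
        (\<forall>V\<in>vector_fields M. \<forall>p\<in>pts M. (\<forall>x. x \<notin> N \<longrightarrow> V p (ev x) = 0) \<longleftrightarrow> V p = (\<lambda>_. 0)) \<and>
        (\<forall>V\<in>vector_fields M. \<forall>W\<in>vector_fields M. \<forall>p\<in>pts M.
           has_bochner_integral (completion \<mu>) (\<lambda>x. V p (ev x)) 0 \<and>
           has_bochner_integral (completion \<mu>) (\<lambda>x. V p (\<lambda>q. W q (ev x))) 0))"


section \<open>The class \<open>\<G>\<close> and the associated functions\<close>

definition admissible_triples :: "((real \<Rightarrow> real) \<times> (real \<Rightarrow> real) \<times> real set) set" where
  "admissible_triples = {(h, \<tau>, I).
     open I \<and> is_interval I \<and> I \<noteq> {} \<and> I \<subseteq> {0<..} \<and>
     smooth_on I \<tau> \<and> (\<forall>t\<in>I. deriv \<tau> t > 0) \<and>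
     smooth_on (\<tau> ` I) h \<and> (\<forall>u\<in>\<tau> ` I. deriv (deriv h) u > 0)}"

definition ell :: "(real \<Rightarrow> real) \<Rightarrow> (real \<Rightarrow> real) \<Rightarrow> real \<Rightarrow> real" where
  "ell h \<tau> = deriv h \<circ> \<tau>"

definition chi :: "(real \<Rightarrow> real) \<Rightarrow> (real \<Rightarrow> real) \<Rightarrow> real \<Rightarrow> real" where
  "chi h \<tau> = (\<lambda>t. 1 / deriv (ell h \<tau>) t)"

definition sstar :: "(real \<Rightarrow> real) \<Rightarrow> (real \<Rightarrow> real) \<Rightarrow> real \<Rightarrow> real" where
  "sstar h \<tau> = (\<lambda>t. - \<tau> t * ell h \<tau> t + h (\<tau> t))"

definition ddiv :: "(real \<Rightarrow> real) \<Rightarrow> (real \<Rightarrow> real) \<Rightarrow> real \<Rightarrow> real \<Rightarrow> real" where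
  "ddiv h \<tau> t s = h (\<tau> t) - h (\<tau> s) - (\<tau> t - \<tau> s) * deriv h (\<tau> s)"

definition divergence ::
  "'x measure \<Rightarrow> (real \<Rightarrow> real) \<Rightarrow> (real \<Rightarrow> real) \<Rightarrow> ('x \<Rightarrow> real) \<Rightarrow> ('x \<Rightarrow> real) \<Rightarrow> real" where
  "divergence \<mu> h \<tau> p p' = (LINT x|completion \<mu>. ddiv h \<tau> (p x) (p' x))"

definition Ifun :: "'x measure \<Rightarrow> (real \<Rightarrow> real) \<Rightarrow> ('x \<Rightarrow> real) \<Rightarrow> real" where
  "Ifun \<mu> f p = (LINT x|completion \<mu>. f (p x))"

definition exp_ht :: "(real \<Rightarrow> real) \<Rightarrow> (real \<Rightarrow> real) \<Rightarrow> real set \<Rightarrow> real \<Rightarrow> ereal" where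
  "exp_ht h \<tau> I u =
     (if u \<in> ell h \<tau> ` I then ereal (inv_into I (ell h \<tau>) u)
      else if ereal u \<ge> (SUP t\<in>I. ereal (ell h \<tau> t)) then \<infinity>
      else 0)"


section \<open>\<open>(h, \<tau>)\<close>-exponential families and compatibility\<close>

definition exp_coord_rep ::
  "(real \<Rightarrow> real) \<Rightarrow> (real \<Rightarrow> real) \<Rightarrow> real set \<Rightarrow> ('x::topological_space \<Rightarrow> real, 'n::finite) manifold \<Rightarrow>
   ('x \<Rightarrow> real) set \<Rightarrow> (('x \<Rightarrow> real) \<Rightarrow> real^'n) \<Rightarrow> ('x \<Rightarrow> real^'n) \<Rightarrow> ('x \<Rightarrow> real) \<Rightarrow>
   (('x \<Rightarrow> real) \<Rightarrow> real) \<Rightarrow> bool" where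
  "exp_coord_rep h \<tau> I M U \<theta> T c \<psi> \<longleftrightarrow>
     (\<forall>p\<in>pts M. \<forall>x. p x \<in> I) \<and>
     (U, \<theta>) \<in> charts M \<and> continuous_on UNIV T \<and> continuous_on UNIV c \<and> smooth_fun M U \<psi> \<and>
     (\<forall>p\<in>U. \<forall>x. ereal (p x) = exp_ht h \<tau> I (\<theta> p \<bullet> T x - c x - \<psi> p))"

definition exponential_family ::
  "'x::topological_space measure \<Rightarrow> (real \<Rightarrow> real) \<Rightarrow> (real \<Rightarrow> real) \<Rightarrow> real set \<Rightarrow>
   ('x \<Rightarrow> real, 'n::finite) manifold \<Rightarrow> bool" where
  "exponential_family \<mu> h \<tau> I M \<longleftrightarrow>
     statistical_model \<mu> M \<and> manifold_in \<mu> I M \<and>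
     (\<forall>p\<in>pts M. \<exists>U \<theta> T c \<psi>. p \<in> U \<and> exp_coord_rep h \<tau> I M U \<theta> T c \<psi>)"

definition d_ev :: "(real \<Rightarrow> real) \<Rightarrow> (real \<Rightarrow> real) \<Rightarrow> 'x \<Rightarrow> ('x \<Rightarrow> real) \<times> ('x \<Rightarrow> real) \<Rightarrow> real" where
  "d_ev h \<tau> x = (\<lambda>(p, p'). ddiv h \<tau> (ev x p) (ev x p'))"

definition g_ht ::
  "'x measure \<Rightarrow> (real \<Rightarrow> real) \<Rightarrow> (real \<Rightarrow> real) \<Rightarrow> ('x \<Rightarrow> real) \<Rightarrow>
   ('x \<Rightarrow> real) vfield \<Rightarrow> ('x \<Rightarrow> real) vfield \<Rightarrow> real" where
  "g_ht \<mu> h \<tau> p V W = - (LINT x|completion \<mu>. vtilde V (vhat W (d_ev h \<tau> x)) (p, p))"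

text \<open>The prescribed value of \<open>g\<^sub>p(\<nabla>\<^sub>Z V, W)\<close>.\<close>

definition gnabla_ht ::
  "'x measure \<Rightarrow> (real \<Rightarrow> real) \<Rightarrow> (real \<Rightarrow> real) \<Rightarrow> ('x \<Rightarrow> real) \<Rightarrow>
   ('x \<Rightarrow> real) vfield \<Rightarrow> ('x \<Rightarrow> real) vfield \<Rightarrow> ('x \<Rightarrow> real) vfield \<Rightarrow> real" where
  "gnabla_ht \<mu> h \<tau> p Z V W = - (LINT x|completion \<mu>. vhat Z (vhat V (vtilde W (d_ev h \<tau> x))) (p, p))"

definition compatible ::
  "'x::topological_space measure \<Rightarrow> (real \<Rightarrow> real) \<Rightarrow> (real \<Rightarrow> real) \<Rightarrow> real set \<Rightarrow>
   ('x \<Rightarrow> real, 'n::finite) manifold \<Rightarrow> bool" where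
  "compatible \<mu> h \<tau> I M \<longleftrightarrow>
     statistical_model \<mu> M \<and> manifold_in \<mu> I M \<and>
     (\<forall>V\<in>vector_fields M. \<forall>W\<in>vector_fields M. \<forall>Z\<in>vector_fields M.
        (\<forall>p\<in>pts M.
           integrable (completion \<mu>) (\<lambda>x. vtilde V (vhat W (d_ev h \<tau> x)) (p, p)) \<and>
           integrable (completion \<mu>) (\<lambda>x. vhat V (vhat W (vtilde Z (d_ev h \<tau> x))) (p, p))) \<and>
        smooth_fun M (pts M) (\<lambda>p. g_ht \<mu> h \<tau> p V W) \<and>
        smooth_fun M (pts M) (\<lambda>p. gnabla_ht \<mu> h \<tau> p Z V W))"

definition nabla_ht ::
  "'x measure \<Rightarrow> (real \<Rightarrow> real) \<Rightarrow> (real \<Rightarrow> real) \<Rightarrow> ('x \<Rightarrow> real, 'n::finite) manifold \<Rightarrow>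
   ('x \<Rightarrow> real) vfield \<Rightarrow> ('x \<Rightarrow> real) vfield \<Rightarrow> ('x \<Rightarrow> real) vfield" where
  "nabla_ht \<mu> h \<tau> M Z V = (THE Y. Y \<in> vector_fields M \<and>
     (\<forall>W\<in>vector_fields M. \<forall>p\<in>pts M. g_ht \<mu> h \<tau> p Y W = gnabla_ht \<mu> h \<tau> p Z V W))"

end

(* In exponential coordinates ell (p x) = <theta p, T x> - c x - psi p, so differentiating ell (p x) along a
   field V gives stat V p x = <V theta, T x> - V psi, and every integrand of the theorem is a function of
   p x times products of such terms. With D the flat connection of the chart this yields
     g (V, W) = integral of (tau' chi) (p x) * stat V * stat W,
     g (nabla_Z V, W) = g (D_Z V, W) - (D d psi)(Z, V) * W (I_tau).
   Hence nabla = D when I_tau is constant. Conversely, in affine coordinates (D d psi)(Z, V) * W (I_tau) = 0,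
   and the second derivatives of ev x integrate to zero, which excludes D d psi = 0 if chi' > 0.
   Differentiating I_sstar twice identifies g as the Hessian of the potential.

   A global exponential chart is obtained from the local ones because T and c are unique up to affine
   changes on overlapping charts (and M is connected), while 1, T_1, ..., T_n are linearly independent:
   p and q with ell (p x) - ell (q x) constant are comparable densities of total mass 1, hence equal. *)
theory Submission
  imports Defs
begin

section \<open>Calculus of smooth functions\<close>

text \<open>Once one chart covers \<open>M\<close>, a vector field is the same thing as its
  component function and the coordinate fields are global, so no cut-off functions enter. The weight
  in the metric arises because the mixed derivative of \<open>ddiv h \<tau>\<close> on the diagonal
  is minus the product of the derivatives of \<open>\<tau>\<close> and \<open>ell h \<tau>\<close>,
  while each derivative of \<open>p x\<close> contributes a factor \<open>chi h \<tau>\<close>, the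
  reciprocal of the derivative of \<open>ell h \<tau>\<close>. The term with the Hessian of
  \<open>\<psi>\<close> arises because \<open>\<psi>\<close> is the only part of the logarithm-like
  expression \<open>ell h \<tau> (p x)\<close> that is not affine in the coordinates; its Hessian is
  constant in \<open>x\<close>, leaves the integral, and what remains inside is the derivative of
  \<open>\<tau> (p x)\<close>. A further obstacle is that \<open>nabla_ht\<close> is a definite
  description. Uniqueness is positive definiteness of the metric, but nothing can be read off from
  vanishing Christoffel symbols before a smooth solution is known to exist; this is why a
  representation theorem for linear forms precedes the converse half of (1).\<close>

lemma Ck_on_cong:
  assumes "open S" "Ck_on k S f" "\<And>x. x \<in> S \<Longrightarrow> f x = g x"
  shows "Ck_on k S g"
  using assms
proof (induction k arbitrary: f g)
  case 0
  then show ?case by (simp cong: continuous_on_cong)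
next
  case (Suc k)
  have "g differentiable (at x)" if "x \<in> S" for x
  proof -
    have "(f has_derivative frechet_derivative f (at x)) (at x)"
      using Suc.prems that by (simp add: frechet_derivative_works)
    from has_derivative_transform_within_open[OF this assms(1) that] Suc.prems(3) show ?thesis
      by (auto simp: differentiable_def)
  qed
  moreover have "frechet_derivative f (at x) v = frechet_derivative g (at x) v" if "x \<in> S" for x v
    using frechet_derivative_transform_within_open[of f x S g] Suc.prems that by auto
  moreover have "Ck_on k S (\<lambda>x. frechet_derivative g (at x) v)" for v
    using Suc.IH[OF assms(1), of "\<lambda>x. frechet_derivative f (at x) v"] Suc.prems(2) calculation by auto
  ultimately show ?case by simp
qed

lemma Ck_on_subset: "Ck_on k S f \<Longrightarrow> S' \<subseteq> S \<Longrightarrow> Ck_on k S' f"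
  by (induction k arbitrary: f) (auto intro: continuous_on_subset)

lemma Ck_on_local:
  assumes "\<And>x. x \<in> S \<Longrightarrow> \<exists>U. open U \<and> x \<in> U \<and> Ck_on k U f"
  shows "Ck_on k S f"
  using assms
proof (induction k arbitrary: f)
  case 0
  have "continuous (at x within S) f" if x: "x \<in> S" for x
  proof -
    obtain U where "open U" "x \<in> U" "continuous_on U f"
      using 0 x by auto
    then show ?thesis
      using continuous_on_eq_continuous_at continuous_at_imp_continuous_at_within by blast
  qed
  then show ?case by (simp add: continuous_on_eq_continuous_within)
next
  case (Suc k)
  have "Ck_on k S (\<lambda>x. frechet_derivative f (at x) v)" for v
    using Suc.prems by (intro Suc.IH) force
  moreover have "f differentiable (at x)" if "x \<in> S" for x
    using Suc.prems[OF that] by auto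
  ultimately show ?case by simp
qed

lemma Ck_on_Suc_imp: "Ck_on (Suc k) S f \<Longrightarrow> Ck_on k S f"
proof (induction k arbitrary: f)
  case 0
  then show ?case
    by (auto intro!: continuous_at_imp_continuous_on differentiable_imp_continuous_within)
next
  case (Suc k)
  then show ?case by auto
qed

lemma Ck_on_const [simp]: "Ck_on k S (\<lambda>x. c)"
  by (induction k arbitrary: c) auto

lemma frechet_derivative_eqI: "(f has_derivative f') (at x) \<Longrightarrow> frechet_derivative f (at x) = f'"
  by (rule frechet_derivative_at[symmetric])

text \<open>Lets an explicit derivative formula replace the choice made by
  \<open>frechet_derivative\<close>. The closure properties below are inductions on \<open>k\<close>
  in which only this formula changes.\<close>

lemma Ck_on_SucI:
  assumes "open S" "\<And>x. x \<in> S \<Longrightarrow> (f has_derivative f' x) (at x)" "\<And>v. Ck_on k S (\<lambda>x. f' x v)"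
  shows "Ck_on (Suc k) S f"
proof -
  have "frechet_derivative f (at x) = f' x" if "x \<in> S" for x
    using assms(2)[OF that] by (rule frechet_derivative_eqI)
  then have "Ck_on k S (\<lambda>x. frechet_derivative f (at x) v)" for v
    using assms(3)[of v] by (auto intro: Ck_on_cong[OF assms(1)])
  then show ?thesis using assms(2) by (auto simp: differentiable_def)
qed

lemma Ck_on_Suc_has_derivative:
  "Ck_on (Suc k) S f \<Longrightarrow> x \<in> S \<Longrightarrow> (f has_derivative frechet_derivative f (at x)) (at x)"
  by (simp add: frechet_derivative_works)

lemma Ck_on_bounded_linear:
  assumes "bounded_linear L" "open S" "Ck_on k S f"
  shows "Ck_on k S (\<lambda>x. L (f x))"
  using assms(3)
proof (induction k arbitrary: f)
  case 0
  then show ?case using bounded_linear.continuous_on[OF assms(1)] by simp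
next
  case (Suc k)
  show ?case
  proof (rule Ck_on_SucI[OF assms(2)])
    show "((\<lambda>x. L (f x)) has_derivative (\<lambda>v. L (frechet_derivative f (at x) v))) (at x)" if "x \<in> S" for x
      using bounded_linear.has_derivative[OF assms(1) Ck_on_Suc_has_derivative[OF Suc.prems that]] .
    show "Ck_on k S (\<lambda>x. L (frechet_derivative f (at x) v))" for v
      using Suc by simp
  qed
qed

lemma Ck_on_ident: "open S \<Longrightarrow> Ck_on k S (\<lambda>x. x)"
  by (cases k) auto

lemma Ck_on_add:
  assumes "open S" "Ck_on k S f" "Ck_on k S g"
  shows "Ck_on k S (\<lambda>x. f x + g x)"
  using assms(2,3)
proof (induction k arbitrary: f g)
  case 0
  then show ?case by (auto intro: continuous_intros)
next
  case (Suc k)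
  show ?case
  proof (rule Ck_on_SucI[OF assms(1)])
    show "((\<lambda>x. f x + g x) has_derivative
        (\<lambda>v. frechet_derivative f (at x) v + frechet_derivative g (at x) v)) (at x)" if "x \<in> S" for x
      using Suc.prems that by (intro has_derivative_add Ck_on_Suc_has_derivative)
    show "Ck_on k S (\<lambda>x. frechet_derivative f (at x) v + frechet_derivative g (at x) v)" for v
      using Suc by simp
  qed
qed

lemma Ck_on_sum:
  assumes "open S" "\<And>i. i \<in> J \<Longrightarrow> Ck_on k S (f i)"
  shows "Ck_on k S (\<lambda>x. \<Sum>i\<in>J. f i x)"
  using assms(2) by (induction J rule: infinite_finite_induct) (auto intro: Ck_on_add assms(1))

lemma Ck_on_bilinear:
  assumes "bounded_bilinear B" "open S" "Ck_on k S f" "Ck_on k S g"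
  shows "Ck_on k S (\<lambda>x. B (f x) (g x))"
  using assms(3,4)
proof (induction k arbitrary: f g)
  case 0
  then show ?case using bounded_bilinear.continuous_on[OF assms(1)] by simp
next
  case (Suc k)
  show ?case
  proof (rule Ck_on_SucI[OF assms(2)])
    show "((\<lambda>x. B (f x) (g x)) has_derivative
        (\<lambda>v. B (f x) (frechet_derivative g (at x) v) + B (frechet_derivative f (at x) v) (g x))) (at x)"
      if "x \<in> S" for x
      using Suc.prems that
      by (intro bounded_bilinear.FDERIV[OF assms(1)] Ck_on_Suc_has_derivative)
    \<comment> \<open>The product rule pairs an undifferentiated factor with a derivative, so the
      induction hypothesis also needs \<open>f\<close> and \<open>g\<close> themselves at the lower
      order \<open>k\<close>.\<close>
    show "Ck_on k S (\<lambda>x. B (f x) (frechet_derivative g (at x) v) +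
        B (frechet_derivative f (at x) v) (g x))" for v
      using Suc.prems Suc.prems[THEN Ck_on_Suc_imp]
      by (intro Ck_on_add Suc.IH assms(2)) (simp_all only: Ck_on.simps)
  qed
qed

text \<open>By the chain rule the derivative of \<open>f\<close> is applied to a direction that
  depends on \<open>x\<close>, whereas \<open>Ck_on\<close> speaks of fixed directions. Expanding
  that direction in the basis of the Euclidean space in the middle gives a sum of products to which
  the induction hypothesis applies.\<close>

lemma Ck_on_compose:
  fixes g :: "'a::real_normed_vector \<Rightarrow> 'b::euclidean_space"
  assumes "open S" "open T" "Ck_on k T f" "Ck_on k S g" "\<And>x. x \<in> S \<Longrightarrow> g x \<in> T"
  shows "Ck_on k S (\<lambda>x. f (g x))"
  using assms(3,4)
proof (induction k arbitrary: f)
  case 0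
  then show ?case
    using assms(5) by (auto intro: continuous_on_compose2)
next
  case (Suc k)
  define G where "G x v b = frechet_derivative g (at x) v \<bullet> b" for x v b
  show ?case
  proof (rule Ck_on_SucI[OF assms(1)])
    show "((\<lambda>x. f (g x)) has_derivative
       (\<lambda>v. \<Sum>b\<in>Basis. G x v b *\<^sub>R frechet_derivative f (at (g x)) b)) (at x)" if x: "x \<in> S" for x
    proof -
      have f: "(f has_derivative frechet_derivative f (at (g x))) (at (g x))"
        using Ck_on_Suc_has_derivative[OF Suc.prems(1)] assms(5) x by blast
      have "frechet_derivative f (at (g x)) (frechet_derivative g (at x) v) =
          (\<Sum>b\<in>Basis. G x v b *\<^sub>R frechet_derivative f (at (g x)) b)" for v
      proof -
        interpret bounded_linear "frechet_derivative f (at (g x))"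
          using f has_derivative_bounded_linear by blast
        have "frechet_derivative f (at (g x)) (frechet_derivative g (at x) v) =
            frechet_derivative f (at (g x)) (\<Sum>b\<in>Basis. G x v b *\<^sub>R b)"
          by (simp only: G_def euclidean_representation)
        also have "\<dots> = (\<Sum>b\<in>Basis. G x v b *\<^sub>R frechet_derivative f (at (g x)) b)"
          by (simp only: sum scaleR)
        finally show ?thesis .
      qed
      then show ?thesis
        using has_derivative_compose[OF Ck_on_Suc_has_derivative[OF Suc.prems(2) x] f] by simp
    qed
    show "Ck_on k S (\<lambda>x. \<Sum>b\<in>Basis. G x v b *\<^sub>R frechet_derivative f (at (g x)) b)" for v
    proof (intro Ck_on_sum assms(1) Ck_on_bilinear[OF bounded_bilinear_scaleR])
      fix b :: 'b
      show "Ck_on k S (\<lambda>x. G x v b)"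
        unfolding G_def using Suc.prems
        by (intro Ck_on_bounded_linear[OF bounded_linear_inner_left] assms(1)) simp
      show "Ck_on k S (\<lambda>x. frechet_derivative f (at (g x)) b)"
        using Suc.IH[of "\<lambda>y. frechet_derivative f (at y) b"] Suc.prems Ck_on_Suc_imp by auto
    qed
  qed
qed

text \<open>The derivative of \<open>1 / f\<close> is a product of a derivative of \<open>f\<close>
  with two copies of \<open>1 / f\<close>, so the induction hypothesis for \<open>1 / f\<close>
  itself closes the induction.\<close>

lemma Ck_on_divide:
  fixes f :: "'a::real_normed_vector \<Rightarrow> real"
  assumes "open S" "Ck_on k S f" "\<And>x. x \<in> S \<Longrightarrow> f x \<noteq> 0"
  shows "Ck_on k S (\<lambda>x. 1 / f x)"
  using assms(2)
proof (induction k)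
  case 0
  then show ?case using assms(3) by (auto intro!: continuous_intros)
next
  case (Suc k)
  note inv = Suc.IH[OF Ck_on_Suc_imp[OF Suc.prems]]
  show ?case
  proof (rule Ck_on_SucI[OF assms(1)])
    show "((\<lambda>x. 1 / f x) has_derivative
       (\<lambda>v. - 1 * (frechet_derivative f (at x) v * (1 / f x * (1 / f x))))) (at x)" if "x \<in> S" for x
      using has_derivative_divide'[OF has_derivative_const[of "1::real"]
          Ck_on_Suc_has_derivative[OF Suc.prems that]] assms(3)[OF that]
      by (simp add: field_simps)
    show "Ck_on k S (\<lambda>x. - 1 * (frechet_derivative f (at x) v * (1 / f x * (1 / f x))))" for v
      using inv Suc.prems assms(1) by (intro Ck_on_bilinear[OF bounded_bilinear_mult]) auto
  qed
qed

lemma smooth_on_cong: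
  "open S \<Longrightarrow> smooth_on S f \<Longrightarrow> (\<And>x. x \<in> S \<Longrightarrow> f x = g x) \<Longrightarrow> smooth_on S g"
  unfolding smooth_on_def using Ck_on_cong by blast

lemma smooth_on_subset: "smooth_on S f \<Longrightarrow> S' \<subseteq> S \<Longrightarrow> smooth_on S' f"
  unfolding smooth_on_def using Ck_on_subset by blast

lemma smooth_on_local:
  assumes "\<And>x. x \<in> S \<Longrightarrow> \<exists>U. open U \<and> x \<in> U \<and> smooth_on U f"
  shows "smooth_on S f"
  unfolding smooth_on_def
proof
  show "Ck_on k S f" for k
    using assms unfolding smooth_on_def by (intro Ck_on_local) blast
qed

lemma smooth_on_const: "smooth_on S (\<lambda>x. c)"
  unfolding smooth_on_def by simp

lemma smooth_on_ident: "open S \<Longrightarrow> smooth_on S (\<lambda>x. x)"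
  unfolding smooth_on_def using Ck_on_ident by blast

lemma smooth_on_bounded_linear:
  "bounded_linear L \<Longrightarrow> open S \<Longrightarrow> smooth_on S f \<Longrightarrow> smooth_on S (\<lambda>x. L (f x))"
  unfolding smooth_on_def using Ck_on_bounded_linear by blast

lemma smooth_on_add:
  "open S \<Longrightarrow> smooth_on S f \<Longrightarrow> smooth_on S g \<Longrightarrow> smooth_on S (\<lambda>x. f x + g x)"
  unfolding smooth_on_def using Ck_on_add by blast

lemma smooth_on_sum:
  "open S \<Longrightarrow> (\<And>i. i \<in> J \<Longrightarrow> smooth_on S (f i)) \<Longrightarrow> smooth_on S (\<lambda>x. \<Sum>i\<in>J. f i x)"
  by (simp add: smooth_on_def Ck_on_sum)

lemma smooth_on_bilinear:
  "bounded_bilinear B \<Longrightarrow> open S \<Longrightarrow> smooth_on S f \<Longrightarrow> smooth_on S g \<Longrightarrow>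
    smooth_on S (\<lambda>x. B (f x) (g x))"
  unfolding smooth_on_def using Ck_on_bilinear by blast

lemma smooth_on_compose:
  fixes g :: "'a::real_normed_vector \<Rightarrow> 'b::euclidean_space"
  shows "open S \<Longrightarrow> open T \<Longrightarrow> smooth_on T f \<Longrightarrow> smooth_on S g \<Longrightarrow> (\<And>x. x \<in> S \<Longrightarrow> g x \<in> T) \<Longrightarrow>
    smooth_on S (\<lambda>x. f (g x))"
  unfolding smooth_on_def by (metis Ck_on_compose)

lemma smooth_on_divide:
  fixes f :: "'a::real_normed_vector \<Rightarrow> real"
  shows "open S \<Longrightarrow> smooth_on S f \<Longrightarrow> (\<And>x. x \<in> S \<Longrightarrow> f x \<noteq> 0) \<Longrightarrow> smooth_on S (\<lambda>x. 1 / f x)"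
  unfolding smooth_on_def using Ck_on_divide by blast

lemma smooth_on_mult:
  fixes f g :: "'a::real_normed_vector \<Rightarrow> real"
  shows "open S \<Longrightarrow> smooth_on S f \<Longrightarrow> smooth_on S g \<Longrightarrow> smooth_on S (\<lambda>x. f x * g x)"
  by (rule smooth_on_bilinear[OF bounded_bilinear_mult])

lemma smooth_on_prod:
  fixes f :: "'i \<Rightarrow> 'a::real_normed_vector \<Rightarrow> real"
  assumes "open S" "\<And>i. i \<in> J \<Longrightarrow> smooth_on S (f i)"
  shows "smooth_on S (\<lambda>x. \<Prod>i\<in>J. f i x)"
  using assms(2)
  by (induction J rule: infinite_finite_induct) (auto intro: smooth_on_mult smooth_on_const assms(1))

lemma smooth_on_componentwise:
  fixes f :: "'a::real_normed_vector \<Rightarrow> real^'n"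
  assumes "open S"
  shows "smooth_on S f \<longleftrightarrow> (\<forall>k. smooth_on S (\<lambda>x. f x $ k))"
proof
  show "smooth_on S f \<Longrightarrow> \<forall>k. smooth_on S (\<lambda>x. f x $ k)"
    using smooth_on_bounded_linear[OF bounded_linear_vec_nth assms] by blast
  assume *: "\<forall>k. smooth_on S (\<lambda>x. f x $ k)"
  have "smooth_on S (\<lambda>x. \<Sum>k\<in>UNIV. (f x $ k) *\<^sub>R axis k (1::real))"
    using * smooth_on_bounded_linear[OF bounded_linear_scaleR_left assms]
    by (intro smooth_on_sum assms) blast
  moreover have "(\<Sum>k\<in>UNIV. (f x $ k) *\<^sub>R axis k (1::real)) = f x" for x
    using basis_expansion[of "f x"] by (simp add: scalar_mult_eq_scaleR)
  ultimately show "smooth_on S f" by simp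
qed

text \<open>The Leibniz formula makes the determinant a polynomial in the entries. This serves for
  Cramer's rule with smooth coefficients.\<close>

lemma smooth_on_det:
  fixes A :: "'a::real_normed_vector \<Rightarrow> real^'n^'n"
  assumes "open S" "\<And>i j. smooth_on S (\<lambda>x. A x $ i $ j)"
  shows "smooth_on S (\<lambda>x. det (A x))"
  unfolding det_def
  by (intro smooth_on_sum smooth_on_mult smooth_on_prod smooth_on_const assms)

lemma smooth_on_imp_continuous_on: "smooth_on S f \<Longrightarrow> continuous_on S f"
  unfolding smooth_on_def by (drule spec[of _ 0]) simp

lemma smooth_on_imp_differentiable: "smooth_on S f \<Longrightarrow> x \<in> S \<Longrightarrow> f differentiable (at x)"
  unfolding smooth_on_def by (drule spec[of _ "Suc 0"]) simp

lemma smooth_on_has_derivative: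
  "smooth_on S f \<Longrightarrow> x \<in> S \<Longrightarrow> (f has_derivative frechet_derivative f (at x)) (at x)"
  using smooth_on_imp_differentiable frechet_derivative_works by blast

lemma smooth_on_frechet_derivative:
  "smooth_on S f \<Longrightarrow> smooth_on S (\<lambda>x. frechet_derivative f (at x) v)"
  unfolding smooth_on_def
proof
  show "\<forall>k. Ck_on k S f \<Longrightarrow> Ck_on k S (\<lambda>x. frechet_derivative f (at x) v)" for k
    by (drule spec[of _ "Suc k"]) simp
qed

lemma smooth_on_has_real_derivative:
  fixes f :: "real \<Rightarrow> real"
  assumes "smooth_on S f" "x \<in> S"
  shows "(f has_real_derivative deriv f x) (at x)"
  using smooth_on_imp_differentiable[OF assms]
  by (simp add: DERIV_deriv_iff_real_differentiable)

lemma smooth_on_deriv: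
  fixes f :: "real \<Rightarrow> real"
  assumes "open S" "smooth_on S f"
  shows "smooth_on S (deriv f)"
proof (rule smooth_on_cong[OF assms(1) smooth_on_frechet_derivative[OF assms(2), of 1]])
  show "frechet_derivative f (at x) 1 = deriv f x" if "x \<in> S" for x
    using smooth_on_has_real_derivative[OF assms(2) that]
    by (auto simp: has_field_derivative_def dest!: frechet_derivative_eqI)
qed

text \<open>Regularity is bootstrapped: the derivative of \<open>g\<close> is
  \<open>1 / deriv f\<close> composed with \<open>g\<close>, so \<open>g\<close> of order
  \<open>k\<close> has a derivative of order \<open>k\<close>.\<close>

lemma smooth_on_inverse_function:
  fixes f g :: "real \<Rightarrow> real"
  assumes "open S" "open T" "smooth_on S f" "\<And>x. x \<in> S \<Longrightarrow> deriv f x \<noteq> 0"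
    "\<And>y. y \<in> T \<Longrightarrow> g y \<in> S" "\<And>y. y \<in> T \<Longrightarrow> f (g y) = y" "continuous_on T g"
  shows "smooth_on T g"
proof -
  have der: "(g has_real_derivative 1 / deriv f (g y)) (at y)" if "y \<in> T" for y
  proof -
    have nz: "deriv f (g y) \<noteq> 0" using assms that by blast
    have "(g has_derivative (\<lambda>v. 1 / deriv f (g y) * v)) (at y)"
    proof (rule has_derivative_inverse_basic[where f=f and T=T])
      show "(f has_derivative (\<lambda>v. deriv f (g y) * v)) (at (g y))"
        using smooth_on_has_real_derivative[OF assms(3) assms(5)[OF that]]
        by (simp add: has_field_derivative_def)
      show "bounded_linear (\<lambda>v. 1 / deriv f (g y) * v)"
        by (rule bounded_linear_mult_right)
      show "continuous (at y) g"
        using assms(2,7) that continuous_on_eq_continuous_at by blast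
    qed (use nz assms(2,6) that in \<open>auto simp: fun_eq_iff\<close>)
    then show ?thesis unfolding has_field_derivative_def .
  qed
  have "Ck_on k T g" for k
  proof (induction k)
    case 0
    then show ?case using assms(7) by simp
  next
    case (Suc k)
    have d: "smooth_on S (\<lambda>x. 1 / deriv f x)"
      using assms by (intro smooth_on_divide smooth_on_deriv)
    show ?case
    proof (rule Ck_on_SucI[OF assms(2)])
      show "(g has_derivative (\<lambda>v. 1 / deriv f (g y) * v)) (at y)" if "y \<in> T" for y
        using der[OF that] unfolding has_field_derivative_def .
      show "Ck_on k T (\<lambda>y. 1 / deriv f (g y) * v)" for v
        using Ck_on_compose[OF assms(2,1) _ Suc assms(5)] d
        by (intro Ck_on_bilinear[OF bounded_bilinear_mult] assms(2)) (auto simp: smooth_on_def)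
    qed
  qed
  then show ?thesis by (simp add: smooth_on_def)
qed

section \<open>Symmetry of second derivatives\<close>

lemma mean_value_along:
  fixes F :: "'a::real_normed_vector \<Rightarrow> real"
  assumes t: "t > 0" and d: "\<And>s. 0 \<le> s \<Longrightarrow> s \<le> t \<Longrightarrow> F differentiable (at (y + s *\<^sub>R u))"
  obtains s where "0 < s" "s < t"
    "F (y + t *\<^sub>R u) - F y = t * frechet_derivative F (at (y + s *\<^sub>R u)) u"
proof -
  let ?f' = "\<lambda>s k. frechet_derivative F (at (y + s *\<^sub>R u)) (k *\<^sub>R u)"
  have der: "((\<lambda>s. F (y + s *\<^sub>R u)) has_derivative ?f' s) (at s)" if "0 \<le> s" "s \<le> t" for s
  proof (rule has_derivative_compose[where g=F])
    show "((\<lambda>s. y + s *\<^sub>R u) has_derivative (\<lambda>k. k *\<^sub>R u)) (at s)"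
      by (auto intro!: derivative_eq_intros)
    show "(F has_derivative frechet_derivative F (at (y + s *\<^sub>R u))) (at (y + s *\<^sub>R u))"
      using d[OF that] by (simp add: frechet_derivative_works)
  qed
  have "\<exists>s\<in>{0<..<t}. F (y + t *\<^sub>R u) - F (y + 0 *\<^sub>R u) = ?f' s (t - 0)"
    by (rule mvt_simple[where f="\<lambda>s. F (y + s *\<^sub>R u)" and f'="?f'", OF t has_derivative_at_withinI[OF der]])
  then obtain s where s: "0 < s" "s < t" "F (y + t *\<^sub>R u) - F y = ?f' s t" by auto
  have "linear (frechet_derivative F (at (y + s *\<^sub>R u)))"
    using d s by (intro linear_frechet_derivative) auto
  then have "?f' s t = t * frechet_derivative F (at (y + s *\<^sub>R u)) u"
    by (simp add: linear_cmul)
  with s that show thesis by simp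
qed

text \<open>The mean value theorem is applied to \<open>F (x + t *\<^sub>R v) - F x\<close> along
  \<open>u\<close>, and then to the derivative of \<open>F\<close> in direction \<open>u\<close>
  along \<open>v\<close>. The left side is symmetric in \<open>u\<close> and \<open>v\<close>, the
  right side a priori is not.\<close>

lemma mixed_difference:
  fixes F :: "'a::real_normed_vector \<Rightarrow> real"
  assumes F: "smooth_on S F" and t: "t > 0"
    and S: "\<And>a b. 0 \<le> a \<Longrightarrow> a \<le> t \<Longrightarrow> 0 \<le> b \<Longrightarrow> b \<le> t \<Longrightarrow> y + a *\<^sub>R u + b *\<^sub>R v \<in> S"
  obtains a b where "0 < a" "a < t" "0 < b" "b < t"
    "F (y + t *\<^sub>R u + t *\<^sub>R v) - F (y + t *\<^sub>R u) - F (y + t *\<^sub>R v) + F y =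
      t * t * frechet_derivative (\<lambda>x. frechet_derivative F (at x) u) (at (y + a *\<^sub>R u + b *\<^sub>R v)) v"
proof -
  let ?G = "\<lambda>x. F (x + t *\<^sub>R v) - F x"
  have F': "(F has_derivative frechet_derivative F (at x)) (at x)" if "x \<in> S" for x
    using smooth_on_has_derivative[OF F that] .
  have G: "(?G has_derivative (\<lambda>k. frechet_derivative F (at (y + s *\<^sub>R u + t *\<^sub>R v)) k
      - frechet_derivative F (at (y + s *\<^sub>R u)) k)) (at (y + s *\<^sub>R u))" if "0 \<le> s" "s \<le> t" for s
  proof (intro has_derivative_diff)
    have "((\<lambda>x. x + t *\<^sub>R v) has_derivative (\<lambda>k. k)) (at (y + s *\<^sub>R u))"
      by (auto intro!: derivative_eq_intros)
    from has_derivative_compose[OF this F'[OF S[OF that, of t]]]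
    show "((\<lambda>x. F (x + t *\<^sub>R v)) has_derivative frechet_derivative F (at (y + s *\<^sub>R u + t *\<^sub>R v)))
        (at (y + s *\<^sub>R u))"
      using t by simp
    show "(F has_derivative frechet_derivative F (at (y + s *\<^sub>R u))) (at (y + s *\<^sub>R u))"
      using F'[OF S[OF that, of 0]] t by simp
  qed
  obtain a where a: "0 < a" "a < t"
    "?G (y + t *\<^sub>R u) - ?G y = t * frechet_derivative ?G (at (y + a *\<^sub>R u)) u"
    by (rule mean_value_along[OF t, of ?G y u]) (use G in \<open>auto simp: differentiable_def\<close>)
  let ?D = "\<lambda>x. frechet_derivative F (at x) u"
  have "smooth_on S ?D" by (rule smooth_on_frechet_derivative[OF F])
  then have "?D differentiable (at (y + a *\<^sub>R u + s *\<^sub>R v))" if "0 \<le> s" "s \<le> t" for s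
    using smooth_on_imp_differentiable S[of a s] a that by auto
  then obtain b where b: "0 < b" "b < t"
    "?D (y + a *\<^sub>R u + t *\<^sub>R v) - ?D (y + a *\<^sub>R u) =
      t * frechet_derivative ?D (at (y + a *\<^sub>R u + b *\<^sub>R v)) v"
    using mean_value_along[OF t, of ?D "y + a *\<^sub>R u" v] by blast
  have "frechet_derivative ?G (at (y + a *\<^sub>R u)) u =
      ?D (y + a *\<^sub>R u + t *\<^sub>R v) - ?D (y + a *\<^sub>R u)"
    using frechet_derivative_eqI[OF G[of a]] a by simp
  with a b that[of a b] show thesis by (simp add: algebra_simps)
qed

text \<open>One and the same second difference equals \<open>t * t\<close> times either mixed
  derivative, each at some point near \<open>y\<close>. Continuity of both mixed derivatives at
  \<open>y\<close> then leaves an arbitrarily small gap.\<close>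

lemma smooth_on_second_derivative_symmetric:
  fixes F :: "'a::real_normed_vector \<Rightarrow> real"
  assumes "open S" and F: "smooth_on S F" and y: "y \<in> S"
  shows "frechet_derivative (\<lambda>x. frechet_derivative F (at x) u) (at y) v =
    frechet_derivative (\<lambda>x. frechet_derivative F (at x) v) (at y) u"
proof -
  define P where "P u v x = frechet_derivative (\<lambda>x. frechet_derivative F (at x) u) (at x) v" for u v x
  have cont: "continuous (at y) (P u v)" for u v
    unfolding P_def
    using smooth_on_imp_continuous_on[OF smooth_on_frechet_derivative[OF smooth_on_frechet_derivative[OF F]]]
      assms(1) y continuous_on_eq_continuous_at by blast
  have "\<bar>P u v y - P v u y\<bar> \<le> 0 + e" if "e > 0" for e
  proof -
    have ev: "\<forall>\<^sub>F x in nhds y. x \<in> S \<and> dist (P u v x) (P u v y) < e / 2 \<and> dist (P v u x) (P v u y) < e / 2"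
      using cont that assms(1) y
      by (intro eventually_conj eventually_nhds_in_open tendstoD[of _ _ "nhds y"])
         (auto simp: continuous_at tendsto_at_iff_tendsto_nhds)
    then obtain d where d: "d > 0" and dS: "\<And>x. dist x y < d \<Longrightarrow>
        x \<in> S \<and> dist (P u v x) (P u v y) < e / 2 \<and> dist (P v u x) (P v u y) < e / 2"
      unfolding eventually_nhds_metric by blast
    \<comment> \<open>This keeps the whole parallelogram spanned at \<open>y\<close> within distance
      \<open>d\<close>; the summand \<open>1\<close> covers \<open>u = v = 0\<close>.\<close>
    define t where "t = d / (norm u + norm v + 1)"
    have t: "t > 0" using d by (auto simp: t_def intro!: divide_pos_pos add_nonneg_pos)
    have near: "dist (y + a *\<^sub>R u + b *\<^sub>R v) y < d" if "0 \<le> a" "a \<le> t" "0 \<le> b" "b \<le> t" for a b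
    proof -
      have "dist (y + a *\<^sub>R u + b *\<^sub>R v) y \<le> a * norm u + b * norm v"
        using norm_triangle_ineq[of "a *\<^sub>R u" "b *\<^sub>R v"] that by (simp add: dist_norm)
      also have "\<dots> \<le> t * norm u + t * norm v"
        using that by (intro add_mono mult_right_mono) auto
      also have "\<dots> < t * (norm u + norm v + 1)" using t by (simp add: algebra_simps)
      also have "\<dots> = d" by (simp add: t_def add_nonneg_eq_0_iff)
      finally show ?thesis .
    qed
    obtain a b where ab: "0 < a" "a < t" "0 < b" "b < t"
      "F (y + t *\<^sub>R u + t *\<^sub>R v) - F (y + t *\<^sub>R u) - F (y + t *\<^sub>R v) + F y =
        t * t * P u v (y + a *\<^sub>R u + b *\<^sub>R v)"
      by (rule mixed_difference[OF F t, of y u v]) (simp add: near dS, simp add: P_def)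
    have near': "dist (y + a *\<^sub>R v + b *\<^sub>R u) y < d" if "0 \<le> a" "a \<le> t" "0 \<le> b" "b \<le> t" for a b
      using near[OF that(3,4,1,2)] by (simp add: add_ac)
    obtain a' b' where ab': "0 < a'" "a' < t" "0 < b'" "b' < t"
      "F (y + t *\<^sub>R v + t *\<^sub>R u) - F (y + t *\<^sub>R v) - F (y + t *\<^sub>R u) + F y =
        t * t * P v u (y + a' *\<^sub>R v + b' *\<^sub>R u)"
      by (rule mixed_difference[OF F t, of y v u]) (simp add: near' dS, simp add: P_def)
    have "t * t * P u v (y + a *\<^sub>R u + b *\<^sub>R v) = t * t * P v u (y + a' *\<^sub>R v + b' *\<^sub>R u)"
      using ab(5) ab'(5) by (simp add: algebra_simps)
    then have "P u v (y + a *\<^sub>R u + b *\<^sub>R v) = P v u (y + a' *\<^sub>R v + b' *\<^sub>R u)" using t by simp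
    moreover have "dist (P u v (y + a *\<^sub>R u + b *\<^sub>R v)) (P u v y) < e / 2"
      using dS near[of a b] ab by auto
    moreover have "dist (P v u (y + a' *\<^sub>R v + b' *\<^sub>R u)) (P v u y) < e / 2"
      using dS near'[of a' b'] ab' by auto
    ultimately show ?thesis unfolding dist_real_def by linarith
  qed
  then have "\<bar>P u v y - P v u y\<bar> \<le> 0" by (rule field_le_epsilon)
  then show ?thesis by (simp add: P_def)
qed

section \<open>Manifolds with a global chart\<close>

lemma
  assumes "smooth_manifold M" "(U, \<phi>) \<in> charts M"
  shows chart_openin: "openin (mtop M) U"
    and chart_inj_on: "inj_on \<phi> U"
    and chart_open_image: "openin (mtop M) W \<Longrightarrow> open (\<phi> ` (U \<inter> W))"
    and chart_openin_preimage: "open S \<Longrightarrow> openin (mtop M) {p \<in> U. \<phi> p \<in> S}"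
proof -
  have "is_chart (mtop M) (U, \<phi>)"
    using assms unfolding smooth_manifold_def by blast
  then have U: "openin (mtop M) U" and op: "open (\<phi> ` U)"
    and h: "homeomorphic_map (subtopology (mtop M) U) (top_of_set (\<phi> ` U)) \<phi>"
    by (auto simp: is_chart_def)
  have tU: "topspace (subtopology (mtop M) U) = U"
    using openin_subset[OF U] by auto
  show "openin (mtop M) U" by (fact U)
  show "inj_on \<phi> U"
    using h tU unfolding homeomorphic_map_def by simp
  show "open (\<phi> ` (U \<inter> W))" if "openin (mtop M) W"
  proof -
    have "openin (subtopology (mtop M) U) (U \<inter> W)"
      using that by (metis inf_commute openin_subtopology_Int)
    then have "openin (top_of_set (\<phi> ` U)) (\<phi> ` (U \<inter> W))"
      using homeomorphic_imp_open_map[OF h] unfolding open_map_def by blast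
    then show ?thesis using op by (simp add: openin_open_eq)
  qed
  show "openin (mtop M) {p \<in> U. \<phi> p \<in> S}" if "open S"
  proof -
    have "openin (top_of_set (\<phi> ` U)) (\<phi> ` U \<inter> S)"
      using that by (rule openin_open_Int)
    then have "openin (subtopology (mtop M) U) {p \<in> U. \<phi> p \<in> \<phi> ` U \<inter> S}"
      using openin_continuous_map_preimage[OF homeomorphic_imp_continuous_map[OF h]] unfolding tU by blast
    moreover have "{p \<in> U. \<phi> p \<in> \<phi> ` U \<inter> S} = {p \<in> U. \<phi> p \<in> S}" by auto
    ultimately show ?thesis using U openin_trans_full by metis
  qed
qed

lemma chart_subset: "smooth_manifold M \<Longrightarrow> (U, \<phi>) \<in> charts M \<Longrightarrow> U \<subseteq> pts M"
  using chart_openin openin_subset by blast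

lemma charts_compatible:
  assumes "smooth_manifold M" "(U, \<phi>) \<in> charts M" "(U', \<phi>') \<in> charts M"
  shows "smooth_on (\<phi> ` (U \<inter> U')) (\<phi>' \<circ> inv_into U \<phi>)"
proof -
  have "compatible_charts (U, \<phi>) (U', \<phi>')"
    using assms unfolding smooth_manifold_def by blast
  then show ?thesis by (simp add: compatible_charts_def)
qed

lemma smooth_fun_chartD:
  "smooth_fun M W f \<Longrightarrow> (U, \<phi>) \<in> charts M \<Longrightarrow> smooth_on (\<phi> ` (U \<inter> W)) (f \<circ> inv_into U \<phi>)"
  unfolding smooth_fun_def by auto

lemma smooth_at_pts: "smooth_at M p f \<Longrightarrow> p \<in> pts M"
  unfolding smooth_at_def using openin_subset by blast

lemma smooth_fun_imp_smooth_at: "smooth_fun M (pts M) f \<Longrightarrow> p \<in> pts M \<Longrightarrow> smooth_at M p f"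
  unfolding smooth_at_def by blast

lemma vector_fieldsD:
  assumes "V \<in> vector_fields M"
  shows "p \<notin> pts M \<Longrightarrow> V p = (\<lambda>_. 0)" "p \<in> pts M \<Longrightarrow> V p \<in> tangent_space M p"
    "openin (mtop M) W \<Longrightarrow> smooth_fun M W f \<Longrightarrow> smooth_fun M W (\<lambda>p. V p f)"
  using assms unfolding vector_fields_def by auto

lemma linear_expand: "linear L \<Longrightarrow> L w = (\<Sum>k\<in>UNIV. w $ k *\<^sub>R L (axis k (1::real)))" for w :: "real^'m"
proof -
  assume L: "linear L"
  have "L w = L (\<Sum>k\<in>UNIV. (w $ k) *\<^sub>R axis k 1)"
    using basis_expansion[of w] by (simp add: scalar_mult_eq_scaleR)
  then show ?thesis by (simp add: linear_sum[OF L] linear_cmul[OF L])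
qed

locale global_chart =
  fixes M :: "('p, 'n::finite) manifold" and \<theta> :: "'p \<Rightarrow> real^'n"
  assumes smooth_manifold: "smooth_manifold M" and chart: "(pts M, \<theta>) \<in> charts M"
begin

definition pt :: "real^'n \<Rightarrow> 'p" where "pt = inv_into (pts M) \<theta>"

definition D :: "('p \<Rightarrow> real) \<Rightarrow> 'p \<Rightarrow> real^'n \<Rightarrow> real" where
  "D f p = frechet_derivative (f \<circ> pt) (at (\<theta> p))"

definition comps :: "'p vfield \<Rightarrow> 'p \<Rightarrow> real^'n" where
  "comps V p = (\<chi> k. V p (\<lambda>q. \<theta> q $ k))"

definition fld :: "('p \<Rightarrow> real^'n) \<Rightarrow> 'p vfield" where
  "fld v = (\<lambda>p. if p \<in> pts M then coord_vec M (pts M, \<theta>) p (v p) else (\<lambda>_. 0))"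

lemma coord_field_eq_fld: "coord_field M \<theta> i = fld (\<lambda>_. axis i 1)"
  unfolding coord_field_def fld_def ..

lemma inj: "inj_on \<theta> (pts M)"
  using chart_inj_on[OF smooth_manifold chart] .

lemma pt_\<theta>: "p \<in> pts M \<Longrightarrow> pt (\<theta> p) = p"
  unfolding pt_def using inj by simp

lemma \<theta>_pt: "y \<in> \<theta> ` pts M \<Longrightarrow> \<theta> (pt y) = y"
  unfolding pt_def by (rule f_inv_into_f)

lemma pt_in: "y \<in> \<theta> ` pts M \<Longrightarrow> pt y \<in> pts M"
  unfolding pt_def by (rule inv_into_into)

lemma open_image: "openin (mtop M) W \<Longrightarrow> open (\<theta> ` W)"
  using chart_open_image[OF smooth_manifold chart, of W] openin_subset[of "mtop M" W]
  by (simp add: Int_absorb1)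

lemma open_domain: "open (\<theta> ` pts M)"
  by (rule open_image) simp

text \<open>In any other chart \<open>f\<close> is \<open>f \<circ> pt\<close> composed with the
  transition map to \<open>\<theta>\<close>, so a single chart decides smoothness.\<close>

lemma smooth_fun_iff:
  fixes f :: "'p \<Rightarrow> 'b::real_normed_vector"
  assumes W: "openin (mtop M) W"
  shows "smooth_fun M W f \<longleftrightarrow> smooth_on (\<theta> ` W) (f \<circ> pt)"
proof
  have WM: "W \<subseteq> pts M" using W openin_subset by blast
  then have *: "pts M \<inter> W = W" by blast
  show "smooth_fun M W f \<Longrightarrow> smooth_on (\<theta> ` W) (f \<circ> pt)"
    using smooth_fun_chartD[OF _ chart, of W f] unfolding pt_def * .
  assume f: "smooth_on (\<theta> ` W) (f \<circ> pt)"
  have "smooth_on (\<phi> ` (U \<inter> W)) (f \<circ> inv_into U \<phi>)" if c: "(U, \<phi>) \<in> charts M" for U \<phi>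
  proof -
    note U = chart_subset[OF smooth_manifold c]
    have op: "open (\<phi> ` (U \<inter> W))" by (rule chart_open_image[OF smooth_manifold c W])
    have "smooth_on (\<phi> ` (U \<inter> W)) (\<theta> \<circ> inv_into U \<phi>)"
      using charts_compatible[OF smooth_manifold c chart] by (rule smooth_on_subset) (use WM in auto)
    moreover have inv: "inv_into U \<phi> (\<phi> q) = q" if "q \<in> U" for q
      using chart_inj_on[OF smooth_manifold c] that by simp
    ultimately have "smooth_on (\<phi> ` (U \<inter> W)) (\<lambda>y. (f \<circ> pt) ((\<theta> \<circ> inv_into U \<phi>) y))"
      by (intro smooth_on_compose[OF op open_image[OF W] f]) (auto simp: o_def)
    then show ?thesis
      by (rule smooth_on_cong[OF op]) (use inv pt_\<theta> WM in auto)
  qed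
  then show "smooth_fun M W f" unfolding smooth_fun_def by auto
qed

lemmas smooth_iff = smooth_fun_iff[OF openin_topspace]

lemma smooth_cong:
  assumes "smooth_fun M (pts M) f" "\<And>p. p \<in> pts M \<Longrightarrow> f p = g p"
  shows "smooth_fun M (pts M) g"
  using assms(1) unfolding smooth_iff
  by (rule smooth_on_cong[OF open_domain]) (use assms(2) pt_in in auto)

lemma smooth_const: "smooth_fun M (pts M) (\<lambda>_. c)"
  unfolding smooth_iff o_def by (rule smooth_on_const)

lemma smooth_add:
  "smooth_fun M (pts M) f \<Longrightarrow> smooth_fun M (pts M) g \<Longrightarrow> smooth_fun M (pts M) (\<lambda>p. f p + g p)"
  unfolding smooth_iff o_def by (rule smooth_on_add[OF open_domain])

lemma smooth_sum:
  "(\<And>i. i \<in> J \<Longrightarrow> smooth_fun M (pts M) (f i)) \<Longrightarrow> smooth_fun M (pts M) (\<lambda>p. \<Sum>i\<in>J. f i p)"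
  unfolding smooth_iff o_def by (rule smooth_on_sum[OF open_domain])

lemma smooth_mult:
  fixes f g :: "'p \<Rightarrow> real"
  shows "smooth_fun M (pts M) f \<Longrightarrow> smooth_fun M (pts M) g \<Longrightarrow>
    smooth_fun M (pts M) (\<lambda>p. f p * g p)"
  unfolding smooth_iff o_def by (rule smooth_on_mult[OF open_domain])

lemma smooth_divide:
  fixes f :: "'p \<Rightarrow> real"
  assumes "smooth_fun M (pts M) f" "\<And>p. p \<in> pts M \<Longrightarrow> f p \<noteq> 0"
  shows "smooth_fun M (pts M) (\<lambda>p. 1 / f p)"
  using assms pt_in unfolding smooth_iff o_def by (intro smooth_on_divide[OF open_domain]) auto

lemma smooth_componentwise:
  fixes f :: "'p \<Rightarrow> real^'m"
  shows "smooth_fun M (pts M) f \<longleftrightarrow> (\<forall>k. smooth_fun M (pts M) (\<lambda>p. f p $ k))"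
  unfolding smooth_iff o_def by (rule smooth_on_componentwise[OF open_domain])

lemma smooth_det:
  fixes A :: "'p \<Rightarrow> real^'m^'m"
  shows "(\<And>i j. smooth_fun M (pts M) (\<lambda>p. A p $ i $ j)) \<Longrightarrow> smooth_fun M (pts M) (\<lambda>p. det (A p))"
  unfolding smooth_iff o_def by (rule smooth_on_det[OF open_domain])

lemma smooth_compose:
  fixes f :: "'p \<Rightarrow> real"
  assumes "open J" "smooth_on J F" "smooth_fun M (pts M) f" "\<And>p. p \<in> pts M \<Longrightarrow> f p \<in> J"
  shows "smooth_fun M (pts M) (\<lambda>p. F (f p))"
  using assms(3,4) pt_in unfolding smooth_iff o_def
  by (intro smooth_on_compose[OF open_domain assms(1,2)]) auto

lemma smooth_\<theta>: "smooth_fun M (pts M) \<theta>"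
  unfolding smooth_iff o_def
  by (rule smooth_on_cong[OF open_domain smooth_on_ident[OF open_domain]]) (simp add: \<theta>_pt)

lemma smooth_\<theta>_nth: "smooth_fun M (pts M) (\<lambda>p. \<theta> p $ k)"
  using smooth_\<theta> unfolding smooth_componentwise by blast

section \<open>Tangent vectors and vector fields in the global chart\<close>

lemma D_has_derivative:
  assumes "smooth_at M p f"
  shows "((f \<circ> pt) has_derivative D f p) (at (\<theta> p))"
proof -
  obtain W where W: "openin (mtop M) W" "p \<in> W" "smooth_fun M W f"
    using assms unfolding smooth_at_def by blast
  then have "smooth_on (\<theta> ` W) (f \<circ> pt)" using smooth_fun_iff by blast
  then show ?thesis using W(2) unfolding D_def by (auto intro: smooth_on_has_derivative)
qed

lemma D_eqI: "p \<in> pts M \<Longrightarrow> ((f \<circ> pt) has_derivative d) (at (\<theta> p)) \<Longrightarrow> D f p = d"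
  unfolding D_def by (rule frechet_derivative_eqI)

lemma D_linear: "smooth_at M p f \<Longrightarrow> linear (D f p)"
  using D_has_derivative has_derivative_linear by blast

lemma coord_vec_eq: "coord_vec M (pts M, \<theta>) p w f = (if smooth_at M p f then D f p w else 0)"
  unfolding coord_vec_def D_def pt_def by simp

text \<open>The chain rule for the transition map from \<open>\<phi>\<close> to
  \<open>\<theta>\<close>: the new direction \<open>?w\<close> is the image of the old direction
  \<open>u\<close> under its derivative.\<close>

lemma tangent_space_global:
  assumes "v \<in> tangent_space M p"
  obtains w where "v = coord_vec M (pts M, \<theta>) p w"
proof -
  obtain U \<phi> u where c: "(U, \<phi>) \<in> charts M" and p: "p \<in> U" and v: "v = coord_vec M (U, \<phi>) p u"
    using assms unfolding tangent_space_def by auto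
  let ?w = "frechet_derivative (\<theta> \<circ> inv_into U \<phi>) (at (\<phi> p)) u"
  have inv: "inv_into U \<phi> (\<phi> q) = q" if "q \<in> U" for q
    using chart_inj_on[OF smooth_manifold c] that by simp
  have UM: "U \<subseteq> pts M" by (rule chart_subset[OF smooth_manifold c])
  have op: "open (\<phi> ` U)"
    using chart_open_image[OF smooth_manifold c openin_topspace] UM by (simp add: Int_absorb2)
  have "frechet_derivative (f \<circ> inv_into U \<phi>) (at (\<phi> p)) u = D f p ?w" if f: "smooth_at M p f" for f
  proof -
    have 1: "((\<theta> \<circ> inv_into U \<phi>) has_derivative frechet_derivative (\<theta> \<circ> inv_into U \<phi>) (at (\<phi> p))) (at (\<phi> p))"
      using charts_compatible[OF smooth_manifold c chart]
      by (rule smooth_on_has_derivative) (use p UM in auto)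
    have "((\<lambda>y. (f \<circ> pt) ((\<theta> \<circ> inv_into U \<phi>) y)) has_derivative
        (\<lambda>u. D f p (frechet_derivative (\<theta> \<circ> inv_into U \<phi>) (at (\<phi> p)) u))) (at (\<phi> p))"
      by (rule has_derivative_compose[OF 1]) (use D_has_derivative[OF f] inv[OF p] in \<open>simp add: o_def\<close>)
    then have "((f \<circ> inv_into U \<phi>) has_derivative
        (\<lambda>u. D f p (frechet_derivative (\<theta> \<circ> inv_into U \<phi>) (at (\<phi> p)) u))) (at (\<phi> p))"
      by (rule has_derivative_transform_within_open[OF _ op]) (use p inv UM pt_\<theta> in auto)
    then show ?thesis by (simp add: frechet_derivative_eqI)
  qed
  then have "v = coord_vec M (pts M, \<theta>) p ?w"
    unfolding v by (intro ext) (simp add: coord_vec_eq, simp add: coord_vec_def)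
  then show thesis by (rule that)
qed

lemma D_\<theta>_nth: "p \<in> pts M \<Longrightarrow> D (\<lambda>q. \<theta> q $ k) p w = w $ k"
proof -
  assume p: "p \<in> pts M"
  have "((\<lambda>y. y $ k) has_derivative (\<lambda>w. w $ k)) (at (\<theta> p))"
    by (rule bounded_linear_imp_has_derivative[OF bounded_linear_vec_nth])
  then have "(((\<lambda>q. \<theta> q $ k) \<circ> pt) has_derivative (\<lambda>w. w $ k)) (at (\<theta> p))"
    by (rule has_derivative_transform_within_open[OF _ open_domain]) (use p \<theta>_pt in auto)
  then show ?thesis using D_eqI[OF p] by simp
qed

text \<open>The tangent vector at \<open>p\<close> is given by some direction in the global chart;
  evaluating it on the coordinate functions shows that this direction is
  \<open>comps V p\<close>.\<close>

lemma field_coord_vec: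
  assumes V: "V \<in> vector_fields M" and p: "p \<in> pts M"
  shows "V p = coord_vec M (pts M, \<theta>) p (comps V p)"
proof -
  obtain w where w: "V p = coord_vec M (pts M, \<theta>) p w"
    using tangent_space_global[OF vector_fieldsD(2)[OF V p]] .
  have "comps V p = w"
    using D_\<theta>_nth[OF p] smooth_fun_imp_smooth_at[OF smooth_\<theta>_nth p]
    by (simp add: comps_def w coord_vec_eq vec_eq_iff)
  then show ?thesis using w by simp
qed

lemma field_apply:
  assumes "V \<in> vector_fields M" "smooth_at M p f"
  shows "V p f = D f p (comps V p)"
  using field_coord_vec[OF assms(1) smooth_at_pts[OF assms(2)]] assms(2) by (simp add: coord_vec_eq)

lemma field_not_smooth: "V \<in> vector_fields M \<Longrightarrow> \<not> smooth_at M p f \<Longrightarrow> V p f = 0"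
  by (cases "p \<in> pts M") (simp_all add: field_coord_vec coord_vec_eq vector_fieldsD(1))

lemma field_eqI:
  assumes "V \<in> vector_fields M" "W \<in> vector_fields M" "p \<in> pts M" "comps V p = comps W p"
  shows "V p = W p"
  using assms by (simp add: field_coord_vec)

lemma vector_field_eqI:
  assumes "V \<in> vector_fields M" "W \<in> vector_fields M" "\<And>p. p \<in> pts M \<Longrightarrow> comps V p = comps W p"
  shows "V = W"
proof
  show "V p = W p" for p
  proof (cases "p \<in> pts M")
    case True
    then show ?thesis by (intro field_eqI assms)
  next
    case False
    then show ?thesis by (simp add: vector_fieldsD(1)[OF assms(1)] vector_fieldsD(1)[OF assms(2)])
  qed
qed

lemma smooth_comps_nth: "V \<in> vector_fields M \<Longrightarrow> smooth_fun M (pts M) (\<lambda>p. comps V p $ k)"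
  unfolding comps_def using vector_fieldsD(3)[OF _ openin_topspace smooth_\<theta>_nth] by simp

lemma smooth_comps: "V \<in> vector_fields M \<Longrightarrow> smooth_fun M (pts M) (comps V)"
  unfolding smooth_componentwise using smooth_comps_nth by blast

text \<open>On functions smooth on an open set the operator is the sum of the partial derivatives
  with the components of \<open>v\<close> as coefficients, and these coefficients are
  smooth.\<close>

lemma
  assumes v: "smooth_fun M (pts M) v"
  shows fld_vector_field: "fld v \<in> vector_fields M"
    and comps_fld: "p \<in> pts M \<Longrightarrow> comps (fld v) p = v p"
proof -
  have sm: "smooth_fun M W (\<lambda>p. fld v p f)" if W: "openin (mtop M) W" and f: "smooth_fun M W f" for W f
  proof -
    have WM: "W \<subseteq> pts M" using W openin_subset by blast
    have F: "smooth_on (\<theta> ` W) (f \<circ> pt)" using f smooth_fun_iff[OF W] by blast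
    have "fld v q f = (\<Sum>k\<in>UNIV. v q $ k * frechet_derivative (f \<circ> pt) (at (\<theta> q)) (axis k 1))"
      if "q \<in> W" for q
    proof -
      have q: "smooth_at M q f" using W f that unfolding smooth_at_def by blast
      then have "fld v q f = D f q (v q)" using that WM by (auto simp: fld_def coord_vec_eq)
      also have "\<dots> = (\<Sum>k\<in>UNIV. v q $ k * D f q (axis k 1))"
        by (subst linear_expand[OF D_linear[OF q]]) simp
      finally show ?thesis unfolding D_def .
    qed
    moreover have "smooth_on (\<theta> ` W) (\<lambda>y. \<Sum>k\<in>UNIV. v (pt y) $ k *
        frechet_derivative (f \<circ> pt) (at y) (axis k 1))"
    proof (intro smooth_on_sum smooth_on_mult smooth_on_frechet_derivative F open_image W)
      fix k
      have "smooth_on (\<theta> ` pts M) (\<lambda>y. v (pt y) $ k)"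
        using v unfolding smooth_componentwise smooth_iff o_def by blast
      then show "smooth_on (\<theta> ` W) (\<lambda>y. v (pt y) $ k)"
        by (rule smooth_on_subset) (use WM in auto)
    qed
    ultimately show ?thesis
      unfolding smooth_fun_iff[OF W]
      by (elim smooth_on_cong[OF open_image[OF W]]) (use WM pt_\<theta> in auto)
  qed
  show vf: "fld v \<in> vector_fields M"
    unfolding vector_fields_def
  proof (intro CollectI conjI allI ballI impI)
    show "fld v p = (\<lambda>_. 0)" if "p \<notin> pts M" for p using that by (simp add: fld_def)
    show "fld v p \<in> tangent_space M p" if "p \<in> pts M" for p
      using that chart unfolding tangent_space_def fld_def by force
    show "smooth_fun M W (\<lambda>p. fld v p f)" if "openin (mtop M) W \<and> smooth_fun M W f" for W f
      using sm that by blast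
  qed
  show "comps (fld v) p = v p" if p: "p \<in> pts M"
    using p D_\<theta>_nth[OF p] smooth_fun_imp_smooth_at[OF smooth_\<theta>_nth p]
    by (simp add: comps_def fld_def coord_vec_eq vec_eq_iff)
qed

text \<open>Fields are compared as operators on all functions, including those not smooth at the
  point; the value 0 there is what makes \<open>V\<close> equal to \<open>fld v\<close>.\<close>

lemma
  assumes v: "smooth_fun M (pts M) v"
    and 1: "\<And>p f. smooth_at M p f \<Longrightarrow> V p f = D f p (v p)"
    and 0: "\<And>p f. \<not> smooth_at M p f \<Longrightarrow> V p f = 0"
  shows vector_fieldI: "V \<in> vector_fields M" and comps_vector_fieldI: "p \<in> pts M \<Longrightarrow> comps V p = v p"
proof -
  have "V p f = fld v p f" for p f
    using 1 0 by (cases "smooth_at M p f") (auto simp: fld_def coord_vec_eq dest: smooth_at_pts)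
  then have "V = fld v" by blast
  then show "V \<in> vector_fields M" "p \<in> pts M \<Longrightarrow> comps V p = v p"
    using fld_vector_field[OF v] comps_fld[OF v] by auto
qed

lemma smooth_fun_cong:
  assumes W: "openin (mtop M) W" and f: "smooth_fun M W f"
    and eq: "\<And>q. q \<in> pts M \<Longrightarrow> f q = g q"
  shows "smooth_fun M W g"
proof -
  have 1: "smooth_on (\<theta> ` W) (f \<circ> pt)" using smooth_fun_iff[OF W] f by blast
  have "smooth_on (\<theta> ` W) (g \<circ> pt)"
  proof (rule smooth_on_cong[OF open_image[OF W] 1])
    fix y assume y: "y \<in> \<theta> ` W"
    have "\<theta> ` W \<subseteq> \<theta> ` pts M" using openin_subset[OF W] by (rule image_mono)
    then have "y \<in> \<theta> ` pts M" using y by (rule subsetD)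
    then have "pt y \<in> pts M" by (rule pt_in)
    then show "(f \<circ> pt) y = (g \<circ> pt) y" unfolding o_def by (rule eq)
  qed
  then show ?thesis using smooth_fun_iff[OF W] by blast
qed

lemma smooth_at_cong:
  assumes "\<And>q. q \<in> pts M \<Longrightarrow> f q = g q"
  shows "smooth_at M p f \<longleftrightarrow> smooth_at M p g"
  unfolding smooth_at_def
  using smooth_fun_cong[of _ f g] smooth_fun_cong[of _ g f] assms by metis

text \<open>Permits rewriting under a field when an identity holds on \<open>pts M\<close> only.
  Where the functions fail to be smooth, they fail together and both values are 0.\<close>

lemma field_cong:
  assumes V: "V \<in> vector_fields M" and p: "p \<in> pts M" and eq: "\<And>q. q \<in> pts M \<Longrightarrow> f q = g q"
  shows "V p f = V p g"
proof -
  note sm = smooth_at_cong[of f g p, OF eq]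
  show ?thesis
  proof (cases "smooth_at M p f")
    case True
    have "((g \<circ> pt) has_derivative D f p) (at (\<theta> p))"
      by (rule has_derivative_transform_within_open[OF D_has_derivative[OF True] open_domain])
         (simp_all add: p eq pt_in)
    then have "D g p = D f p" using D_eqI[OF p] by blast
    then show ?thesis using field_apply[OF V] True sm by simp
  next
    case False
    then show ?thesis using sm field_not_smooth[OF V] by simp
  qed
qed

lemma field_has_derivative:
  assumes "V \<in> vector_fields M" "p \<in> pts M" "smooth_fun M (pts M) f"
    "((f \<circ> pt) has_derivative d) (at (\<theta> p))"
  shows "V p f = d (comps V p)"
  using field_apply[OF assms(1) smooth_fun_imp_smooth_at[OF assms(3,2)]] D_eqI[OF assms(2,4)] by simp

lemma field_smooth:
  "V \<in> vector_fields M \<Longrightarrow> smooth_fun M (pts M) f \<Longrightarrow> smooth_fun M (pts M) (\<lambda>q. V q f)"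
  by (rule vector_fieldsD(3)[OF _ openin_topspace])

context
  fixes V p
  assumes V: "V \<in> vector_fields M" and p: "p \<in> pts M"
begin

lemma field_const: "V p (\<lambda>_. c) = 0"
  using field_has_derivative[OF V p smooth_const[of c], of "\<lambda>_. 0"] by (simp add: o_def)

lemma field_add:
  assumes f: "smooth_fun M (pts M) f" and g: "smooth_fun M (pts M) g"
  shows "V p (\<lambda>q. f q + g q) = V p f + V p g"
proof -
  have s: "smooth_at M p f" "smooth_at M p g" using f g smooth_fun_imp_smooth_at[OF _ p] by blast+
  have "(((\<lambda>q. f q + g q) \<circ> pt) has_derivative (\<lambda>w. D f p w + D g p w)) (at (\<theta> p))"
    using has_derivative_add[OF s[THEN D_has_derivative]] by (simp add: o_def)
  from field_has_derivative[OF V p smooth_add[OF f g] this] show ?thesis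
    using field_apply[OF V] s by simp
qed

lemma field_mult:
  assumes f: "smooth_fun M (pts M) f" and g: "smooth_fun M (pts M) g"
  shows "V p (\<lambda>q. f q * g q) = f p * V p g + V p f * g p"
proof -
  have s: "smooth_at M p f" "smooth_at M p g" using f g smooth_fun_imp_smooth_at[OF _ p] by blast+
  have "(((\<lambda>q. f q * g q) \<circ> pt) has_derivative (\<lambda>w. f p * D g p w + D f p w * g p)) (at (\<theta> p))"
    using has_derivative_mult[OF s[THEN D_has_derivative]] p by (simp add: o_def pt_\<theta>)
  from field_has_derivative[OF V p smooth_mult[OF f g] this] show ?thesis
    using field_apply[OF V] s by simp
qed

lemma field_cmult: "smooth_fun M (pts M) f \<Longrightarrow> V p (\<lambda>q. c * f q) = c * V p f"
  using field_mult[OF smooth_const[of c], of f] field_const by simp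

lemma field_sum:
  "finite J \<Longrightarrow> (\<And>i. i \<in> J \<Longrightarrow> smooth_fun M (pts M) (f i)) \<Longrightarrow>
    V p (\<lambda>q. \<Sum>i\<in>J. f i q) = (\<Sum>i\<in>J. V p (f i))"
  by (induction J rule: finite_induct) (simp_all add: field_const field_add smooth_sum)

lemma field_compose:
  fixes F :: "real \<Rightarrow> real"
  assumes J: "open J" and F: "smooth_on J F" and f: "smooth_fun M (pts M) f"
    and fJ: "\<And>q. q \<in> pts M \<Longrightarrow> f q \<in> J"
  shows "V p (\<lambda>q. F (f q)) = deriv F (f p) * V p f"
proof -
  have s: "smooth_at M p f" using f smooth_fun_imp_smooth_at[OF _ p] by blast
  have F': "(F has_derivative (\<lambda>t. deriv F (f p) * t)) (at ((f \<circ> pt) (\<theta> p)))"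
    using smooth_on_has_real_derivative[OF F fJ[OF p]] p by (simp add: pt_\<theta> has_field_derivative_def)
  have "(((\<lambda>q. F (f q)) \<circ> pt) has_derivative (\<lambda>w. deriv F (f p) * D f p w)) (at (\<theta> p))"
    using has_derivative_compose[OF D_has_derivative[OF s] F'] by (simp add: o_def)
  from field_has_derivative[OF V p smooth_compose[OF J F f fJ] this] show ?thesis
    using field_apply[OF V] s by simp
qed

end

section \<open>Sums, multiples and Lie brackets of fields, and the flat connection of the
  chart\<close>

lemma
  assumes V: "V \<in> vector_fields M" and W: "W \<in> vector_fields M"
  shows vadd_vector_field: "vadd V W \<in> vector_fields M"
    and comps_vadd: "comps (vadd V W) p = comps V p + comps W p"
proof -
  show "vadd V W \<in> vector_fields M"
  proof (rule vector_fieldI[of "\<lambda>p. comps V p + comps W p"])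
    show "vadd V W p f = D f p (comps V p + comps W p)" if "smooth_at M p f" for p f
      using that field_apply[OF V that] field_apply[OF W that]
      by (simp add: vadd_def linear_add[OF D_linear])
  qed (use V W in \<open>auto simp: vadd_def field_not_smooth intro: smooth_add smooth_comps\<close>)
  show "comps (vadd V W) p = comps V p + comps W p"
    by (simp add: comps_def vadd_def vec_eq_iff)
qed

lemma
  assumes u: "smooth_fun M (pts M) u" and V: "V \<in> vector_fields M"
  shows vscale_vector_field: "vscale u V \<in> vector_fields M"
    and comps_vscale: "comps (vscale u V) p = u p *\<^sub>R comps V p"
proof -
  show "vscale u V \<in> vector_fields M"
  proof (rule vector_fieldI[of "\<lambda>p. u p *\<^sub>R comps V p"])
    show "smooth_fun M (pts M) (\<lambda>p. u p *\<^sub>R comps V p)"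
      unfolding smooth_componentwise using smooth_mult[OF u smooth_comps_nth[OF V]] by simp
    show "vscale u V p f = D f p (u p *\<^sub>R comps V p)" if "smooth_at M p f" for p f
      using field_apply[OF V that] by (simp add: vscale_def linear_cmul[OF D_linear[OF that]])
  qed (use V in \<open>auto simp: vscale_def field_not_smooth\<close>)
  show "comps (vscale u V) p = u p *\<^sub>R comps V p"
    by (simp add: comps_def vscale_def vec_eq_iff)
qed

text \<open>The second summand is symmetric in \<open>V\<close> and \<open>W\<close> by Schwarz's theorem; it is the Hessian of \<open>f\<close>
  with respect to the flat connection of the chart.\<close>

lemma field_field_apply:
  assumes V: "V \<in> vector_fields M" and W: "W \<in> vector_fields M" and f: "smooth_at M p f"
  shows "V p (\<lambda>q. W q f) = D f p (\<chi> k. V p (\<lambda>q. comps W q $ k)) +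
    frechet_derivative (\<lambda>y. frechet_derivative (f \<circ> pt) (at y) (comps V p)) (at (\<theta> p)) (comps W p)"
proof -
  have p: "p \<in> pts M" by (rule smooth_at_pts[OF f])
  obtain O' where O': "openin (mtop M) O'" "p \<in> O'" "smooth_fun M O' f"
    using f unfolding smooth_at_def by blast
  have OM: "O' \<subseteq> pts M" using O'(1) openin_subset by blast
  let ?F = "f \<circ> pt"
  let ?v = "comps V p" and ?w = "comps W p"
  let ?S = "\<theta> ` O'"
  have S: "open ?S" and pS: "\<theta> p \<in> ?S" using open_image O' by auto
  have F: "smooth_on ?S ?F" using O' smooth_fun_iff by blast
  let ?P = "\<lambda>u. \<lambda>y. frechet_derivative ?F (at y) u"
  have P: "(?P u has_derivative frechet_derivative (?P u) (at (\<theta> p))) (at (\<theta> p))" for u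
    by (rule smooth_on_has_derivative[OF smooth_on_frechet_derivative[OF F] pS])
  have w: "(((\<lambda>q. comps W q $ k) \<circ> pt) has_derivative D (\<lambda>q. comps W q $ k) p) (at (\<theta> p))" for k
    by (intro D_has_derivative smooth_fun_imp_smooth_at smooth_comps_nth W p)
  have sm: "smooth_at M p (\<lambda>q. W q f)"
    using O' vector_fieldsD(3)[OF W] unfolding smooth_at_def by blast
  have eq: "(\<Sum>k\<in>UNIV. ((\<lambda>q. comps W q $ k) \<circ> pt) y * ?P (axis k 1) y) = ((\<lambda>q. W q f) \<circ> pt) y" if y: "y \<in> ?S" for y
  proof -
    have q: "pt y \<in> O'" "\<theta> (pt y) = y" using y OM pt_\<theta> by auto
    then have s: "smooth_at M (pt y) f" using O' unfolding smooth_at_def by blast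
    have "W (pt y) f = D f (pt y) (comps W (pt y))" by (rule field_apply[OF W s])
    also have "\<dots> = (\<Sum>k\<in>UNIV. comps W (pt y) $ k *\<^sub>R D f (pt y) (axis k 1))"
      by (rule linear_expand[OF D_linear[OF s]])
    finally show ?thesis using q by (simp add: D_def)
  qed
  have "((\<lambda>y. \<Sum>k\<in>UNIV. ((\<lambda>q. comps W q $ k) \<circ> pt) y * ?P (axis k 1) y) has_derivative
      (\<lambda>u. \<Sum>k\<in>UNIV. ((\<lambda>q. comps W q $ k) \<circ> pt) (\<theta> p) * frechet_derivative (?P (axis k 1)) (at (\<theta> p)) u +
        D (\<lambda>q. comps W q $ k) p u * ?P (axis k 1) (\<theta> p))) (at (\<theta> p))"
    by (intro has_derivative_sum has_derivative_mult w P)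
  then have "(((\<lambda>q. W q f) \<circ> pt) has_derivative
      (\<lambda>u. \<Sum>k\<in>UNIV. ((\<lambda>q. comps W q $ k) \<circ> pt) (\<theta> p) * frechet_derivative (?P (axis k 1)) (at (\<theta> p)) u +
        D (\<lambda>q. comps W q $ k) p u * ?P (axis k 1) (\<theta> p))) (at (\<theta> p))"
    by (rule has_derivative_transform_within_open[OF _ S pS eq])
  then have "V p (\<lambda>q. W q f) = (\<Sum>k\<in>UNIV. ?w $ k * frechet_derivative (?P (axis k 1)) (at (\<theta> p)) ?v +
        D (\<lambda>q. comps W q $ k) p ?v * ?P (axis k 1) (\<theta> p))"
    using field_apply[OF V sm] D_eqI[OF p] pt_\<theta>[OF p] by simp
  \<comment> \<open>Schwarz moves \<open>axis k 1\<close> from the inner to the outer derivative,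
    after which the sum over \<open>k\<close> reassembles to the direction \<open>?w\<close> by
    linearity.\<close>
  also have "\<dots> = (\<Sum>k\<in>UNIV. D (\<lambda>q. comps W q $ k) p ?v *\<^sub>R D f p (axis k 1)) +
      (\<Sum>k\<in>UNIV. ?w $ k *\<^sub>R frechet_derivative (?P ?v) (at (\<theta> p)) (axis k 1))"
    using smooth_on_second_derivative_symmetric[OF S F pS, of "axis _ 1" ?v]
    by (simp add: sum.distrib D_def add.commute)
  also have "(\<Sum>k\<in>UNIV. D (\<lambda>q. comps W q $ k) p ?v *\<^sub>R D f p (axis k 1)) =
      D f p (\<chi> k. V p (\<lambda>q. comps W q $ k))"
    using linear_expand[OF D_linear[OF f], of "\<chi> k. V p (\<lambda>q. comps W q $ k)"]
      field_apply[OF V smooth_fun_imp_smooth_at[OF smooth_comps_nth[OF W] p]] by simp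
  also have "(\<Sum>k\<in>UNIV. ?w $ k *\<^sub>R frechet_derivative (?P ?v) (at (\<theta> p)) (axis k 1)) =
      frechet_derivative (?P ?v) (at (\<theta> p)) ?w"
    by (rule linear_expand[OF has_derivative_linear[OF P[of ?v]], symmetric])
  finally show ?thesis .
qed

text \<open>The second-order terms of the two iterated derivatives coincide by Schwarz and cancel,
  which leaves a first-order operator.\<close>

lemma
  assumes V: "V \<in> vector_fields M" and W: "W \<in> vector_fields M"
  shows lie_bracket_vector_field: "lie_bracket M V W \<in> vector_fields M"
    and comps_lie_bracket: "p \<in> pts M \<Longrightarrow> comps (lie_bracket M V W) p $ k =
      V p (\<lambda>q. comps W q $ k) - W p (\<lambda>q. comps V q $ k)"
proof -
  let ?u = "\<lambda>p. \<chi> k. V p (\<lambda>q. comps W q $ k) + - 1 * W p (\<lambda>q. comps V q $ k)"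
  have "smooth_fun M (pts M) (\<lambda>p. V p (\<lambda>q. comps W q $ k) + - 1 * W p (\<lambda>q. comps V q $ k))" for k
    by (rule smooth_add[OF field_smooth[OF V smooth_comps_nth[OF W]]
          smooth_mult[OF smooth_const field_smooth[OF W smooth_comps_nth[OF V]]]])
  then have u: "smooth_fun M (pts M) ?u"
    unfolding smooth_componentwise by simp
  have 1: "lie_bracket M V W p f = D f p (?u p)" if f: "smooth_at M p f" for p f
  proof -
    have p: "p \<in> pts M" by (rule smooth_at_pts[OF f])
    obtain O' where O': "openin (mtop M) O'" "p \<in> O'" "smooth_fun M O' f"
      using f unfolding smooth_at_def by blast
    have F: "smooth_on (\<theta> ` O') (f \<circ> pt)" using O' smooth_fun_iff by blast
    have "?u p = (\<chi> k. V p (\<lambda>q. comps W q $ k)) - (\<chi> k. W p (\<lambda>q. comps V q $ k))"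
      by (simp add: vec_eq_iff)
    then show ?thesis
      using f smooth_on_second_derivative_symmetric[OF open_image[OF O'(1)] F imageI[OF O'(2)]]
      unfolding lie_bracket_def field_field_apply[OF V W f] field_field_apply[OF W V f]
      by (simp add: linear_diff[OF D_linear[OF f]])
  qed
  have 0: "lie_bracket M V W p f = 0" if "\<not> smooth_at M p f" for p f
    using that by (simp add: lie_bracket_def)
  show "lie_bracket M V W \<in> vector_fields M" by (rule vector_fieldI[OF u 1 0])
  show "comps (lie_bracket M V W) p $ k = V p (\<lambda>q. comps W q $ k) - W p (\<lambda>q. comps V q $ k)"
    if "p \<in> pts M"
    using comps_vector_fieldI[OF u 1 0 that] by simp
qed

text \<open>The connection that differentiates components, that is, the one for which the coordinate
  fields of \<open>\<theta>\<close> are parallel.\<close>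

definition flat :: "'p vfield \<Rightarrow> 'p vfield \<Rightarrow> 'p vfield" where
  "flat V W = fld (\<lambda>p. \<chi> k. V p (\<lambda>q. comps W q $ k))"

lemma smooth_flat_comps:
  assumes "V \<in> vector_fields M" "W \<in> vector_fields M"
  shows "smooth_fun M (pts M) (\<lambda>p. \<chi> k. V p (\<lambda>q. comps W q $ k))"
  unfolding smooth_componentwise using field_smooth[OF assms(1) smooth_comps_nth[OF assms(2)]] by simp

lemma flat_vector_field: "V \<in> vector_fields M \<Longrightarrow> W \<in> vector_fields M \<Longrightarrow> flat V W \<in> vector_fields M"
  unfolding flat_def by (rule fld_vector_field[OF smooth_flat_comps])

lemma comps_flat:
  "V \<in> vector_fields M \<Longrightarrow> W \<in> vector_fields M \<Longrightarrow> p \<in> pts M \<Longrightarrow>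
    comps (flat V W) p $ k = V p (\<lambda>q. comps W q $ k)"
  unfolding flat_def by (subst comps_fld[OF smooth_flat_comps]) simp_all

lemma flat_eqI:
  assumes Z: "Z \<in> vector_fields M" and V: "V \<in> vector_fields M" and Y: "Y \<in> vector_fields M"
    and eq: "\<And>p k. p \<in> pts M \<Longrightarrow> Z p (\<lambda>q. comps V q $ k) = comps Y p $ k"
  shows "flat Z V = Y"
  by (rule vector_field_eqI[OF flat_vector_field[OF Z V] Y]) (simp add: vec_eq_iff comps_flat[OF Z V] eq)

lemma field_constant_on:
  assumes V: "V \<in> vector_fields M" and p: "p \<in> pts M" and "f constant_on pts M"
  shows "V p f = 0"
proof -
  obtain k where "\<And>q. q \<in> pts M \<Longrightarrow> f q = k" using assms(3) unfolding constant_on_def by blast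
  from field_cong[OF V p this] show ?thesis by (simp add: field_const[OF V p])
qed

text \<open>Fields with constant components realise every direction, so the derivative of
  \<open>f \<circ> pt\<close> vanishes on the image of the chart, and this image is connected as a
  continuous image of \<open>M\<close>.\<close>

lemma constant_if_fields_zero:
  assumes f: "smooth_fun M (pts M) f"
    and 0: "\<And>V p. V \<in> vector_fields M \<Longrightarrow> p \<in> pts M \<Longrightarrow> V p f = (0::real)"
  shows "f constant_on pts M"
proof -
  have "continuous_map (mtop M) euclidean \<theta>"
    using chart_openin_preimage[OF smooth_manifold chart] by (simp add: continuous_map_def)
  moreover have "connectedin (mtop M) (pts M)"
    using smooth_manifold by (simp add: smooth_manifold_def connectedin_topspace)
  ultimately have con: "connected (\<theta> ` pts M)"
    using connectedin_continuous_map_image connectedin_iff_connected by blast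
  have der: "((f \<circ> pt) has_derivative (\<lambda>_. 0)) (at y)" if y: "y \<in> \<theta> ` pts M" for y
  proof -
    obtain p where p: "p \<in> pts M" "y = \<theta> p" using y by blast
    have s: "smooth_at M p f" by (rule smooth_fun_imp_smooth_at[OF f p(1)])
    have "D f p w = 0" for w
      using 0[OF fld_vector_field[OF smooth_const[of w]] p(1)]
        field_apply[OF fld_vector_field[OF smooth_const[of w]] s] comps_fld[OF smooth_const p(1)] by simp
    then have "D f p = (\<lambda>_. 0)" by blast
    then show ?thesis using D_has_derivative[OF s] p(2) by simp
  qed
  have "pts M \<noteq> {}" using smooth_manifold by (simp add: smooth_manifold_def)
  then obtain p0 where p0: "p0 \<in> pts M" by blast
  have "f p = f p0" if p: "p \<in> pts M" for p
    using has_derivative_zero_unique_connected[OF open_domain con der imageI[OF p] imageI[OF p0]]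
    by (simp add: pt_\<theta>[OF p] pt_\<theta>[OF p0])
  then show ?thesis unfolding constant_on_def by blast
qed

definition frame :: "'n \<Rightarrow> 'p vfield" where
  "frame i = coord_field M \<theta> i"

lemma frame_vector_field: "frame i \<in> vector_fields M"
  unfolding frame_def coord_field_eq_fld by (rule fld_vector_field[OF smooth_const])

lemma comps_frame: "p \<in> pts M \<Longrightarrow> comps (frame i) p = axis i 1"
  unfolding frame_def coord_field_eq_fld by (rule comps_fld[OF smooth_const])

lemma comps_flat_frame: "p \<in> pts M \<Longrightarrow> comps (flat (frame i) (frame j)) p = 0"
proof -
  assume p: "p \<in> pts M"
  have "frame i p (\<lambda>q. comps (frame j) q $ k) = frame i p (\<lambda>q. axis j 1 $ k)" for k
    by (rule field_cong[OF frame_vector_field p]) (simp add: comps_frame)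
  then show ?thesis
    by (simp add: vec_eq_iff comps_flat[OF frame_vector_field frame_vector_field p]
        field_const[OF frame_vector_field p])
qed

lemma field_frame_expand:
  assumes W: "W \<in> vector_fields M" and p: "p \<in> pts M" and f: "smooth_fun M (pts M) f"
  shows "W p f = (\<Sum>j\<in>UNIV. comps W p $ j * frame j p f)"
proof -
  have s: "smooth_at M p f" by (rule smooth_fun_imp_smooth_at[OF f p])
  have "W p f = (\<Sum>j\<in>UNIV. comps W p $ j *\<^sub>R D f p (axis j 1))"
    unfolding field_apply[OF W s] by (rule linear_expand[OF D_linear[OF s]])
  then show ?thesis by (simp add: field_apply[OF frame_vector_field s] comps_frame[OF p])
qed

end

section \<open>The functions attached to an admissible triple\<close>

locale admissible =
  fixes h \<tau> :: "real \<Rightarrow> real" and I :: "real set"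
  assumes adm: "(h, \<tau>, I) \<in> admissible_triples"
begin

lemma open_I: "open I" and I_interval: "is_interval I" and I_pos: "t \<in> I \<Longrightarrow> t > 0"
  and smooth_\<tau>: "smooth_on I \<tau>" and \<tau>'_pos: "t \<in> I \<Longrightarrow> deriv \<tau> t > 0"
  and smooth_h: "smooth_on (\<tau> ` I) h" and h''_pos: "u \<in> \<tau> ` I \<Longrightarrow> deriv (deriv h) u > 0"
  using adm unfolding admissible_triples_def by auto

lemma strict_mono_on_I:
  assumes f: "smooth_on I f" and pos: "\<And>t. t \<in> I \<Longrightarrow> deriv f t > 0"
    and st: "s \<in> I" "t \<in> I" "s < t"
  shows "f s < f t"
proof (rule DERIV_pos_imp_increasing[OF st(3)])
  fix x assume "s \<le> x" "x \<le> t"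
  then have "x \<in> I" using mem_is_interval_1_I[OF I_interval st(1,2)] by blast
  then show "\<exists>y. (f has_real_derivative y) (at x) \<and> y > 0"
    using smooth_on_has_real_derivative[OF f] pos by blast
qed

lemma inj_on_I:
  assumes f: "smooth_on I f" and pos: "\<And>t. t \<in> I \<Longrightarrow> deriv f t > 0"
  shows "inj_on f I"
proof (rule inj_onI)
  fix s t assume st: "s \<in> I" "t \<in> I" "f s = f t"
  show "s = t"
    using strict_mono_on_I[OF f pos st(1,2)] strict_mono_on_I[OF f pos st(2,1)] st(3)
    by (cases s t rule: linorder_cases) auto
qed

lemma open_image_I:
  assumes f: "smooth_on I f" and pos: "\<And>t. t \<in> I \<Longrightarrow> deriv f t > 0"
  shows "open (f ` I)"
  using invariance_of_domain[OF smooth_on_imp_continuous_on[OF f] open_I inj_on_I[OF f pos]] .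

lemma open_\<tau>_I: "open (\<tau> ` I)"
  using open_image_I[OF smooth_\<tau> \<tau>'_pos] .

lemma smooth_ell: "smooth_on I (ell h \<tau>)"
  unfolding ell_def o_def
  by (rule smooth_on_compose[OF open_I open_\<tau>_I smooth_on_deriv[OF open_\<tau>_I smooth_h] smooth_\<tau>]) auto

lemmas has_deriv_\<tau> = smooth_on_has_real_derivative[OF smooth_\<tau>]
lemmas has_deriv_ell = smooth_on_has_real_derivative[OF smooth_ell]

lemma has_deriv_h\<tau>:
  "t \<in> I \<Longrightarrow> ((\<lambda>t. h (\<tau> t)) has_real_derivative ell h \<tau> t * deriv \<tau> t) (at t)"
  using DERIV_chain2[OF smooth_on_has_real_derivative[OF smooth_h] has_deriv_\<tau>, of t]
  by (simp add: ell_def)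

lemma ell'_pos: "t \<in> I \<Longrightarrow> deriv (ell h \<tau>) t > 0"
proof -
  assume t: "t \<in> I"
  have "((\<lambda>t. deriv h (\<tau> t)) has_real_derivative deriv (deriv h) (\<tau> t) * deriv \<tau> t) (at t)"
    using DERIV_chain2[OF smooth_on_has_real_derivative[OF smooth_on_deriv[OF open_\<tau>_I smooth_h]] has_deriv_\<tau>] t
    by blast
  then have "deriv (ell h \<tau>) t = deriv (deriv h) (\<tau> t) * deriv \<tau> t"
    unfolding ell_def o_def by (rule DERIV_imp_deriv)
  then show ?thesis using h''_pos \<tau>'_pos t by simp
qed

lemmas ell_strict_mono = strict_mono_on_I[OF smooth_ell ell'_pos]
lemmas inj_ell = inj_on_I[OF smooth_ell ell'_pos]

lemma ell_le_iff: "s \<in> I \<Longrightarrow> t \<in> I \<Longrightarrow> ell h \<tau> s \<le> ell h \<tau> t \<longleftrightarrow> s \<le> t"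
  using ell_strict_mono[of s t] ell_strict_mono[of t s]
  by (cases s t rule: linorder_cases) auto

lemma open_ell_I: "open (ell h \<tau> ` I)"
  using open_image_I[OF smooth_ell ell'_pos] .

text \<open>Positivity of the derivative gives all orders of regularity once the inverse is
  continuous; continuity comes from invariance of domain.\<close>

lemma smooth_inv_ell: "smooth_on (ell h \<tau> ` I) (inv_into I (ell h \<tau>))"
proof (rule smooth_on_inverse_function[OF open_I open_ell_I smooth_ell])
  show "deriv (ell h \<tau>) x \<noteq> 0" if "x \<in> I" for x using ell'_pos[OF that] by simp
  show "inv_into I (ell h \<tau>) y \<in> I" "ell h \<tau> (inv_into I (ell h \<tau>) y) = y" if "y \<in> ell h \<tau> ` I" for y
    using that by (auto simp: inv_into_into f_inv_into_f)
  obtain g where g: "homeomorphism I (ell h \<tau> ` I) (ell h \<tau>) g"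
    using invariance_of_domain_homeomorphism[OF open_I smooth_on_imp_continuous_on[OF smooth_ell] _ inj_ell]
    by auto
  have "g y = inv_into I (ell h \<tau>) y" if "y \<in> ell h \<tau> ` I" for y
    using g that inj_ell by (auto simp: homeomorphism_def)
  then show "continuous_on (ell h \<tau> ` I) (inv_into I (ell h \<tau>))"
    using g by (auto simp: homeomorphism_def cong: continuous_on_cong)
qed

lemma smooth_chi: "smooth_on I (chi h \<tau>)"
  unfolding chi_def
  by (rule smooth_on_divide[OF open_I smooth_on_deriv[OF open_I smooth_ell]]) (use ell'_pos in force)

lemma chi_pos: "t \<in> I \<Longrightarrow> chi h \<tau> t > 0"
  unfolding chi_def using ell'_pos by simp

lemma ell'_chi: "t \<in> I \<Longrightarrow> deriv (ell h \<tau>) t * chi h \<tau> t = 1"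
  unfolding chi_def using ell'_pos[of t] by simp

lemma smooth_h\<tau>: "smooth_on I (\<lambda>t. h (\<tau> t))"
  by (rule smooth_on_compose[OF open_I open_\<tau>_I smooth_h smooth_\<tau>]) auto

lemma smooth_minus:
  fixes f g :: "real \<Rightarrow> real"
  assumes "smooth_on I f" "smooth_on I g"
  shows "smooth_on I (\<lambda>t. f t - g t)"
  using smooth_on_add[OF open_I assms(1) smooth_on_mult[OF open_I smooth_on_const[of I "-1"] assms(2)]] by simp

lemma smooth_sstar: "smooth_on I (sstar h \<tau>)"
  using smooth_minus[OF smooth_h\<tau> smooth_on_mult[OF open_I smooth_\<tau> smooth_ell]]
  by (simp add: sstar_def)

text \<open>The two terms with \<open>deriv \<tau>\<close> cancel, because
  \<open>h \<circ> \<tau>\<close> has derivative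
  \<open>ell h \<tau> t * deriv \<tau> t\<close>.\<close>

lemma deriv_sstar: "t \<in> I \<Longrightarrow> deriv (sstar h \<tau>) t = - \<tau> t * deriv (ell h \<tau>) t"
  unfolding sstar_def
  by (rule DERIV_imp_deriv) (auto intro!: derivative_eq_intros has_deriv_\<tau> has_deriv_ell has_deriv_h\<tau>)

lemma smooth_ddiv_left: "smooth_on I (\<lambda>t. ddiv h \<tau> t s)"
  unfolding ddiv_def
  by (intro smooth_minus smooth_h\<tau> smooth_on_mult[OF open_I] smooth_\<tau> smooth_on_const)

lemma deriv_ddiv_left:
  "t \<in> I \<Longrightarrow> deriv (\<lambda>t. ddiv h \<tau> t s) t = deriv \<tau> t * (ell h \<tau> t - ell h \<tau> s)"
  unfolding ddiv_def
  by (rule DERIV_imp_deriv)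
     (auto intro!: derivative_eq_intros has_deriv_\<tau> has_deriv_h\<tau> simp: ell_def algebra_simps)

lemma smooth_ddiv_right: "smooth_on I (ddiv h \<tau> t)"
  using smooth_minus[OF smooth_minus[OF smooth_on_const[of I "h (\<tau> t)"] smooth_h\<tau>]
      smooth_on_mult[OF open_I smooth_minus[OF smooth_on_const[of I "\<tau> t"] smooth_\<tau>] smooth_ell]]
  by (simp add: ddiv_def[abs_def] ell_def)

text \<open>The same cancellation as for \<open>sstar\<close>. Like the derivative in the first
  argument, the result has a factor that vanishes for \<open>t = s\<close>, which keeps the higher
  derivatives on the diagonal short.\<close>

lemma deriv_ddiv_right:
  assumes "s \<in> I"
  shows "deriv (ddiv h \<tau> t) s = - (\<tau> t - \<tau> s) * deriv (ell h \<tau>) s"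
proof (rule DERIV_imp_deriv)
  have "((\<lambda>s. h (\<tau> t) - h (\<tau> s) - (\<tau> t - \<tau> s) * ell h \<tau> s) has_real_derivative
      - (\<tau> t - \<tau> s) * deriv (ell h \<tau>) s) (at s)"
    using assms
    by (auto intro!: derivative_eq_intros has_deriv_\<tau> has_deriv_h\<tau> has_deriv_ell simp: algebra_simps)
  then show "(ddiv h \<tau> t has_real_derivative - (\<tau> t - \<tau> s) * deriv (ell h \<tau>) s) (at s)"
    by (simp add: ddiv_def[abs_def] ell_def)
qed

end

section \<open>Existence of a global exponential representation\<close>

text \<open>The atlas is maximal, so it suffices that \<open>\<theta>\<close> is a homeomorphism
  onto an open set and compatible with every chart. Apart from injectivity both are local questions,
  and locally \<open>\<theta>\<close> is a chart followed by a diffeomorphism \<open>F\<close> of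
  the whole space.\<close>

lemma chart_homeomorphic_image:
  fixes \<theta> :: "'p \<Rightarrow> real^'n::finite"
  assumes M: "smooth_manifold M" and inj: "inj_on \<theta> (pts M)"
    and loc: "\<And>p. p \<in> pts M \<Longrightarrow> \<exists>U \<phi> F F'. p \<in> U \<and> (U, \<phi>) \<in> charts M \<and>
      smooth_on UNIV F \<and> smooth_on UNIV F' \<and> (\<forall>y. F' (F y) = y) \<and> (\<forall>y. F (F' y) = y) \<and>
      (\<forall>q\<in>U. \<theta> q = F (\<phi> q))"
  shows "(pts M, \<theta>) \<in> charts M"
proof -
  \<comment> \<open>Images under \<open>F\<close> are preimages under its inverse, so openness of
    images follows from continuity of \<open>F'\<close>.\<close>
  have image: "F ` S = F' -` S" if "\<forall>y. F' (F y) = y" "\<forall>y. F (F' y) = y" for F F' :: "real^'n \<Rightarrow> real^'n" and S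
    using that by (auto simp: image_iff) metis
  have open_image: "open (F ` S)" if "smooth_on UNIV F'" "\<forall>y. F' (F y) = y" "\<forall>y. F (F' y) = y" "open S"
    for F F' :: "real^'n \<Rightarrow> real^'n" and S
    unfolding image[OF that(2,3)]
    using smooth_on_imp_continuous_on[OF that(1)] that(4) by (simp add: open_vimage)
  have op: "open (\<theta> ` W)" if W: "openin (mtop M) W" for W
  proof (subst open_subopen, intro ballI)
    fix y assume "y \<in> \<theta> ` W"
    then obtain p where p: "p \<in> W" "y = \<theta> p" by blast
    then have "p \<in> pts M" using openin_subset[OF W] by blast
    from loc[OF this] obtain U \<phi> F F' where c: "p \<in> U" "(U, \<phi>) \<in> charts M" "smooth_on UNIV F'"
      "\<forall>y. F' (F y) = y" "\<forall>y. F (F' y) = y" "\<forall>q\<in>U. \<theta> q = F (\<phi> q)" by blast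
    have "\<theta> ` (U \<inter> W) = F ` \<phi> ` (U \<inter> W)"
      unfolding image_image using c(6) by (intro image_cong) auto
    then have "open (\<theta> ` (U \<inter> W))"
      using open_image[OF c(3-5) chart_open_image[OF M c(2) W]] by simp
    then show "\<exists>T. open T \<and> y \<in> T \<and> T \<subseteq> \<theta> ` W"
      using p c(1) by (intro exI[of _ "\<theta> ` (U \<inter> W)"]) auto
  qed
  have open_domain: "open (\<theta> ` pts M)" by (rule op) simp
  have cont: "openin (mtop M) {p \<in> pts M. \<theta> p \<in> S}" if S: "open S" for S
  proof (subst openin_subopen, intro ballI)
    fix p assume p: "p \<in> {p \<in> pts M. \<theta> p \<in> S}"
    then obtain U \<phi> F F' where c: "p \<in> U" "(U, \<phi>) \<in> charts M" "smooth_on UNIV F"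
      "\<forall>q\<in>U. \<theta> q = F (\<phi> q)" using loc[of p] by blast
    have "open (F -` S)"
      using smooth_on_imp_continuous_on[OF c(3)] S by (simp add: open_vimage)
    then have "openin (mtop M) {q \<in> U. \<phi> q \<in> F -` S}"
      by (rule chart_openin_preimage[OF M c(2)])
    then show "\<exists>T. openin (mtop M) T \<and> p \<in> T \<and> T \<subseteq> {p \<in> pts M. \<theta> p \<in> S}"
      using p c(1,4) chart_subset[OF M c(2)] by (intro exI[of _ "{q \<in> U. \<phi> q \<in> F -` S}"]) auto
  qed
  have "homeomorphic_map (mtop M) (top_of_set (\<theta> ` pts M)) \<theta>"
  proof (rule bijective_open_imp_homeomorphic_map)
    show "continuous_map (mtop M) (top_of_set (\<theta> ` pts M)) \<theta>"
      unfolding continuous_map_in_subtopology by (auto simp: continuous_map_def cont)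
    show "open_map (mtop M) (top_of_set (\<theta> ` pts M)) \<theta>"
      unfolding open_map_def openin_open_eq[OF open_domain]
      using op openin_subset by (metis image_mono)
  qed (use inj in auto)
  then have ch: "is_chart (mtop M) (pts M, \<theta>)"
    by (simp add: is_chart_def open_domain)
  have "compatible_charts (pts M, \<theta>) (U', \<phi>')" if c': "(U', \<phi>') \<in> charts M" for U' \<phi>'
  proof -
    have U': "openin (mtop M) U'" by (rule chart_openin[OF M c'])
    have "\<exists>V. open V \<and> y \<in> V \<and> smooth_on V (\<phi>' \<circ> inv_into (pts M) \<theta>)"
      if y: "y \<in> \<theta> ` (pts M \<inter> U')" for y
    proof -
      obtain p where p: "p \<in> pts M" "p \<in> U'" "y = \<theta> p" using y by blast
      then obtain U \<phi> F F' where c: "p \<in> U" "(U, \<phi>) \<in> charts M" "smooth_on UNIV F" "smooth_on UNIV F'"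
        "\<forall>y. F' (F y) = y" "\<forall>y. F (F' y) = y" "\<forall>q\<in>U. \<theta> q = F (\<phi> q)" using loc[of p] by blast
      have o: "open (\<theta> ` (U \<inter> U'))" by (intro op openin_Int chart_openin[OF M c(2)] U')
      have inv: "inv_into U \<phi> (\<phi> q) = q" "inv_into (pts M) \<theta> (\<theta> q) = q" if "q \<in> U" for q
        using chart_inj_on[OF M c(2)] inj chart_subset[OF M c(2)] that by (auto intro: inv_into_f_f)
      have "smooth_on (\<theta> ` (U \<inter> U')) (\<lambda>y. (\<phi>' \<circ> inv_into U \<phi>) (F' y))"
        by (rule smooth_on_compose[OF o chart_open_image[OF M c(2) U'] charts_compatible[OF M c(2) c']
              smooth_on_subset[OF c(4)]]) (use c in auto)
      then have "smooth_on (\<theta> ` (U \<inter> U')) (\<phi>' \<circ> inv_into (pts M) \<theta>)"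
        by (rule smooth_on_cong[OF o]) (use c inv in auto)
      then show ?thesis using o p c(1) by blast
    qed
    then have 1: "smooth_on (\<theta> ` (pts M \<inter> U')) (\<phi>' \<circ> inv_into (pts M) \<theta>)"
      by (rule smooth_on_local)
    have "\<exists>V. open V \<and> y \<in> V \<and> smooth_on V (\<theta> \<circ> inv_into U' \<phi>')"
      if y: "y \<in> \<phi>' ` (pts M \<inter> U')" for y
    proof -
      obtain p where p: "p \<in> pts M" "p \<in> U'" "y = \<phi>' p" using y by blast
      then obtain U \<phi> F F' where c: "p \<in> U" "(U, \<phi>) \<in> charts M" "smooth_on UNIV F"
        "\<forall>q\<in>U. \<theta> q = F (\<phi> q)" using loc[of p] by blast
      have o: "open (\<phi>' ` (U' \<inter> U))" by (rule chart_open_image[OF M c' chart_openin[OF M c(2)]])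
      have "smooth_on (\<phi>' ` (U' \<inter> U)) (\<lambda>y. F ((\<phi> \<circ> inv_into U' \<phi>') y))"
        by (rule smooth_on_compose[OF o open_UNIV c(3) charts_compatible[OF M c' c(2)]]) simp
      then have "smooth_on (\<phi>' ` (U' \<inter> U)) (\<theta> \<circ> inv_into U' \<phi>')"
        by (rule smooth_on_cong[OF o]) (use c(4) chart_inj_on[OF M c'] in auto)
      then show ?thesis using o p c(1) by blast
    qed
    then have 2: "smooth_on (\<phi>' ` (pts M \<inter> U')) (\<theta> \<circ> inv_into U' \<phi>')"
      by (rule smooth_on_local)
    show ?thesis using 1 2 by (simp add: compatible_charts_def)
  qed
  then have "\<forall>c'\<in>charts M. compatible_charts (pts M, \<theta>) c'" by auto
  then show ?thesis using ch M unfolding smooth_manifold_def by blast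
qed

locale exponential_manifold = admissible h \<tau> I
  for h \<tau> :: "real \<Rightarrow> real" and I :: "real set" +
  fixes \<mu> :: "'x::topological_space measure" and M :: "('x \<Rightarrow> real, 'n::finite) manifold"
  assumes family: "exponential_family \<mu> h \<tau> I M"
begin

lemma manifold: "smooth_manifold M"
  using family unfolding exponential_family_def manifold_in_def by blast

lemma pts_nonempty: "pts M \<noteq> {}"
  using manifold unfolding smooth_manifold_def by blast

text \<open>Membership at every \<open>x\<close>, not just almost every \<open>x\<close>, is part of
  \<open>exp_coord_rep\<close>; the representation around a single point supplies it for all of
  \<open>M\<close>.\<close>

lemma value_in_I: "p \<in> pts M \<Longrightarrow> p x \<in> I"
  using family pts_nonempty unfolding exponential_family_def exp_coord_rep_def by blast

lemma eq_if_ell_diff_const: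
  assumes p: "p \<in> pts M" and q: "q \<in> pts M" and k: "\<And>x. ell h \<tau> (p x) = ell h \<tau> (q x) + k"
  shows "p = q"
proof -
  have dens: "integrable \<mu> r" "(LINT x|\<mu>. r x) = 1" if r: "r \<in> pts M" for r
  proof -
    have "r \<in> densities \<mu> I"
      using family r unfolding exponential_family_def manifold_in_def by blast
    moreover have "\<bar>r x\<bar> = r x" for x using I_pos[OF value_in_I[OF r], of x] by simp
    ultimately show "integrable \<mu> r" "(LINT x|\<mu>. r x) = 1" by (auto simp: densities_def)
  qed
  \<comment> \<open>The nonnegative difference has integral zero, hence vanishes almost everywhere;
    equality as functions holds because \<open>M\<close> contains one representative per
    class.\<close>
  have le: "r = s" if r: "r \<in> pts M" and s: "s \<in> pts M" and le: "\<And>x. r x \<le> s x" for r s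
  proof -
    have "(LINT x|\<mu>. s x - r x) = 0" using dens[OF r] dens[OF s] by simp
    then have "AE x in \<mu>. s x - r x = 0"
      using dens(1)[OF r] dens(1)[OF s] le by (subst (asm) integral_nonneg_eq_0_iff_AE) auto
    then have "AE x in \<mu>. r x = s x" by eventually_elim simp
    then show ?thesis
      using family r s unfolding exponential_family_def manifold_in_def by blast
  qed
  show ?thesis
  proof (cases "k \<ge> 0")
    case True
    then have "q x \<le> p x" for x
      using k[of x] ell_le_iff[OF value_in_I[OF q] value_in_I[OF p]] by fastforce
    then show ?thesis using le[OF q p] by simp
  next
    case False
    then have "p x \<le> q x" for x
      using k[of x] ell_le_iff[OF value_in_I[OF p] value_in_I[OF q]] by fastforce
    then show ?thesis using le[OF p q] by simp
  qed
qed

text \<open>The exponential representation with \<open>exp_ht\<close> inverted: applying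
  \<open>ell h \<tau>\<close> removes the boundary values and leaves an expression affine in the
  coordinates.\<close>

definition ell_rep ::
  "('x \<Rightarrow> real) set \<Rightarrow> (('x \<Rightarrow> real) \<Rightarrow> real^'n) \<Rightarrow> ('x \<Rightarrow> real^'n) \<Rightarrow> ('x \<Rightarrow> real) \<Rightarrow>
   (('x \<Rightarrow> real) \<Rightarrow> real) \<Rightarrow> bool" where
  "ell_rep U \<theta> T c \<psi> \<longleftrightarrow> (U, \<theta>) \<in> charts M \<and> continuous_on UNIV T \<and> smooth_fun M U \<psi> \<and>
     (\<forall>p\<in>U. \<forall>x. ell h \<tau> (p x) = \<theta> p \<bullet> T x - c x - \<psi> p)"

lemma ell_repD: "ell_rep U \<theta> T c \<psi> \<Longrightarrow> p \<in> U \<Longrightarrow> ell h \<tau> (p x) = \<theta> p \<bullet> T x - c x - \<psi> p"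
  by (simp add: ell_rep_def)

text \<open>The value \<open>p x\<close> lies in \<open>I\<close>, so it is positive and finite,
  which excludes the two boundary branches of \<open>exp_ht\<close>.\<close>

lemma ell_rep_if_exp_coord_rep:
  assumes "exp_coord_rep h \<tau> I M U \<theta> T c \<psi>"
  shows "ell_rep U \<theta> T c \<psi>"
proof -
  have U: "(U, \<theta>) \<in> charts M" using assms by (simp add: exp_coord_rep_def)
  have "ell h \<tau> (p x) = \<theta> p \<bullet> T x - c x - \<psi> p" if p: "p \<in> U" for p x
  proof -
    let ?u = "\<theta> p \<bullet> T x - c x - \<psi> p"
    have e: "ereal (p x) = exp_ht h \<tau> I ?u" using assms p by (simp add: exp_coord_rep_def)
    have "p x > 0" using I_pos value_in_I chart_subset[OF manifold U] p by blast
    then have u: "?u \<in> ell h \<tau> ` I"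
      using e by (auto simp: exp_ht_def split: if_splits)
    then have "p x = inv_into I (ell h \<tau>) ?u" using e by (simp add: exp_ht_def)
    then show ?thesis using f_inv_into_f[OF u] by simp
  qed
  then show ?thesis using assms by (simp add: ell_rep_def exp_coord_rep_def)
qed

lemma local_ell_rep:
  assumes "p \<in> pts M"
  obtains U \<theta> T c \<psi> where "p \<in> U" "ell_rep U \<theta> T c \<psi>"
  using family assms ell_rep_if_exp_coord_rep unfolding exponential_family_def by meson

text \<open>If \<open>w \<bullet> T x\<close> is constant, moving the coordinates along
  \<open>w\<close> changes \<open>ell h \<tau> (p x)\<close> by a constant and therefore does not
  move the point; as coordinates determine points and conversely, \<open>w\<close> is zero.\<close>

lemma statistic_affinely_independent:
  assumes rep: "ell_rep U \<theta> T c \<psi>" and "U \<noteq> {}" and w: "\<And>x. w \<bullet> T x = k"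
  shows "w = 0"
proof -
  obtain p where p: "p \<in> U" using assms(2) by blast
  have c: "(U, \<theta>) \<in> charts M" using rep by (simp add: ell_rep_def)
  note sub = chart_subset[OF manifold c]
  have "open (\<theta> ` U)"
    using chart_open_image[OF manifold c openin_topspace] sub by (simp add: Int_absorb2)
  then obtain e where e: "e > 0" "ball (\<theta> p) e \<subseteq> \<theta> ` U"
    using p open_contains_ball by blast
  \<comment> \<open>The displacement \<open>t *\<^sub>R w\<close> has norm at most
    \<open>e / 2\<close>; the summand \<open>1\<close> makes the divisor positive also for
    \<open>w = 0\<close>.\<close>
  define N where "N = norm w + 1"
  have N: "N > 0" unfolding N_def using norm_ge_zero[of w] by linarith
  define t where "t = e / (2 * N)"
  have t: "t > 0" unfolding t_def using e(1) N by simp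
  have "norm (t *\<^sub>R w) \<le> t * N" using t by (simp add: N_def)
  also have "\<dots> = e / 2" unfolding t_def using N by simp
  finally have "\<theta> p + t *\<^sub>R w \<in> ball (\<theta> p) e" using e(1) by (simp add: dist_norm)
  then obtain q where q: "q \<in> U" "\<theta> q = \<theta> p + t *\<^sub>R w" using e(2) by (metis imageE subsetD)
  have "ell h \<tau> (q x) = ell h \<tau> (p x) + (t * k - \<psi> q + \<psi> p)" for x
    using rep p q w[of x] by (simp add: ell_rep_def inner_add_left)
  then have "q = p" using eq_if_ell_diff_const p q sub by blast
  then show ?thesis using q(2) t by simp
qed

text \<open>Invertibility of \<open>A\<close> is left to \<open>ell_rep_change\<close>, which
  derives it from the independence of the components of \<open>T'\<close>; reflexivity and
  transitivity thus need only compositions of linear maps.\<close>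

definition affinely_related ::
  "('x \<Rightarrow> real^'n) \<Rightarrow> ('x \<Rightarrow> real) \<Rightarrow> ('x \<Rightarrow> real^'n) \<Rightarrow> ('x \<Rightarrow> real) \<Rightarrow> bool" where
  "affinely_related T c T' c' \<longleftrightarrow> (\<exists>A \<beta> a b. linear A \<and> linear \<beta> \<and>
     (\<forall>x. T' x = A (T x) + a \<and> c' x = c x + \<beta> (T x) + b))"

lemma affinely_related_refl: "affinely_related T c T c"
  unfolding affinely_related_def
  by (rule exI[of _ "\<lambda>v. v"], rule exI[of _ "\<lambda>v. 0"], rule exI[of _ 0], rule exI[of _ 0])
     (simp add: linear_iff)

lemma affinely_related_trans:
  assumes "affinely_related T c T' c'" "affinely_related T' c' T'' c''"
  shows "affinely_related T c T'' c''"
proof -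
  obtain A \<beta> a b where 1: "linear A" "linear \<beta>" "\<And>x. T' x = A (T x) + a" "\<And>x. c' x = c x + \<beta> (T x) + b"
    using assms(1) unfolding affinely_related_def by blast
  obtain A' \<beta>' a' b' where 2: "linear A'" "linear \<beta>'" "\<And>x. T'' x = A' (T' x) + a'"
      "\<And>x. c'' x = c' x + \<beta>' (T' x) + b'"
    using assms(2) unfolding affinely_related_def by blast
  have "linear (\<lambda>v. A' (A v))" "linear (\<lambda>v. \<beta> v + \<beta>' (A v))"
    using 1 2 linear_compose[OF 1(1) 2(1)] linear_compose[OF 1(1) 2(2)]
    by (auto simp: o_def intro: linear_compose_add)
  moreover have "T'' x = A' (A (T x)) + (A' a + a')" for x
    using 1(3) 2(3) by (simp add: linear_add[OF 2(1)])
  moreover have "c'' x = c x + (\<beta> (T x) + \<beta>' (A (T x))) + (b + \<beta>' a + b')" for x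
    using 1(3,4) 2(4) by (simp add: linear_add[OF 2(2)])
  ultimately show ?thesis unfolding affinely_related_def
    by (intro exI[of _ "\<lambda>v. A' (A v)"] exI[of _ "\<lambda>v. \<beta> v + \<beta>' (A v)"] exI[of _ "A' a + a'"]
        exI[of _ "b + \<beta>' a + b'"]) blast
qed

text \<open>On the overlap the two expressions for \<open>ell h \<tau> (p x)\<close> agree; subtracting them at points whose
  \<open>\<theta>'\<close>-coordinates differ along one axis expresses each component of \<open>T'\<close> through \<open>T\<close>.\<close>

lemma affinely_related_overlap:
  assumes r: "ell_rep U \<theta> T c \<psi>" and r': "ell_rep U' \<theta>' T' c' \<psi>'" and ne: "U \<inter> U' \<noteq> {}"
  shows "affinely_related T c T' c'"
proof -
  have c: "(U, \<theta>) \<in> charts M" "(U', \<theta>') \<in> charts M" using r r' by (simp_all add: ell_rep_def)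
  obtain q where q: "q \<in> U" "q \<in> U'" using ne by blast
  have "open (\<theta>' ` (U' \<inter> U))"
    by (rule chart_open_image[OF manifold c(2) chart_openin[OF manifold c(1)]])
  then obtain e where e: "e > 0" "ball (\<theta>' q) e \<subseteq> \<theta>' ` (U' \<inter> U)"
    using q open_contains_ball by blast
  define t where "t = e / 2"
  have t: "t > 0" "t < e" using e(1) by (auto simp: t_def)
  have "\<exists>p\<in>U' \<inter> U. \<theta>' p = \<theta>' q + t *\<^sub>R axis i 1" for i
  proof -
    have "\<theta>' q + t *\<^sub>R axis i 1 \<in> ball (\<theta>' q) e" using t by (simp add: dist_norm)
    then have "\<theta>' q + t *\<^sub>R axis i 1 \<in> \<theta>' ` (U' \<inter> U)" by (rule subsetD[OF e(2)])
    then obtain r where "\<theta>' q + t *\<^sub>R axis i 1 = \<theta>' r" "r \<in> U' \<inter> U" by (rule imageE)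
    then show ?thesis by (intro bexI[of _ r]) simp_all
  qed
  then have "\<forall>i. \<exists>p. p \<in> U' \<inter> U \<and> \<theta>' p = \<theta>' q + t *\<^sub>R axis i 1" by blast
  then obtain p where p': "\<forall>i. p i \<in> U' \<inter> U \<and> \<theta>' (p i) = \<theta>' q + t *\<^sub>R axis i 1"
    by (rule choice[THEN exE])
  then have p: "p i \<in> U" "p i \<in> U'" "\<theta>' (p i) = \<theta>' q + t *\<^sub>R axis i 1" for i by auto
  have eq: "\<theta> s \<bullet> T x - c x - \<psi> s = \<theta>' s \<bullet> T' x - c' x - \<psi>' s" if "s \<in> U" "s \<in> U'" for s x
    using ell_repD[OF r that(1), of x] ell_repD[OF r' that(2), of x] by linarith
  define A where "A v = (\<chi> i. ((\<theta> (p i) - \<theta> q) \<bullet> v) / t)" for v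
  define a where "a = (\<chi> i. (\<psi> q - \<psi> (p i) + \<psi>' (p i) - \<psi>' q) / t)"
  have A: "linear A"
    unfolding A_def by (auto simp: linear_iff vec_eq_iff inner_add_right add_divide_distrib)
  have T': "T' x = A (T x) + a" for x
  proof -
    have "t * T' x $ i = (\<theta> (p i) - \<theta> q) \<bullet> T x + (\<psi> q - \<psi> (p i) + \<psi>' (p i) - \<psi>' q)" for i
      using eq[OF p(1,2), of i x] eq[OF q, of x] p(3)[of i]
      by (simp add: inner_add_left inner_diff_left inner_axis' algebra_simps)
    then have "T' x $ i = ((\<theta> (p i) - \<theta> q) \<bullet> T x + (\<psi> q - \<psi> (p i) + \<psi>' (p i) - \<psi>' q)) / t" for i
      using t by (simp add: field_simps)
    then show ?thesis by (simp add: vec_eq_iff A_def a_def add_divide_distrib)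
  qed
  \<comment> \<open>Obtained by solving the identity \<open>eq\<close> at the base point
    \<open>q\<close> for \<open>c' x\<close> and replacing \<open>T' x\<close> by
    \<open>A (T x) + a\<close>.\<close>
  define \<beta> where "\<beta> v = \<theta>' q \<bullet> A v - \<theta> q \<bullet> v" for v
  have "linear \<beta>"
    unfolding \<beta>_def by (auto simp: linear_iff linear_add[OF A] linear_cmul[OF A] inner_add_right algebra_simps)
  moreover have "c' x = c x + \<beta> (T x) + (\<theta>' q \<bullet> a - \<psi>' q + \<psi> q)" for x
    using eq[OF q, of x] by (simp add: \<beta>_def T' inner_add_right)
  ultimately show ?thesis using A T' unfolding affinely_related_def by blast
qed

text \<open>The domains of representations related to the given one have an open union. A
  representation around a point outside cannot meet any of them, since the overlap would relate it
  too; so the complement is open and connectedness applies.\<close>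

lemma affinely_related_everywhere:
  assumes r0: "ell_rep U\<^sub>0 \<theta>\<^sub>0 T c \<psi>\<^sub>0" and U0: "U\<^sub>0 \<noteq> {}" and p: "p \<in> pts M"
  shows "\<exists>U \<theta> T' c' \<psi>. p \<in> U \<and> ell_rep U \<theta> T' c' \<psi> \<and> affinely_related T c T' c'"
proof -
  define \<U> where "\<U> = {U. \<exists>\<theta> T' c' \<psi>. ell_rep U \<theta> T' c' \<psi> \<and> affinely_related T c T' c'}"
  have op: "openin (mtop M) U" if "ell_rep U \<theta> T' c' \<psi>" for U \<theta> T' c' \<psi>
    using that chart_openin[OF manifold] by (auto simp: ell_rep_def)
  have o: "openin (mtop M) (\<Union>\<U>)" using op by (auto simp: \<U>_def)
  have "openin (mtop M) (pts M - \<Union>\<U>)"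
  proof (subst openin_subopen, intro ballI)
    fix s assume s: "s \<in> pts M - \<Union>\<U>"
    then obtain U \<theta> T' c' \<psi> where U: "s \<in> U" "ell_rep U \<theta> T' c' \<psi>"
      using local_ell_rep by blast
    have "U \<inter> V = {}" if V: "V \<in> \<U>" for V
    proof (rule ccontr)
      assume ne: "U \<inter> V \<noteq> {}"
      obtain \<theta>1 T1 c1 \<psi>1 where 1: "ell_rep V \<theta>1 T1 c1 \<psi>1" "affinely_related T c T1 c1"
        using V by (auto simp: \<U>_def)
      have "affinely_related T1 c1 T' c'"
        using affinely_related_overlap[OF 1(1) U(2)] ne by blast
      then have "U \<in> \<U>" using U(2) affinely_related_trans[OF 1(2)] unfolding \<U>_def by blast
      then show False using s U(1) by blast
    qed
    then have "U \<subseteq> pts M - \<Union>\<U>" using openin_subset[OF op[OF U(2)]] by blast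
    then show "\<exists>T. openin (mtop M) T \<and> s \<in> T \<and> T \<subseteq> pts M - \<Union>\<U>"
      using U(1) op[OF U(2)] by (intro exI[of _ U]) simp
  qed
  then have "closedin (mtop M) (\<Union>\<U>)" using o openin_subset by (simp add: closedin_def)
  moreover have "U\<^sub>0 \<in> \<U>" using r0 affinely_related_refl unfolding \<U>_def by blast
  then have "\<Union>\<U> \<noteq> {}" using U0 by blast
  moreover have "connected_space (mtop M)" using manifold by (simp add: smooth_manifold_def)
  ultimately have "\<Union>\<U> = pts M"
    using o unfolding connected_space_clopen_in by blast
  then show ?thesis using p unfolding \<U>_def by blast
qed

text \<open>Substituting the affine expressions for \<open>T'\<close> and \<open>c'\<close> and
  moving \<open>A\<close> to the other side of the inner product gives the coordinates
  \<open>adjoint A (\<theta> p) - b0\<close> and the normalization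
  \<open>\<psi> p + b - \<theta> p \<bullet> a\<close>, where \<open>b0\<close> represents
  \<open>\<beta>\<close>.\<close>

lemma ell_rep_change:
  assumes r: "ell_rep U \<theta> T' c' \<psi>" and ne: "U \<noteq> {}" and rel: "affinely_related T c T' c'"
  shows "\<exists>F F' \<psi>'. smooth_on UNIV F \<and> smooth_on UNIV F' \<and> (\<forall>y. F' (F y) = y) \<and>
    (\<forall>y. F (F' y) = y) \<and> smooth_fun M U \<psi>' \<and>
    (\<forall>p\<in>U. \<forall>x. ell h \<tau> (p x) = F (\<theta> p) \<bullet> T x - c x - \<psi>' p)"
proof -
  obtain A \<beta> a b where 1: "linear A" "linear \<beta>" "\<And>x. T' x = A (T x) + a" "\<And>x. c' x = c x + \<beta> (T x) + b"
    using rel unfolding affinely_related_def by blast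
  define b0 where "b0 = adjoint \<beta> 1"
  have \<beta>: "\<beta> v = b0 \<bullet> v" for v
    using adjoint_clauses(2)[OF 1(2), of 1 v] by (simp add: b0_def)
  have lin: "linear (adjoint A)" by (rule adjoint_linear[OF 1(1)])
  \<comment> \<open>A vector in the kernel of the adjoint makes \<open>w \<bullet> T' x\<close>
    constant, so affine independence makes the linear part of \<open>F\<close> bijective.\<close>
  have "w = 0" if "adjoint A w = 0" for w
  proof (rule statistic_affinely_independent[OF r ne])
    show "w \<bullet> T' x = w \<bullet> a" for x
      using that adjoint_clauses(2)[OF 1(1), of w "T x"] by (simp add: 1(3) inner_add_right)
  qed
  then have "inj (adjoint A)" using linear_injective_0[OF lin] by blast
  then obtain B where B: "linear B" "\<And>y. B (adjoint A y) = y" "\<And>y. adjoint A (B y) = y"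
    using linear_injective_isomorphism[OF lin] by blast
  have sm: "smooth_on UNIV (\<lambda>y. L (y + v) + w)" if "linear L" for L :: "real^'n \<Rightarrow> real^'n" and v w
    using that by (intro smooth_on_add smooth_on_bounded_linear[of L] smooth_on_ident smooth_on_const)
      (auto simp: linear_linear)
  let ?\<psi> = "\<lambda>p. \<psi> p + b - \<theta> p \<bullet> a"
  have U: "(U, \<theta>) \<in> charts M" using r by (simp add: ell_rep_def)
  show ?thesis
  proof (intro exI conjI allI ballI)
    show "smooth_on UNIV (\<lambda>y. adjoint A y - b0)" using sm[OF lin, of 0 "- b0"] by simp
    show "smooth_on UNIV (\<lambda>y. B (y + b0))" using sm[OF B(1), of b0 0] by simp
    show "B (adjoint A y - b0 + b0) = y" for y using B by simp
    show "adjoint A (B (y + b0)) - b0 = y" for y using B by simp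
    show "ell h \<tau> (p x) = (adjoint A (\<theta> p) - b0) \<bullet> T x - c x - ?\<psi> p" if "p \<in> U" for p x
      using r that adjoint_clauses(2)[OF 1(1), of "\<theta> p" "T x"]
      by (simp add: ell_rep_def 1(3,4) \<beta> inner_add_right inner_diff_left)
    have "smooth_on (\<phi> ` (V \<inter> U)) (?\<psi> \<circ> inv_into V \<phi>)" if V: "(V, \<phi>) \<in> charts M" for V \<phi>
    proof -
      have o: "open (\<phi> ` (V \<inter> U))"
        by (rule chart_open_image[OF manifold V chart_openin[OF manifold U]])
      have "smooth_on (\<phi> ` (V \<inter> U)) (\<psi> \<circ> inv_into V \<phi>)"
        using r V by (auto simp: ell_rep_def intro: smooth_fun_chartD)
      then have "smooth_on (\<phi> ` (V \<inter> U)) (\<lambda>y. (\<psi> \<circ> inv_into V \<phi>) y + (b + (- ((\<theta> \<circ> inv_into V \<phi>) y \<bullet> a))))"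
        by (intro smooth_on_add o smooth_on_const
            smooth_on_bounded_linear[OF bounded_linear_minus[OF bounded_linear_ident], of _ "\<lambda>y. (\<theta> \<circ> inv_into V \<phi>) y \<bullet> a"]
            smooth_on_bounded_linear[OF bounded_linear_inner_left] charts_compatible[OF manifold V U])
      then show ?thesis by (simp add: o_def algebra_simps)
    qed
    then show "smooth_fun M U ?\<psi>" unfolding smooth_fun_def by auto
  qed
qed

text \<open>The statistics \<open>T\<close> and \<open>c\<close> of one local representation are
  kept for all of \<open>M\<close>. Relative to them each point determines its coordinates and its
  normalization uniquely, so the local versions patch together, and smoothness is inherited
  locally.\<close>

lemma global_ell_rep: "\<exists>\<theta> T c \<psi>. ell_rep (pts M) \<theta> T c \<psi>"
proof -
  obtain p0 where p0: "p0 \<in> pts M" using pts_nonempty by blast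
  obtain U0 \<theta>0 T c \<psi>0 where r0: "p0 \<in> U0" "ell_rep U0 \<theta>0 T c \<psi>0" by (rule local_ell_rep[OF p0])
  have U0: "U0 \<noteq> {}" using r0 by blast
  have loc: "\<exists>U \<phi> F F' \<psi>. p \<in> U \<and> (U, \<phi>) \<in> charts M \<and> smooth_on UNIV F \<and> smooth_on UNIV F' \<and>
      (\<forall>y. F' (F y) = y) \<and> (\<forall>y. F (F' y) = y) \<and> smooth_fun M U \<psi> \<and>
      (\<forall>q\<in>U. \<forall>x. ell h \<tau> (q x) = F (\<phi> q) \<bullet> T x - c x - \<psi> q)" if p: "p \<in> pts M" for p
  proof -
    obtain U \<phi> T' c' \<psi> where r: "p \<in> U" "ell_rep U \<phi> T' c' \<psi>" "affinely_related T c T' c'"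
      using affinely_related_everywhere[OF r0(2) U0 p] by blast
    have ne: "U \<noteq> {}" using r(1) by blast
    note ell_rep_change[OF r(2) ne r(3)]
    moreover have "(U, \<phi>) \<in> charts M" using r(2) by (simp add: ell_rep_def)
    ultimately show ?thesis using r(1) by metis
  qed
  have "\<exists>w s. \<forall>x. ell h \<tau> (p x) = w \<bullet> T x - c x - s" if "p \<in> pts M" for p
    using loc[OF that] by blast
  then obtain \<theta> \<psi> where rep: "\<And>p x. p \<in> pts M \<Longrightarrow> ell h \<tau> (p x) = \<theta> p \<bullet> T x - c x - \<psi> p"
    by metis
  have unique: "\<theta> p = w \<and> \<psi> p = s"
    if p: "p \<in> pts M" and w: "\<And>x. ell h \<tau> (p x) = w \<bullet> T x - c x - s" for p w s
  proof -
    have "(\<theta> p - w) \<bullet> T x = \<psi> p - s" for x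
      using rep[OF p, of x] w[of x] by (simp add: inner_diff_left)
    then have "\<theta> p - w = 0" by (rule statistic_affinely_independent[OF r0(2) U0])
    \<comment> \<open>With equal coordinates any one \<open>x\<close> compares the two constants;
      \<open>undefined\<close> is that arbitrary point.\<close>
    then show ?thesis using rep[OF p, of undefined] w[of undefined] by simp
  qed
  have chart: "(pts M, \<theta>) \<in> charts M"
  proof (rule chart_homeomorphic_image[OF manifold])
    show "inj_on \<theta> (pts M)"
    proof (rule inj_onI)
      fix p q assume pq: "p \<in> pts M" "q \<in> pts M" "\<theta> p = \<theta> q"
      then show "p = q"
        using rep by (intro eq_if_ell_diff_const[of p q "\<psi> q - \<psi> p"]) auto
    qed
    fix p assume "p \<in> pts M"
    from loc[OF this] obtain U \<phi> F F' \<psi>' where l: "p \<in> U" "(U, \<phi>) \<in> charts M" "smooth_on UNIV F"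
      "smooth_on UNIV F'" "\<forall>y. F' (F y) = y" "\<forall>y. F (F' y) = y"
      "\<forall>q\<in>U. \<forall>x. ell h \<tau> (q x) = F (\<phi> q) \<bullet> T x - c x - \<psi>' q" by blast
    have "\<forall>q\<in>U. \<theta> q = F (\<phi> q)"
      using l(7) unique chart_subset[OF manifold l(2)] by blast
    then show "\<exists>U \<phi> F F'. p \<in> U \<and> (U, \<phi>) \<in> charts M \<and> smooth_on UNIV F \<and> smooth_on UNIV F' \<and>
        (\<forall>y. F' (F y) = y) \<and> (\<forall>y. F (F' y) = y) \<and> (\<forall>q\<in>U. \<theta> q = F (\<phi> q))"
      using l by blast
  qed
  have "smooth_on (\<phi>' ` (V \<inter> pts M)) (\<psi> \<circ> inv_into V \<phi>')" if V: "(V, \<phi>') \<in> charts M" for V \<phi>'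
  proof (rule smooth_on_local)
    fix y assume "y \<in> \<phi>' ` (V \<inter> pts M)"
    then obtain p where p: "p \<in> V" "p \<in> pts M" "y = \<phi>' p" by blast
    from loc[OF p(2)] obtain U \<phi> F \<psi>' where l: "p \<in> U" "(U, \<phi>) \<in> charts M" "smooth_fun M U \<psi>'"
      "\<forall>q\<in>U. \<forall>x. ell h \<tau> (q x) = F (\<phi> q) \<bullet> T x - c x - \<psi>' q" by blast
    have eq: "\<psi> q = \<psi>' q" if "q \<in> U" for q
      using l(4) unique chart_subset[OF manifold l(2)] that by blast
    have o: "open (\<phi>' ` (V \<inter> U))"
      by (rule chart_open_image[OF manifold V chart_openin[OF manifold l(2)]])
    have "smooth_on (\<phi>' ` (V \<inter> U)) (\<psi> \<circ> inv_into V \<phi>')"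
      by (rule smooth_on_cong[OF o smooth_fun_chartD[OF l(3) V]])
         (use eq chart_inj_on[OF manifold V] in auto)
    then show "\<exists>O'. open O' \<and> y \<in> O' \<and> smooth_on O' (\<psi> \<circ> inv_into V \<phi>')"
      using o p l(1) by blast
  qed
  then have "smooth_fun M (pts M) \<psi>" unfolding smooth_fun_def by auto
  then have "ell_rep (pts M) \<theta> T c \<psi>"
    using chart rep r0(2) by (simp add: ell_rep_def)
  then show ?thesis by blast
qed

end

section \<open>The metric and the connection in exponential coordinates\<close>

text \<open>Reduces an identity between integrals to an identity between integrands; symmetry and
  linearity of the metric are obtained this way.\<close>

lemma has_bochner_integral_unique:
  assumes "has_bochner_integral M f a" "has_bochner_integral M g b" "\<And>x. f x = g x"
  shows "a = b"
proof -
  have "f = g" using assms(3) by blast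
  then show ?thesis using assms(1,2) has_bochner_integral_eq by blast
qed

text \<open>Assuming \<open>ell_rep\<close> makes the locale available both for a given exponential
  representation and for the patched one from \<open>global_ell_rep\<close>.\<close>

locale global_exponential_family = exponential_manifold h \<tau> I \<mu> M
  for h \<tau> :: "real \<Rightarrow> real" and I :: "real set" and \<mu> :: "'x::topological_space measure"
    and M :: "('x \<Rightarrow> real, 'n::finite) manifold" +
  fixes \<theta> :: "('x \<Rightarrow> real) \<Rightarrow> real^'n" and T :: "'x \<Rightarrow> real^'n" and c :: "'x \<Rightarrow> real"
    and \<psi> :: "('x \<Rightarrow> real) \<Rightarrow> real"
  assumes radon: "radon_measure \<mu>" and support: "measure_support \<mu> = UNIV"
    and compat: "compatible \<mu> h \<tau> I M"
    and rep: "ell_rep (pts M) \<theta> T c \<psi>"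
    and integrable_\<tau>: "p \<in> pts M \<Longrightarrow> integrable (completion \<mu>) (\<lambda>x. \<tau> (p x))"
    and smooth_I\<tau>: "smooth_fun M (pts M) (Ifun \<mu> \<tau>)"
    and diff_I\<tau>: "V \<in> vector_fields M \<Longrightarrow> p \<in> pts M \<Longrightarrow>
      has_bochner_integral (completion \<mu>) (\<lambda>x. V p (\<tau> \<circ> ev x)) (V p (Ifun \<mu> \<tau>))"
begin

sublocale global_chart M \<theta>
  using manifold rep by unfold_locales (auto simp: ell_rep_def)

lemma smooth_\<psi>: "smooth_fun M (pts M) \<psi>" and continuous_T: "continuous_on UNIV T"
  using rep by (auto simp: ell_rep_def)

lemma ell_value: "p \<in> pts M \<Longrightarrow> ell h \<tau> (p x) = \<theta> p \<bullet> T x - c x - \<psi> p"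
  by (rule ell_repD[OF rep])

lemma T_affinely_independent: "(\<And>x. w \<bullet> T x = k) \<Longrightarrow> w = 0"
  by (rule statistic_affinely_independent[OF rep pts_nonempty])

text \<open>\<open>stat V p x\<close> is the derivative of \<open>ell h \<tau> (p x)\<close> in direction \<open>V\<^sub>p\<close>.\<close>

definition stat :: "('x \<Rightarrow> real) vfield \<Rightarrow> ('x \<Rightarrow> real) \<Rightarrow> 'x \<Rightarrow> real" where
  "stat V p x = comps V p \<bullet> T x - V p \<psi>"

text \<open>The derivative of \<open>\<tau>\<close> with respect to \<open>ell h \<tau>\<close> as
  the independent variable; it is the density weight of the metric.\<close>

definition kap :: "real \<Rightarrow> real" where
  "kap t = deriv \<tau> t * chi h \<tau> t"

abbreviation hs where "hs V W p \<equiv> hess flat \<psi> p V W"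

abbreviation g where "g \<equiv> g_ht \<mu> h \<tau>"
abbreviation nabla where "nabla \<equiv> nabla_ht \<mu> h \<tau> M"

lemma kap_pos: "t \<in> I \<Longrightarrow> kap t > 0"
  unfolding kap_def using \<tau>'_pos chi_pos by simp

text \<open>The form to which the derivation rules for sums and constant multiples apply.\<close>

lemma stat_eq: "stat V p x = (\<Sum>k\<in>UNIV. T x $ k * comps V p $ k) + - 1 * V p \<psi>"
  by (simp add: stat_def inner_vec_def mult.commute)

lemma smooth_stat: "V \<in> vector_fields M \<Longrightarrow> smooth_fun M (pts M) (\<lambda>p. stat V p x)"
  unfolding stat_eq
  by (rule smooth_add[OF smooth_sum smooth_mult[OF smooth_const field_smooth[OF _ smooth_\<psi>]]])
     (rule smooth_mult[OF smooth_const smooth_comps_nth])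

text \<open>Differentiating the components gives the components of \<open>flat Z V\<close>, while
  \<open>Z p\<close> applied to \<open>V \<psi>\<close> splits into \<open>flat Z V\<close> on
  \<open>\<psi>\<close> plus the Hessian of \<open>\<psi>\<close>. The Hessian term is the same for
  all \<open>x\<close>.\<close>

lemma field_stat:
  assumes Z: "Z \<in> vector_fields M" and V: "V \<in> vector_fields M" and p: "p \<in> pts M"
  shows "Z p (\<lambda>q. stat V q x) = stat (flat Z V) p x - hs Z V p"
proof -
  note 1 = smooth_mult[OF smooth_const[of "T x $ k" for k] smooth_comps_nth[OF V]]
  note 2 = smooth_mult[OF smooth_const[of "- 1"] field_smooth[OF V smooth_\<psi>]]
  have "Z p (\<lambda>q. stat V q x) = (\<Sum>k\<in>UNIV. T x $ k * Z p (\<lambda>q. comps V q $ k)) + - 1 * Z p (\<lambda>q. V q \<psi>)"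
    unfolding stat_eq
    by (simp only: field_add[OF Z p smooth_sum[OF 1] 2] field_sum[OF Z p finite 1]
        field_cmult[OF Z p smooth_comps_nth[OF V]] field_cmult[OF Z p field_smooth[OF V smooth_\<psi>]])
  then show ?thesis
    unfolding stat_eq by (simp add: comps_flat[OF Z V p] hess_def)
qed

lemma ell_value_eq:
  "p \<in> pts M \<Longrightarrow> (\<Sum>k\<in>UNIV. T x $ k * \<theta> p $ k) + (- c x + - 1 * \<psi> p) = ell h \<tau> (p x)"
  by (simp add: ell_value inner_vec_def mult.commute)

lemma smooth_ell_ev: "smooth_fun M (pts M) (\<lambda>p. ell h \<tau> (p x))"
proof (rule smooth_cong[OF _ ell_value_eq])
  show "smooth_fun M (pts M) (\<lambda>p. (\<Sum>k\<in>UNIV. T x $ k * \<theta> p $ k) + (- c x + - 1 * \<psi> p))"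
    by (rule smooth_add[OF smooth_sum smooth_add[OF smooth_const smooth_mult[OF smooth_const smooth_\<psi>]]])
       (rule smooth_mult[OF smooth_const smooth_\<theta>_nth])
qed

text \<open>The exponential form gives smoothness for every \<open>x\<close>, with no exceptional
  null set: \<open>p x\<close> is the smooth inverse of \<open>ell h \<tau>\<close> applied to a
  smooth function of \<open>p\<close>.\<close>

lemma smooth_ev: "smooth_fun M (pts M) (\<lambda>p. p x)"
proof (rule smooth_cong)
  show "smooth_fun M (pts M) (\<lambda>p. inv_into I (ell h \<tau>) (ell h \<tau> (p x)))"
    by (rule smooth_compose[OF open_ell_I smooth_inv_ell smooth_ell_ev]) (simp add: value_in_I)
  show "inv_into I (ell h \<tau>) (ell h \<tau> (p x)) = p x" if "p \<in> pts M" for p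
    using inv_into_f_f[OF inj_ell value_in_I[OF that]] .
qed

lemma smooth_compose_ev: "smooth_on I F \<Longrightarrow> smooth_fun M (pts M) (\<lambda>p. F (p x))"
  by (rule smooth_compose[OF open_I _ smooth_ev value_in_I])

lemma field_ell:
  assumes V: "V \<in> vector_fields M" and p: "p \<in> pts M"
  shows "V p (\<lambda>q. ell h \<tau> (q x)) = stat V p x"
proof -
  note 1 = smooth_mult[OF smooth_const[of "T x $ k" for k] smooth_\<theta>_nth]
  note 2 = smooth_mult[OF smooth_const[of "- 1"] smooth_\<psi>]
  have "V p (\<lambda>q. ell h \<tau> (q x)) = V p (\<lambda>q. (\<Sum>k\<in>UNIV. T x $ k * \<theta> q $ k) + (- c x + - 1 * \<psi> q))"
    by (rule field_cong[OF V p ell_value_eq[symmetric]])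
  also have "\<dots> = (\<Sum>k\<in>UNIV. T x $ k * V p (\<lambda>q. \<theta> q $ k)) + (0 + - 1 * V p \<psi>)"
    by (simp only: field_add[OF V p smooth_sum[OF 1] smooth_add[OF smooth_const 2]] field_sum[OF V p finite 1]
        field_add[OF V p smooth_const 2] field_const[OF V p]
        field_cmult[OF V p smooth_\<theta>_nth] field_cmult[OF V p smooth_\<psi>])
  finally show ?thesis by (simp add: stat_eq comps_def)
qed

text \<open>The chain rule with \<open>ell h \<tau>\<close>, whose derivative along \<open>V\<close>
  is \<open>stat V p x\<close>, first yields the derivative of the evaluation itself as
  \<open>chi h \<tau> (p x) * stat V p x\<close>.\<close>

lemma field_ev:
  assumes V: "V \<in> vector_fields M" and p: "p \<in> pts M" and F: "smooth_on I F"
  shows "V p (\<lambda>q. F (q x)) = deriv F (p x) * chi h \<tau> (p x) * stat V p x"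
proof -
  have *: "V p (\<lambda>q. F (q x)) = deriv F (p x) * V p (\<lambda>q. q x)" if F: "smooth_on I F" for F
    by (rule field_compose[OF V p open_I F smooth_ev value_in_I])
  have "stat V p x = deriv (ell h \<tau>) (p x) * V p (\<lambda>q. q x)"
    using *[OF smooth_ell] field_ell[OF V p] by simp
  then have "V p (\<lambda>q. q x) = chi h \<tau> (p x) * stat V p x"
    using ell'_chi[OF value_in_I[OF p, of x]] by (simp add: algebra_simps)
  then show ?thesis using *[OF F] by simp
qed

text \<open>Multiplying a derivative by \<open>chi h \<tau>\<close> amounts to differentiating with
  respect to \<open>ell h \<tau>\<close>; \<open>G\<close> is this derivative of \<open>F\<close>.
  The rest is the product rule with \<open>field_stat\<close>.\<close>

lemma field_field_ev:
  assumes Z: "Z \<in> vector_fields M" and V: "V \<in> vector_fields M" and p: "p \<in> pts M"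
    and F: "smooth_on I F" and G: "smooth_on I G" and FG: "\<And>t. t \<in> I \<Longrightarrow> deriv F t * chi h \<tau> t = G t"
  shows "Z p (\<lambda>q. V q (\<lambda>r. F (r x))) = deriv G (p x) * chi h \<tau> (p x) * stat Z p x * stat V p x +
    G (p x) * (stat (flat Z V) p x - hs Z V p)"
proof -
  have "Z p (\<lambda>q. V q (\<lambda>r. F (r x))) = Z p (\<lambda>q. G (q x) * stat V q x)"
    by (rule field_cong[OF Z p]) (simp add: field_ev[OF V _ F] FG value_in_I)
  then show ?thesis
    by (simp add: field_mult[OF Z p smooth_compose_ev[OF G] smooth_stat[OF V]]
        field_ev[OF Z p G] field_stat[OF Z V p])
qed

text \<open>After the derivative in the second argument, the first argument enters only through
  \<open>\<tau> (q x)\<close>, and the derivative of \<open>ell h \<tau>\<close> has cancelled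
  against \<open>chi h \<tau>\<close>.\<close>

lemma vtilde_vhat_d_ev:
  assumes V: "V \<in> vector_fields M" and W: "W \<in> vector_fields M" and p: "p \<in> pts M"
  shows "vtilde V (vhat W (d_ev h \<tau> x)) (p, p) = - (kap (p x) * stat V p x * stat W p x)"
proof -
  have inner: "W p (\<lambda>q'. ddiv h \<tau> t (q' x)) = - stat W p x * (\<tau> t + - \<tau> (p x))" for t
  proof -
    have "W p (\<lambda>q'. ddiv h \<tau> t (q' x)) =
        - (\<tau> t - \<tau> (p x)) * (deriv (ell h \<tau>) (p x) * chi h \<tau> (p x)) * stat W p x"
      using field_ev[OF W p smooth_ddiv_right[of t], of x] by (simp add: deriv_ddiv_right[OF value_in_I[OF p]])
    then show ?thesis unfolding ell'_chi[OF value_in_I[OF p]] by (simp add: algebra_simps)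
  qed
  have "vtilde V (vhat W (d_ev h \<tau> x)) (p, p) = V p (\<lambda>q. - stat W p x * (\<tau> (q x) + - \<tau> (p x)))"
    unfolding vtilde_def vhat_def d_ev_def by (simp add: inner)
  also have "\<dots> = - stat W p x * (deriv \<tau> (p x) * chi h \<tau> (p x) * stat V p x)"
    using field_cmult[OF V p smooth_add[OF smooth_compose_ev[OF smooth_\<tau>] smooth_const[of "- \<tau> (p x)"]],
        of "- stat W p x" x]
    by (simp add: field_add[OF V p smooth_compose_ev[OF smooth_\<tau>] smooth_const[of "- \<tau> (p x)"], of x, simplified]
        field_const[OF V p] field_ev[OF V p smooth_\<tau>])
  finally show ?thesis by (simp add: kap_def)
qed

text \<open>The derivative in the first argument is affine in \<open>ell h \<tau>\<close> of the
  second. So the two remaining derivatives act on \<open>ell h \<tau> (r x)\<close> alone, and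
  \<open>field_stat\<close> gives the second one.\<close>

lemma vhat_vhat_vtilde_d_ev:
  assumes Z: "Z \<in> vector_fields M" and V: "V \<in> vector_fields M" and W: "W \<in> vector_fields M"
    and p: "p \<in> pts M"
  shows "vhat Z (vhat V (vtilde W (d_ev h \<tau> x))) (p, p) =
    - (kap (p x) * stat W p x * (stat (flat Z V) p x - hs Z V p))"
proof -
  let ?a = "- (kap (p x) * stat W p x)"
  have inner: "W p (\<lambda>q. ddiv h \<tau> (q x) s) = ?a * (ell h \<tau> s + - ell h \<tau> (p x))" for s
    using field_ev[OF W p smooth_ddiv_left[of s], of x]
    by (simp add: deriv_ddiv_left[OF value_in_I[OF p]] kap_def algebra_simps)
  have mid: "V q (\<lambda>r. ?a * (ell h \<tau> (r x) + - ell h \<tau> (p x))) = ?a * stat V q x" if q: "q \<in> pts M" for q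
    by (simp only: field_cmult[OF V q smooth_add[OF smooth_ell_ev smooth_const]]
        field_add[OF V q smooth_ell_ev smooth_const] field_const[OF V q] field_ell[OF V q] add_0_right)
  have "vhat Z (vhat V (vtilde W (d_ev h \<tau> x))) (p, p) =
      Z p (\<lambda>q. V q (\<lambda>r. ?a * (ell h \<tau> (r x) + - ell h \<tau> (p x))))"
    unfolding vtilde_def vhat_def d_ev_def by (simp add: inner)
  also have "\<dots> = Z p (\<lambda>q. ?a * stat V q x)" by (rule field_cong[OF Z p mid])
  also have "\<dots> = ?a * (stat (flat Z V) p x - hs Z V p)"
    by (simp only: field_cmult[OF Z p smooth_stat[OF V]] field_stat[OF Z V p])
  finally show ?thesis by simp
qed

lemma g_has_integral:
  assumes V: "V \<in> vector_fields M" and W: "W \<in> vector_fields M" and p: "p \<in> pts M"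
  shows "has_bochner_integral (completion \<mu>) (\<lambda>x. kap (p x) * stat V p x * stat W p x) (g p V W)"
proof -
  have "integrable (completion \<mu>) (\<lambda>x. vtilde V (vhat W (d_ev h \<tau> x)) (p, p))"
    using compat V W p unfolding compatible_def by blast
  from has_bochner_integral_minus[OF has_bochner_integral_integrable[OF this]] show ?thesis
    by (simp add: g_ht_def vtilde_vhat_d_ev[OF V W p])
qed

lemma \<tau>_has_integral:
  assumes V: "V \<in> vector_fields M" and p: "p \<in> pts M"
  shows "has_bochner_integral (completion \<mu>) (\<lambda>x. kap (p x) * stat V p x) (V p (Ifun \<mu> \<tau>))"
  using diff_I\<tau>[OF V p] by (simp add: o_def field_ev[OF V p smooth_\<tau>] kap_def)

lemma gnabla_eq:
  assumes Z: "Z \<in> vector_fields M" and V: "V \<in> vector_fields M" and W: "W \<in> vector_fields M"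
    and p: "p \<in> pts M"
  shows "gnabla_ht \<mu> h \<tau> p Z V W = g p (flat Z V) W - hs Z V p * W p (Ifun \<mu> \<tau>)"
proof -
  have "has_bochner_integral (completion \<mu>) (\<lambda>x. vhat Z (vhat V (vtilde W (d_ev h \<tau> x))) (p, p))
      (- (g p (flat Z V) W - hs Z V p * W p (Ifun \<mu> \<tau>)))"
    unfolding vhat_vhat_vtilde_d_ev[OF Z V W p]
    using has_bochner_integral_minus[OF has_bochner_integral_diff[OF
        g_has_integral[OF flat_vector_field[OF Z V] W p]
        has_bochner_integral_mult_right[OF \<tau>_has_integral[OF W p], of "hs Z V p"]]]
    by (simp add: algebra_simps)
  then show ?thesis by (simp add: gnabla_ht_def has_bochner_integral_integral_eq)
qed

section \<open>Tensoriality and positive definiteness of the metric\<close>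

lemma stat_cong:
  assumes "V \<in> vector_fields M" "W \<in> vector_fields M" "p \<in> pts M" "comps V p = comps W p"
  shows "stat V p x = stat W p x"
  using assms field_eqI[OF assms] by (simp add: stat_def)

lemma stat_zero:
  assumes V: "V \<in> vector_fields M" and p: "p \<in> pts M" and 0: "comps V p = 0"
  shows "stat V p x = 0"
proof -
  have s: "smooth_at M p \<psi>" by (rule smooth_fun_imp_smooth_at[OF smooth_\<psi> p])
  have "V p \<psi> = 0" using field_apply[OF V s] 0 linear_0[OF D_linear[OF s]] by simp
  then show ?thesis using 0 by (simp add: stat_def)
qed

lemma stat_vadd:
  "V \<in> vector_fields M \<Longrightarrow> W \<in> vector_fields M \<Longrightarrow> stat (vadd V W) p x = stat V p x + stat W p x"
  unfolding stat_def comps_vadd by (simp add: vadd_def inner_add_left)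

lemma stat_vscale:
  "smooth_fun M (pts M) u \<Longrightarrow> V \<in> vector_fields M \<Longrightarrow> stat (vscale u V) p x = u p * stat V p x"
  unfolding stat_def comps_vscale by (simp add: vscale_def right_diff_distrib)

lemma g_commute:
  "V \<in> vector_fields M \<Longrightarrow> W \<in> vector_fields M \<Longrightarrow> p \<in> pts M \<Longrightarrow> g p V W = g p W V"
  by (rule has_bochner_integral_unique[OF g_has_integral g_has_integral]) auto

lemma g_vadd:
  assumes "V \<in> vector_fields M" "Z \<in> vector_fields M" "W \<in> vector_fields M" "p \<in> pts M"
  shows "g p (vadd V Z) W = g p V W + g p Z W"
  by (rule has_bochner_integral_unique[OF g_has_integral
        has_bochner_integral_add[OF g_has_integral g_has_integral]])
     (use assms in \<open>auto simp: vadd_vector_field stat_vadd algebra_simps\<close>)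

lemma g_vscale:
  assumes "smooth_fun M (pts M) u" "V \<in> vector_fields M" "W \<in> vector_fields M" "p \<in> pts M"
  shows "g p (vscale u V) W = u p * g p V W"
  by (rule has_bochner_integral_unique[OF g_has_integral
        has_bochner_integral_mult_right[OF g_has_integral]])
     (use assms in \<open>auto simp: vscale_vector_field stat_vscale algebra_simps\<close>)

text \<open>The set where \<open>f\<close> is nonzero is open, and full support gives every nonempty
  open set positive measure.\<close>

lemma AE_zero_imp_zero:
  assumes f: "continuous_on UNIV f" and AE: "AE x in completion \<mu>. f x = (0::real)"
  shows "f x = 0"
proof (rule ccontr)
  assume x: "f x \<noteq> 0"
  have sets: "sets \<mu> = sets borel" using radon by (simp add: radon_measure_def)
  have sp: "space \<mu> = UNIV" using sets_eq_imp_space_eq[OF sets] by simp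
  let ?U = "{x. f x \<noteq> 0}"
  have "?U = f -` (- {0})" by auto
  then have o: "open ?U" using f by (simp add: open_vimage open_Compl)
  then have "?U \<in> sets \<mu>" by (simp add: sets)
  then have "emeasure \<mu> ?U = 0"
    using AE unfolding AE_completion_iff by (subst (asm) AE_iff_measurable[of ?U]) (auto simp: sp)
  moreover have "emeasure \<mu> ?U > 0"
    using support x o unfolding measure_support_def by blast
  ultimately show False by simp
qed

lemma continuous_stat: "continuous_on UNIV (stat V p)"
  unfolding stat_def by (intro continuous_intros continuous_T)

text \<open>A nonnegative integrand with integral zero vanishes almost everywhere; continuity of
  \<open>T\<close> extends this to every \<open>x\<close>, and affine independence concludes. The
  weight is \<open>kap\<close> for the metric and a product of \<open>chi h \<tau>\<close> with its
  derivative for the Hessian of \<open>\<psi>\<close>.\<close>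

lemma weighted_stat_integral_zero:
  assumes V: "V \<in> vector_fields M" and p: "p \<in> pts M" and w: "\<And>t. t \<in> I \<Longrightarrow> w t > 0"
    and int: "has_bochner_integral (completion \<mu>) (\<lambda>x. w (p x) * stat V p x * stat V p x) 0"
  shows "comps V p = 0"
proof -
  have nn: "w (p x) * stat V p x * stat V p x \<ge> 0" for x
    using w[OF value_in_I[OF p, of x]] by (simp add: mult.assoc)
  have "AE x in completion \<mu>. w (p x) * stat V p x * stat V p x = 0"
    using integral_nonneg_eq_0_iff_AE[OF has_bochner_integral_iff[THEN iffD1, OF int, THEN conjunct1], THEN iffD1] nn
      has_bochner_integral_integral_eq[OF int] by simp
  then have "AE x in completion \<mu>. stat V p x = 0"
  proof eventually_elim
    case (elim x)
    then show ?case using w[OF value_in_I[OF p, of x]] by simp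
  qed
  then have "stat V p x = 0" for x by (rule AE_zero_imp_zero[OF continuous_stat])
  then have "comps V p \<bullet> T x = V p \<psi>" for x by (simp add: stat_def)
  then show ?thesis by (rule T_affinely_independent)
qed

lemma g_definite:
  assumes V: "V \<in> vector_fields M" and p: "p \<in> pts M"
  shows "g p V V \<ge> 0" and "g p V V = 0 \<Longrightarrow> comps V p = 0"
proof -
  note int = g_has_integral[OF V V p]
  show "comps V p = 0" if "g p V V = 0"
    using weighted_stat_integral_zero[OF V p kap_pos] int that by simp
  have "kap (p x) * stat V p x * stat V p x \<ge> 0" for x
    using kap_pos[OF value_in_I[OF p, of x]] by (simp add: mult.assoc)
  then have "(LINT x|completion \<mu>. kap (p x) * stat V p x * stat V p x) \<ge> 0" by simp
  then show "g p V V \<ge> 0" using has_bochner_integral_integral_eq[OF int] by simp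
qed

text \<open>Resolves the definite description: the difference of two solutions, tested against
  itself, has length zero.\<close>

lemma nabla_eqI:
  assumes Y: "Y \<in> vector_fields M"
    and gY: "\<And>W p. W \<in> vector_fields M \<Longrightarrow> p \<in> pts M \<Longrightarrow> g p Y W = gnabla_ht \<mu> h \<tau> p Z V W"
  shows "nabla Z V = Y"
  unfolding nabla_ht_def
proof (rule the_equality)
  show "Y \<in> vector_fields M \<and> (\<forall>W\<in>vector_fields M. \<forall>p\<in>pts M. g p Y W = gnabla_ht \<mu> h \<tau> p Z V W)"
    using Y gY by blast
  fix Y' assume "Y' \<in> vector_fields M \<and> (\<forall>W\<in>vector_fields M. \<forall>p\<in>pts M. g p Y' W = gnabla_ht \<mu> h \<tau> p Z V W)"
  then have Y': "Y' \<in> vector_fields M"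
    "\<And>W p. W \<in> vector_fields M \<Longrightarrow> p \<in> pts M \<Longrightarrow> g p Y' W = gnabla_ht \<mu> h \<tau> p Z V W" by auto
  have s: "smooth_fun M (pts M) (\<lambda>_. - 1 :: real)" by (rule smooth_const)
  let ?X = "vadd Y (vscale (\<lambda>_. - 1) Y')"
  have mX: "vscale (\<lambda>_. - 1) Y' \<in> vector_fields M" by (rule vscale_vector_field[OF s Y'(1)])
  have X: "?X \<in> vector_fields M" by (rule vadd_vector_field[OF Y mX])
  show "Y' = Y"
  proof (rule vector_field_eqI[OF Y'(1) Y])
    fix p assume p: "p \<in> pts M"
    have "g p ?X ?X = g p Y ?X + - 1 * g p Y' ?X"
      by (simp only: g_vadd[OF Y mX X p] g_vscale[OF s Y'(1) X p])
    also have "\<dots> = 0" by (simp add: gY[OF X p] Y'(2)[OF X p])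
    finally have "comps ?X p = 0" by (rule g_definite(2)[OF X p])
    then show "comps Y' p = comps Y p"
      by (simp add: comps_vadd[OF Y mX] comps_vscale[OF s Y'(1)])
  qed
qed

lemma nabla_eq_flat:
  assumes "Ifun \<mu> \<tau> constant_on pts M" "Z \<in> vector_fields M" "V \<in> vector_fields M"
  shows "nabla Z V = flat Z V"
  by (rule nabla_eqI[OF flat_vector_field]) (use assms in \<open>simp_all add: gnabla_eq field_constant_on\<close>)

section \<open>Affine coordinates and constancy of the integral of \<open>\<tau>\<close>\<close>

abbreviation I\<tau> where "I\<tau> \<equiv> Ifun \<mu> \<tau>"

lemma christoffel_eq:
  "p \<in> pts M \<Longrightarrow> christoffel M nabla \<theta> k i j p = comps (nabla (frame i) (frame j)) p $ k"
  by (simp add: christoffel_def frame_def comps_def)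

lemma affine_if_constant:
  assumes "I\<tau> constant_on pts M"
  shows "affine_coords M nabla \<theta>"
  unfolding affine_coords_def
  by (simp add: chart christoffel_eq nabla_eq_flat[OF assms frame_vector_field frame_vector_field]
      comps_flat_frame)

lemma stat_frame_expand:
  assumes W: "W \<in> vector_fields M" and p: "p \<in> pts M"
  shows "stat W p x = (\<Sum>j\<in>UNIV. comps W p $ j * stat (frame j) p x)"
  unfolding stat_def field_frame_expand[OF W p smooth_\<psi>]
  by (simp add: comps_frame[OF p] inner_axis' right_diff_distrib sum_subtractf)
     (simp add: inner_vec_def)

lemma g_frame_expand:
  assumes V: "V \<in> vector_fields M" and W: "W \<in> vector_fields M" and p: "p \<in> pts M"
  shows "g p V W = (\<Sum>j\<in>UNIV. comps W p $ j * g p V (frame j))"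
proof (rule has_bochner_integral_unique[OF g_has_integral[OF V W p]])
  show "has_bochner_integral (completion \<mu>)
      (\<lambda>x. \<Sum>j\<in>UNIV. comps W p $ j * (kap (p x) * stat V p x * stat (frame j) p x))
      (\<Sum>j\<in>UNIV. comps W p $ j * g p V (frame j))"
    by (intro has_bochner_integral_sum has_bochner_integral_mult_right g_has_integral V p frame_vector_field)
  show "kap (p x) * stat V p x * stat W p x =
      (\<Sum>j\<in>UNIV. comps W p $ j * (kap (p x) * stat V p x * stat (frame j) p x))" for x
    by (subst stat_frame_expand[OF W p]) (simp add: sum_distrib_left mult_ac)
qed

text \<open>The Gram matrix in the coordinate frame is invertible and its inverse is smooth by Cramer's rule.\<close>

lemma exists_riesz_field:
  assumes b: "\<And>j. smooth_fun M (pts M) (\<lambda>p. b p $ j)"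
  shows "\<exists>Y\<in>vector_fields M. \<forall>W\<in>vector_fields M. \<forall>p\<in>pts M. g p Y W = comps W p \<bullet> b p"
proof -
  define G :: "('x \<Rightarrow> real) \<Rightarrow> real^'n^'n" where "G p = (\<chi> j i. g p (frame j) (frame i))" for p
  have smooth_g: "smooth_fun M (pts M) (\<lambda>p. g p (frame j) (frame i))" for i j
    using compat frame_vector_field unfolding compatible_def by blast
  have Gv: "(G p *v y) $ j = g p (fld (\<lambda>_. y)) (frame j)" if p: "p \<in> pts M" for p y j
  proof -
    have Y: "fld (\<lambda>_. y) \<in> vector_fields M" by (rule fld_vector_field[OF smooth_const])
    have "g p (fld (\<lambda>_. y)) (frame j) = g p (frame j) (fld (\<lambda>_. y))"
      by (rule g_commute[OF Y frame_vector_field p])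
    also have "\<dots> = (\<Sum>i\<in>UNIV. y $ i * g p (frame j) (frame i))"
      using g_frame_expand[OF frame_vector_field Y p] comps_fld[OF smooth_const p] by simp
    finally show ?thesis by (simp add: G_def matrix_vector_mult_def mult.commute)
  qed
  \<comment> \<open>A kernel vector, read as a field with constant components, is orthogonal to the
    frame and hence to itself.\<close>
  have det: "det (G p) \<noteq> 0" if p: "p \<in> pts M" for p
  proof -
    have "y = 0" if y: "G p *v y = 0" for y
    proof -
      have Y: "fld (\<lambda>_. y) \<in> vector_fields M" by (rule fld_vector_field[OF smooth_const])
      have "g p (fld (\<lambda>_. y)) (frame j) = 0" for j using Gv[OF p, of y j] y by simp
      then have "g p (fld (\<lambda>_. y)) (fld (\<lambda>_. y)) = 0" using g_frame_expand[OF Y Y p] by simp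
      then have "comps (fld (\<lambda>_. y)) p = 0" by (rule g_definite(2)[OF Y p])
      then show ?thesis using comps_fld[OF smooth_const p, of y] by simp
    qed
    then have "inj ((*v) (G p))"
      using linear_injective_0[OF matrix_vector_mul_linear[of "G p"]] by blast
    then show ?thesis
      unfolding matrix_left_invertible_injective[symmetric] invertible_left_inverse[symmetric]
        invertible_det_nz .
  qed
  define y where "y p = (\<chi> k. det (\<chi> i j. if j = k then b p $ i else G p $ i $ j) / det (G p))" for p
  have Gy: "G p *v y p = b p" if "p \<in> pts M" for p
    using cramer[OF det[OF that], of "y p" "b p"] by (simp add: y_def)
  have "smooth_fun M (pts M) (\<lambda>p. det (\<chi> i j. if j = k then b p $ i else G p $ i $ j) * (1 / det (G p)))" for k
  proof (intro smooth_mult smooth_divide det smooth_det)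
    show "smooth_fun M (pts M) (\<lambda>p. (\<chi> i j. if j = k then b p $ i else G p $ i $ j) $ i $ j)" for i j
      using b smooth_g by (cases "j = k") (simp_all add: G_def)
    show "smooth_fun M (pts M) (\<lambda>p. G p $ i $ j)" for i j
      using smooth_g by (simp add: G_def)
  qed
  then have y: "smooth_fun M (pts M) y"
    unfolding smooth_componentwise by (simp add: y_def)
  have "g p (fld y) W = comps W p \<bullet> b p" if W: "W \<in> vector_fields M" and p: "p \<in> pts M" for W p
  proof -
    \<comment> \<open>At \<open>p\<close> the field may be replaced by the one with constant
      components \<open>y p\<close>, since the metric depends on values at \<open>p\<close> only;
      for constant components the Gram matrix computes it.\<close>
    have Y: "fld y \<in> vector_fields M" "fld (\<lambda>_. y p) \<in> vector_fields M"
      by (rule fld_vector_field[OF y], rule fld_vector_field[OF smooth_const])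
    have "comps (fld y) p = comps (fld (\<lambda>_. y p)) p"
      by (simp add: comps_fld[OF y p] comps_fld[OF smooth_const p])
    then have st: "stat (fld y) p x = stat (fld (\<lambda>_. y p)) p x" for x by (rule stat_cong[OF Y p])
    have "g p (fld y) (frame j) = b p $ j" for j
    proof -
      have "g p (fld y) (frame j) = g p (fld (\<lambda>_. y p)) (frame j)"
        by (rule has_bochner_integral_unique[OF g_has_integral[OF Y(1) frame_vector_field p]
              g_has_integral[OF Y(2) frame_vector_field p]]) (simp add: st)
      then show ?thesis using Gv[OF p, of "y p" j] Gy[OF p] by simp
    qed
    then show ?thesis using g_frame_expand[OF Y(1) W p] by (simp add: inner_vec_def)
  qed
  then show ?thesis using fld_vector_field[OF y] by blast
qed

text \<open>By \<open>gnabla_eq\<close> the prescribed value is linear in \<open>comps W p\<close>,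
  so it is represented by its values on the frame, which are smooth by compatibility. This covers
  the case of nonconstant \<open>I\<tau>\<close>, where \<open>nabla\<close> is not yet identified
  with \<open>flat\<close>.\<close>

lemma exists_nabla:
  assumes Z: "Z \<in> vector_fields M" and V: "V \<in> vector_fields M"
  shows "\<exists>Y\<in>vector_fields M. \<forall>W\<in>vector_fields M. \<forall>p\<in>pts M. g p Y W = gnabla_ht \<mu> h \<tau> p Z V W"
proof -
  have "smooth_fun M (pts M) (\<lambda>p. (\<chi> j. gnabla_ht \<mu> h \<tau> p Z V (frame j)) $ j)" for j
    using compat frame_vector_field Z V unfolding compatible_def by simp
  from exists_riesz_field[OF this] obtain Y where Y: "Y \<in> vector_fields M"
    "\<And>W p. W \<in> vector_fields M \<Longrightarrow> p \<in> pts M \<Longrightarrow>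
      g p Y W = comps W p \<bullet> (\<chi> j. gnabla_ht \<mu> h \<tau> p Z V (frame j))" by blast
  have "g p Y W = gnabla_ht \<mu> h \<tau> p Z V W" if W: "W \<in> vector_fields M" and p: "p \<in> pts M" for W p
  proof -
    have "g p Y W = (\<Sum>j\<in>UNIV. comps W p $ j * gnabla_ht \<mu> h \<tau> p Z V (frame j))"
      using Y(2)[OF W p] by (simp add: inner_vec_def)
    also have "\<dots> = (\<Sum>j\<in>UNIV. comps W p $ j * g p (flat Z V) (frame j)) -
        hs Z V p * (\<Sum>j\<in>UNIV. comps W p $ j * frame j p I\<tau>)"
      by (simp add: gnabla_eq[OF Z V frame_vector_field p] right_diff_distrib sum_subtractf
          sum_distrib_left mult_ac)
    also have "\<dots> = gnabla_ht \<mu> h \<tau> p Z V W"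
      by (simp add: gnabla_eq[OF Z V W p] g_frame_expand[OF flat_vector_field[OF Z V] W p]
          field_frame_expand[OF W p smooth_I\<tau>])
    finally show ?thesis .
  qed
  then show ?thesis using Y(1) by blast
qed

lemma g_zero:
  assumes "V \<in> vector_fields M" "W \<in> vector_fields M" "p \<in> pts M" "comps V p = 0"
  shows "g p V W = 0"
  using has_bochner_integral_integral_eq[OF g_has_integral[OF assms(1-3)]]
  by (simp add: stat_zero[OF assms(1,3,4)])

lemma field_field_ev_integral_zero:
  assumes "V \<in> vector_fields M" "W \<in> vector_fields M" "p \<in> pts M"
  shows "has_bochner_integral (completion \<mu>) (\<lambda>x. V p (\<lambda>q. W q (ev x))) 0"
proof -
  have "statistical_model \<mu> M" using family by (simp add: exponential_family_def)
  then have "\<forall>V\<in>vector_fields M. \<forall>W\<in>vector_fields M. \<forall>p\<in>pts M.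
      has_bochner_integral (completion \<mu>) (\<lambda>x. V p (ev x)) 0 \<and>
      has_bochner_integral (completion \<mu>) (\<lambda>x. V p (\<lambda>q. W q (ev x))) 0"
    unfolding statistical_model_def by (elim conjE bexE) assumption
  from this[rule_format, OF assms] show ?thesis by (rule conjunct2)
qed

text \<open>In affine coordinates the connection coefficients vanish, which leaves
  \<open>hs (frame i) (frame j) p * W p I\<tau> = 0\<close>. The diagonal entries of the Hessian of \<open>\<psi>\<close> are nonzero because
  the second derivative of \<open>ev x\<close> integrates to zero.\<close>

lemma hs_frame_nonzero:
  assumes chi': "\<And>t. t \<in> I \<Longrightarrow> deriv (chi h \<tau>) t > 0" and p: "p \<in> pts M"
  shows "hs (frame i) (frame i) p \<noteq> 0"
proof
  assume 0: "hs (frame i) (frame i) p = 0"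
  let ?E = "frame i"
  note E = frame_vector_field[of i]
  have id: "deriv (\<lambda>t::real. t) t * chi h \<tau> t = chi h \<tau> t" for t by simp
  \<comment> \<open>For the identity function, \<open>G\<close> is \<open>chi h \<tau>\<close>. The
    other summand drops out: the frame is parallel for \<open>flat\<close>, and the Hessian entry is
    zero by assumption.\<close>
  have "?E p (\<lambda>q. ?E q (\<lambda>r. r x)) = deriv (chi h \<tau>) (p x) * chi h \<tau> (p x) * stat ?E p x * stat ?E p x" for x
    using field_field_ev[where F="\<lambda>t. t" and G="chi h \<tau>" and x=x, OF E E p smooth_on_ident[OF open_I] smooth_chi id]
      stat_zero[OF flat_vector_field[OF E E] p comps_flat_frame[OF p]] 0 by simp
  moreover have "has_bochner_integral (completion \<mu>) (\<lambda>x. ?E p (\<lambda>q. ?E q (ev x))) 0"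
    by (rule field_field_ev_integral_zero[OF E E p])
  ultimately have "has_bochner_integral (completion \<mu>)
      (\<lambda>x. (\<lambda>t. deriv (chi h \<tau>) t * chi h \<tau> t) (p x) * stat ?E p x * stat ?E p x) 0" by simp
  then have "comps ?E p = 0"
    using weighted_stat_integral_zero[OF E p, of "\<lambda>t. deriv (chi h \<tau>) t * chi h \<tau> t"] chi' chi_pos by simp
  then have "axis i (1::real) = 0" using comps_frame[OF p] by simp
  then show False by (simp add: axis_eq_0_iff)
qed

lemma constant_if_affine:
  assumes chi': "\<And>t. t \<in> I \<Longrightarrow> deriv (chi h \<tau>) t > 0" and aff: "affine_coords M nabla \<theta>"
  shows "I\<tau> constant_on pts M"
proof (rule constant_if_fields_zero[OF smooth_I\<tau>])
  fix W p assume W: "W \<in> vector_fields M" and p: "p \<in> pts M"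
  \<comment> \<open>One coordinate direction is enough, and the index type has an element.\<close>
  obtain i :: 'n where True by blast
  let ?E = "frame i"
  note E = frame_vector_field[of i]
  obtain Y where Y: "Y \<in> vector_fields M"
    "\<And>W p. W \<in> vector_fields M \<Longrightarrow> p \<in> pts M \<Longrightarrow> g p Y W = gnabla_ht \<mu> h \<tau> p ?E ?E W"
    using exists_nabla[OF E E] by blast
  have Y_eq: "nabla ?E ?E = Y" by (rule nabla_eqI[OF Y])
  have "comps (nabla ?E ?E) p = 0"
    using aff p christoffel_eq[OF p] by (simp add: affine_coords_def vec_eq_iff)
  then have "comps Y p = 0" unfolding Y_eq .
  then have "gnabla_ht \<mu> h \<tau> p ?E ?E W = 0"
    using g_zero[OF Y(1) W p] Y(2)[OF W p] by simp
  then have "hs ?E ?E p * W p I\<tau> = 0"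
    by (simp add: gnabla_eq[OF E E W p] g_zero[OF flat_vector_field[OF E E] W p comps_flat_frame[OF p]])
  then show "W p I\<tau> = 0" using hs_frame_nonzero[OF chi' p] by simp
qed

section \<open>The Hessian structure\<close>

lemma riemannian_g: "riemannian_metric M g"
  unfolding riemannian_metric_def
proof (intro conjI ballI allI impI)
  show "smooth_fun M (pts M) (\<lambda>p. g p V W)" if "V \<in> vector_fields M" "W \<in> vector_fields M" for V W
    using compat that unfolding compatible_def by blast
  show "g p V V > 0" if V: "V \<in> vector_fields M" and p: "p \<in> pts M" and nz: "V p \<noteq> (\<lambda>_. 0)" for V p
  proof (rule ccontr)
    assume "\<not> g p V V > 0"
    then have 0: "comps V p = 0" using g_definite[OF V p] by force
    have "V p f = 0" for f
      using field_apply[OF V, of p f] field_not_smooth[OF V, of p f] 0 linear_0[OF D_linear]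
      by (cases "smooth_at M p f") auto
    then show False using nz by blast
  qed
qed (simp_all add: g_commute g_vadd g_vscale)

abbreviation Is where "Is \<equiv> Ifun \<mu> (sstar h \<tau>)"

definition potential where "potential p = - Is p + \<psi> p * I\<tau> p"

context
  assumes const: "I\<tau> constant_on pts M"
begin

lemma nabla_flat: "V \<in> vector_fields M \<Longrightarrow> W \<in> vector_fields M \<Longrightarrow> nabla V W = flat V W"
  by (rule nabla_eq_flat[OF const])

lemma affine_connection_nabla: "affine_connection M nabla"
  unfolding affine_connection_def
proof (intro ballI conjI allI impI)
  fix Z V assume Z: "Z \<in> vector_fields M" and V: "V \<in> vector_fields M"
  note ZV = flat_vector_field[OF Z V]
  show "nabla Z V \<in> vector_fields M" by (simp add: nabla_flat Z V ZV)
  show "nabla (vadd Z Y) V = vadd (nabla Z V) (nabla Y V)" if Y: "Y \<in> vector_fields M" for Y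
    unfolding nabla_flat[OF vadd_vector_field[OF Z Y] V] nabla_flat[OF Z V] nabla_flat[OF Y V]
    by (rule flat_eqI[OF vadd_vector_field[OF Z Y] V vadd_vector_field[OF ZV flat_vector_field[OF Y V]]])
       (simp add: comps_vadd[OF ZV flat_vector_field[OF Y V]] comps_flat Z V Y, simp add: vadd_def)
  show "nabla Z (vadd V W) = vadd (nabla Z V) (nabla Z W)" if W: "W \<in> vector_fields M" for W
    unfolding nabla_flat[OF Z vadd_vector_field[OF V W]] nabla_flat[OF Z V] nabla_flat[OF Z W]
    by (rule flat_eqI[OF Z vadd_vector_field[OF V W] vadd_vector_field[OF ZV flat_vector_field[OF Z W]]])
       (simp add: comps_vadd[OF ZV flat_vector_field[OF Z W]] comps_vadd[OF V W] comps_flat Z V W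
         field_add[OF Z _ smooth_comps_nth[OF V] smooth_comps_nth[OF W]])
  fix u :: "('x \<Rightarrow> real) \<Rightarrow> real" assume u: "smooth_fun M (pts M) u"
  note uZ = vscale_vector_field[OF u Z] and uV = vscale_vector_field[OF u V]
    and uZV = vscale_vector_field[OF u ZV]
  show "nabla (vscale u Z) V = vscale u (nabla Z V)"
    unfolding nabla_flat[OF uZ V] nabla_flat[OF Z V]
    by (rule flat_eqI[OF uZ V uZV]) (simp add: comps_vscale[OF u ZV] comps_flat Z V, simp add: vscale_def)
  have Zu: "smooth_fun M (pts M) (\<lambda>p. Z p u)" by (rule field_smooth[OF Z u])
  note ZuV = vscale_vector_field[OF Zu V]
  show "nabla Z (vscale u V) = vadd (vscale (\<lambda>p. Z p u) V) (vscale u (nabla Z V))"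
    unfolding nabla_flat[OF Z uV] nabla_flat[OF Z V]
    by (rule flat_eqI[OF Z uV vadd_vector_field[OF ZuV uZV]])
       (simp add: comps_vadd[OF ZuV uZV] comps_vscale[OF u ZV] comps_vscale[OF u V] comps_vscale[OF Zu V]
         comps_flat Z V field_mult[OF Z _ u smooth_comps_nth[OF V]])
qed

lemma torsion_free_nabla: "torsion_free M nabla"
  unfolding torsion_free_def
proof (intro ballI allI)
  fix V W p f assume V: "V \<in> vector_fields M" and W: "W \<in> vector_fields M" and p: "p \<in> pts M"
  note L = lie_bracket_vector_field[OF V W] and VW = flat_vector_field[OF V W] and WV = flat_vector_field[OF W V]
  have "comps (flat V W) p = comps (vadd (flat W V) (lie_bracket M V W)) p"
    unfolding comps_vadd[OF WV L]
    by (simp add: vec_eq_iff comps_flat[OF V W p] comps_flat[OF W V p] comps_lie_bracket[OF V W p])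
  from field_eqI[OF VW vadd_vector_field[OF WV L] p this]
  show "nabla V W p f - nabla W V p f - lie_bracket M V W p f = 0"
    by (simp add: nabla_flat V W vadd_def)
qed

text \<open>On components \<open>flat\<close> acts as the field itself, so the claim becomes the
  definition of the Lie bracket applied to the component functions of \<open>Z\<close>.\<close>

lemma curvature_free_nabla: "curvature_free M nabla"
  unfolding curvature_free_def
proof (intro ballI allI)
  fix V W Z p f
  assume V: "V \<in> vector_fields M" and W: "W \<in> vector_fields M" and Z: "Z \<in> vector_fields M"
    and p: "p \<in> pts M"
  note L = lie_bracket_vector_field[OF V W] and VZ = flat_vector_field[OF V Z] and WZ = flat_vector_field[OF W Z]
  note VWZ = flat_vector_field[OF V WZ] and WVZ = flat_vector_field[OF W VZ] and LZ = flat_vector_field[OF L Z]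
  have nest: "comps (flat A (flat B Z)) p $ k = A p (\<lambda>q. B q (\<lambda>r. comps Z r $ k))"
    if A: "A \<in> vector_fields M" and B: "B \<in> vector_fields M" for A B k
    unfolding comps_flat[OF A flat_vector_field[OF B Z] p]
    by (rule field_cong[OF A p comps_flat[OF B Z]])
  have "smooth_at M p (\<lambda>q. comps Z q $ k)" for k
    by (rule smooth_fun_imp_smooth_at[OF smooth_comps_nth[OF Z] p])
  then have "comps (flat V (flat W Z)) p = comps (vadd (flat W (flat V Z)) (flat (lie_bracket M V W) Z)) p"
    unfolding comps_vadd[OF WVZ LZ]
    by (simp add: vec_eq_iff nest V W comps_flat[OF L Z p]) (simp add: lie_bracket_def)
  from field_eqI[OF VWZ vadd_vector_field[OF WVZ LZ] p this]
  show "nabla V (nabla W Z) p f - nabla W (nabla V Z) p f - nabla (lie_bracket M V W) Z p f = 0"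
    by (simp add: nabla_flat V W Z L VZ WZ vadd_def)
qed

section \<open>The potential and the canonical divergence\<close>

context
  assumes integrable_sstar: "\<forall>p\<in>pts M. integrable (completion \<mu>) (\<lambda>x. sstar h \<tau> (p x))"
    and smooth_Is: "smooth_fun M (pts M) Is"
    and diff_sstar: "\<forall>V\<in>vector_fields M. \<forall>W\<in>vector_fields M. \<forall>p\<in>pts M.
      has_bochner_integral (completion \<mu>) (\<lambda>x. V p (sstar h \<tau> \<circ> ev x)) (V p Is) \<and>
      has_bochner_integral (completion \<mu>) (\<lambda>x. V p (\<lambda>q. W q (sstar h \<tau> \<circ> ev x))) (V p (\<lambda>q. W q Is))"
begin

lemma deriv_sstar_chi: "t \<in> I \<Longrightarrow> deriv (sstar h \<tau>) t * chi h \<tau> t = - 1 * \<tau> t"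
  by (simp add: deriv_sstar mult.assoc ell'_chi)

lemma smooth_minus_\<tau>: "smooth_on I (\<lambda>t. - 1 * \<tau> t)"
  by (rule smooth_on_mult[OF open_I smooth_on_const smooth_\<tau>])

lemma deriv_minus_\<tau>: "t \<in> I \<Longrightarrow> deriv (\<lambda>t. - 1 * \<tau> t) t = - deriv \<tau> t"
  by (rule DERIV_imp_deriv) (auto intro!: derivative_eq_intros has_deriv_\<tau>)

lemma field_Is:
  assumes V: "V \<in> vector_fields M" and p: "p \<in> pts M"
  shows "has_bochner_integral (completion \<mu>) (\<lambda>x. - \<tau> (p x) * stat V p x) (V p Is)"
proof -
  have "V p (\<lambda>q. sstar h \<tau> (q x)) = - \<tau> (p x) * stat V p x" for x
    unfolding field_ev[OF V p smooth_sstar] deriv_sstar_chi[OF value_in_I[OF p]] by simp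
  then show ?thesis using diff_sstar[rule_format, OF V V p] by (simp add: o_def)
qed

text \<open>Integrates \<open>field_field_ev\<close> for \<open>sstar h \<tau>\<close>, whose
  derivative with respect to \<open>ell h \<tau>\<close> is minus \<open>\<tau>\<close>. The
  quadratic part gives the metric, the linear part the derivative along \<open>flat V W\<close>, and
  the Hessian of \<open>\<psi>\<close> comes out of the integral with factor
  \<open>I\<tau> p\<close>.\<close>

lemma field_field_Is:
  assumes V: "V \<in> vector_fields M" and W: "W \<in> vector_fields M" and p: "p \<in> pts M"
  shows "V p (\<lambda>q. W q Is) = - g p V W + flat V W p Is + hs V W p * I\<tau> p"
proof (rule has_bochner_integral_unique[OF diff_sstar[rule_format, OF V W p, THEN conjunct2]])
  have "has_bochner_integral (completion \<mu>) (\<lambda>x. \<tau> (p x)) (I\<tau> p)"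
    using integrable_\<tau>[OF p] by (simp add: has_bochner_integral_iff Ifun_def)
  then show "has_bochner_integral (completion \<mu>)
     (\<lambda>x. - (kap (p x) * stat V p x * stat W p x) + - \<tau> (p x) * stat (flat V W) p x + hs V W p * \<tau> (p x))
     (- g p V W + flat V W p Is + hs V W p * I\<tau> p)"
    by (intro has_bochner_integral_add has_bochner_integral_minus has_bochner_integral_mult_right
        g_has_integral V W p field_Is flat_vector_field)
  show "V p (\<lambda>q. W q (sstar h \<tau> \<circ> ev x)) =
      - (kap (p x) * stat V p x * stat W p x) + - \<tau> (p x) * stat (flat V W) p x + hs V W p * \<tau> (p x)" for x
    using field_field_ev[where F="sstar h \<tau>" and G="\<lambda>t. - 1 * \<tau> t" and x=x,
        OF V W p smooth_sstar smooth_minus_\<tau> deriv_sstar_chi]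
    unfolding deriv_minus_\<tau>[OF value_in_I[OF p]] o_def
    by (simp add: kap_def algebra_simps)
qed

text \<open>Constancy of \<open>I\<tau>\<close> turns the product with \<open>\<psi>\<close> into a
  constant multiple of \<open>\<psi>\<close>.\<close>

lemma field_potential:
  assumes V: "V \<in> vector_fields M" and p: "p \<in> pts M"
  shows "V p potential = - V p Is + I\<tau> p * V p \<psi>"
proof -
  obtain k where k: "\<And>q. q \<in> pts M \<Longrightarrow> I\<tau> q = k" using const unfolding constant_on_def by blast
  have "V p potential = V p (\<lambda>q. - 1 * Is q + k * \<psi> q)"
    by (rule field_cong[OF V p]) (simp add: potential_def k)
  also have "\<dots> = - 1 * V p Is + k * V p \<psi>"
    by (simp only: field_add[OF V p smooth_mult[OF smooth_const smooth_Is] smooth_mult[OF smooth_const smooth_\<psi>]]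
        field_cmult[OF V p smooth_Is] field_cmult[OF V p smooth_\<psi>])
  finally show ?thesis by (simp add: k[OF p])
qed

lemma smooth_potential: "smooth_fun M (pts M) potential"
proof (rule smooth_cong)
  show "smooth_fun M (pts M) (\<lambda>q. - 1 * Is q + \<psi> q * I\<tau> q)"
    by (rule smooth_add[OF smooth_mult[OF smooth_const smooth_Is] smooth_mult[OF smooth_\<psi> smooth_I\<tau>]])
qed (simp add: potential_def)

text \<open>The Hessian of minus \<open>Is\<close> is the metric minus the Hessian of
  \<open>\<psi>\<close> times \<open>I\<tau> p\<close>; the summand with \<open>\<psi>\<close> in
  the potential is there to cancel this error.\<close>

lemma hess_potential:
  assumes V: "V \<in> vector_fields M" and W: "W \<in> vector_fields M" and p: "p \<in> pts M"
  shows "g p V W = hess nabla potential p V W"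
proof -
  obtain k where k: "\<And>q. q \<in> pts M \<Longrightarrow> I\<tau> q = k" using const unfolding constant_on_def by blast
  note sW = field_smooth[OF W smooth_Is] field_smooth[OF W smooth_\<psi>]
  have "V p (\<lambda>q. W q potential) = V p (\<lambda>q. - 1 * W q Is + k * W q \<psi>)"
    by (rule field_cong[OF V p]) (simp add: field_potential[OF W] k)
  also have "\<dots> = - 1 * V p (\<lambda>q. W q Is) + k * V p (\<lambda>q. W q \<psi>)"
    by (simp only: field_add[OF V p smooth_mult[OF smooth_const sW(1)] smooth_mult[OF smooth_const sW(2)]]
        field_cmult[OF V p sW(1)] field_cmult[OF V p sW(2)])
  finally show ?thesis
    unfolding hess_def nabla_flat[OF V W] field_potential[OF flat_vector_field[OF V W] p]
      field_field_Is[OF V W p]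
    by (simp add: hess_def k[OF p] algebra_simps)
qed

lemma global_potential_potential: "global_potential M g nabla potential"
  unfolding global_potential_def hessian_potential_on_def
  using smooth_potential hess_potential by blast

lemma hessian_structure_g_nabla: "hessian_structure M g nabla"
  unfolding hessian_structure_def flat_connection_def
proof (intro conjI ballI exI)
  show "hessian_potential_on M g nabla (pts M) potential"
    using global_potential_potential unfolding global_potential_def .
qed (simp_all add: riemannian_g affine_connection_nabla torsion_free_nabla curvature_free_nabla)

text \<open>This identifies the dual coordinates: the partial derivatives of the potential are the
  moments of \<open>T\<close> weighted by \<open>\<tau> (p x)\<close>. Integrability is extracted
  from that of the derivatives of \<open>sstar h \<tau> (p x)\<close>.\<close>

lemma \<tau>_T_has_integral:
  assumes p: "p \<in> pts M"
  shows "has_bochner_integral (completion \<mu>) (\<lambda>x. \<tau> (p x) * T x $ i) (frame i p potential)"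
proof -
  note E = frame_vector_field[of i]
  have "has_bochner_integral (completion \<mu>) (\<lambda>x. \<tau> (p x)) (I\<tau> p)"
    using integrable_\<tau>[OF p] by (simp add: has_bochner_integral_iff Ifun_def)
  then have "has_bochner_integral (completion \<mu>)
      (\<lambda>x. - (- \<tau> (p x) * stat (frame i) p x) + frame i p \<psi> * \<tau> (p x))
      (- frame i p Is + frame i p \<psi> * I\<tau> p)"
    by (intro has_bochner_integral_add has_bochner_integral_minus has_bochner_integral_mult_right
        field_Is E p)
  moreover have "- (- \<tau> (p x) * stat (frame i) p x) + frame i p \<psi> * \<tau> (p x) = \<tau> (p x) * T x $ i" for x
    by (simp add: stat_def comps_frame[OF p] inner_axis' algebra_simps)
  ultimately show ?thesis unfolding field_potential[OF E p] by (simp add: mult.commute)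
qed

text \<open>Pointwise, \<open>ddiv h \<tau>\<close> is the difference of the \<open>sstar\<close>
  values plus \<open>\<tau> (p x)\<close> times the difference of the \<open>ell\<close> values. The
  latter is affine in \<open>T x\<close>, so integration produces the dual coordinates.\<close>

lemma divergence_has_integral:
  assumes p: "p \<in> pts M" and p': "p' \<in> pts M"
  shows "has_bochner_integral (completion \<mu>) (\<lambda>x. ddiv h \<tau> (p x) (p' x))
    (canonical_divergence M \<theta> potential p p')"
proof -
  let ?\<theta> = "\<theta> p - \<theta> p'"
  have I\<tau>: "has_bochner_integral (completion \<mu>) (\<lambda>x. \<tau> (p x)) (I\<tau> p)"
    using integrable_\<tau>[OF p] by (simp add: has_bochner_integral_iff Ifun_def)
  have Is: "has_bochner_integral (completion \<mu>) (\<lambda>x. sstar h \<tau> (q x)) (Is q)" if "q \<in> pts M" for q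
    using integrable_sstar that by (simp add: has_bochner_integral_iff Ifun_def)
  have "has_bochner_integral (completion \<mu>)
      (\<lambda>x. sstar h \<tau> (p x) - sstar h \<tau> (p' x) + ((\<Sum>i\<in>UNIV. ?\<theta> $ i * (\<tau> (p x) * T x $ i))
        + (\<psi> p' - \<psi> p) * \<tau> (p x)))
      (Is p - Is p' + ((\<Sum>i\<in>UNIV. ?\<theta> $ i * frame i p potential) + (\<psi> p' - \<psi> p) * I\<tau> p))"
    by (intro has_bochner_integral_add has_bochner_integral_diff has_bochner_integral_sum
        has_bochner_integral_mult_right \<tau>_T_has_integral Is I\<tau> p p')
  moreover have "sstar h \<tau> (p x) - sstar h \<tau> (p' x) + ((\<Sum>i\<in>UNIV. ?\<theta> $ i * (\<tau> (p x) * T x $ i))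
        + (\<psi> p' - \<psi> p) * \<tau> (p x)) = ddiv h \<tau> (p x) (p' x)" for x
  proof -
    have "(\<Sum>i\<in>UNIV. ?\<theta> $ i * (\<tau> (p x) * T x $ i)) = \<tau> (p x) * (?\<theta> \<bullet> T x)"
      by (simp add: inner_vec_def sum_distrib_left mult_ac)
    also have "?\<theta> \<bullet> T x = ell h \<tau> (p x) - ell h \<tau> (p' x) + \<psi> p - \<psi> p'"
      by (simp add: ell_value[OF p] ell_value[OF p'] inner_diff_left)
    finally show ?thesis by (simp add: sstar_def ddiv_def ell_def algebra_simps)
  qed
  moreover have "Is p - Is p' + ((\<Sum>i\<in>UNIV. ?\<theta> $ i * frame i p potential) + (\<psi> p' - \<psi> p) * I\<tau> p) =
      canonical_divergence M \<theta> potential p p'"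
  proof -
    \<comment> \<open>The integrals carry \<open>\<psi> p' * I\<tau> p\<close>, whereas the
      potential at \<open>p'\<close> contains \<open>\<psi> p' * I\<tau> p'\<close>.\<close>
    have "I\<tau> p' = I\<tau> p" using const p p' unfolding constant_on_def by auto
    then show ?thesis
      by (simp add: canonical_divergence_def potential_def[of p] potential_def[of p'] inner_vec_def
          frame_def algebra_simps)
  qed
  ultimately show ?thesis by simp
qed

end

end

end

theorem theorem5p5:
  fixes \<mu> :: "'x::topological_space measure"
    and M :: "('x \<Rightarrow> real, 'n::finite) manifold"
    and h \<tau> :: "real \<Rightarrow> real" and I :: "real set"
  assumes "radon_measure \<mu>" and "measure_support \<mu> = UNIV"
    and "(h, \<tau>, I) \<in> admissible_triples"
    and "compatible \<mu> h \<tau> I M" and "exponential_family \<mu> h \<tau> I M"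
    and "\<forall>p\<in>pts M. integrable (completion \<mu>) (\<lambda>x. chi h \<tau> (p x))"
    and "\<forall>p\<in>pts M. integrable (completion \<mu>) (\<lambda>x. \<tau> (p x))"
    and "smooth_fun M (pts M) (Ifun \<mu> \<tau>)"
    and "\<forall>V\<in>vector_fields M. \<forall>p\<in>pts M.
           has_bochner_integral (completion \<mu>) (\<lambda>x. V p (\<tau> \<circ> ev x)) (V p (Ifun \<mu> \<tau>))"
  shows
    "(\<forall>\<theta> T c \<psi>. exp_coord_rep h \<tau> I M (pts M) \<theta> T c \<psi> \<longrightarrow>
        (Ifun \<mu> \<tau> constant_on pts M \<longrightarrow> affine_coords M (nabla_ht \<mu> h \<tau> M) \<theta>) \<and>
        ((\<forall>t\<in>I. deriv (chi h \<tau>) t > 0) \<and> affine_coords M (nabla_ht \<mu> h \<tau> M) \<theta>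
           \<longrightarrow> Ifun \<mu> \<tau> constant_on pts M))
     \<and>
     (Ifun \<mu> \<tau> constant_on pts M \<and>
      (\<forall>p\<in>pts M. integrable (completion \<mu>) (\<lambda>x. sstar h \<tau> (p x))) \<and>
      smooth_fun M (pts M) (Ifun \<mu> (sstar h \<tau>)) \<and>
      (\<forall>V\<in>vector_fields M. \<forall>W\<in>vector_fields M. \<forall>p\<in>pts M.
         has_bochner_integral (completion \<mu>) (\<lambda>x. V p (sstar h \<tau> \<circ> ev x)) (V p (Ifun \<mu> (sstar h \<tau>))) \<and>
         has_bochner_integral (completion \<mu>) (\<lambda>x. V p (\<lambda>q. W q (sstar h \<tau> \<circ> ev x)))
           (V p (\<lambda>q. W q (Ifun \<mu> (sstar h \<tau>)))))
      \<longrightarrow>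
      hessian_structure M (g_ht \<mu> h \<tau>) (nabla_ht \<mu> h \<tau> M) \<and>
      (\<forall>\<theta> T c \<psi>. exp_coord_rep h \<tau> I M (pts M) \<theta> T c \<psi> \<longrightarrow>
         (let \<Psi> = (\<lambda>p. - Ifun \<mu> (sstar h \<tau>) p + \<psi> p * Ifun \<mu> \<tau> p) in
          global_potential M (g_ht \<mu> h \<tau>) (nabla_ht \<mu> h \<tau> M) \<Psi> \<and>
          (\<forall>p\<in>pts M. \<forall>p'\<in>pts M.
             integrable (completion \<mu>) (\<lambda>x. ddiv h \<tau> (p x) (p' x)) \<and>
             canonical_divergence M \<theta> \<Psi> p p' = divergence \<mu> h \<tau> p p'))))"
proof -
  interpret E: exponential_manifold h \<tau> I \<mu> M
    using assms(3,5) by unfold_locales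
  have family: "global_exponential_family h \<tau> I \<mu> M \<theta> T c \<psi>" if "E.ell_rep (pts M) \<theta> T c \<psi>" for \<theta> T c \<psi>
    using assms that by unfold_locales auto
  have part1: "(Ifun \<mu> \<tau> constant_on pts M \<longrightarrow> affine_coords M (nabla_ht \<mu> h \<tau> M) \<theta>) \<and>
        ((\<forall>t\<in>I. deriv (chi h \<tau>) t > 0) \<and> affine_coords M (nabla_ht \<mu> h \<tau> M) \<theta>
           \<longrightarrow> Ifun \<mu> \<tau> constant_on pts M)"
    if "exp_coord_rep h \<tau> I M (pts M) \<theta> T c \<psi>" for \<theta> T c \<psi>
  proof -
    interpret global_exponential_family h \<tau> I \<mu> M \<theta> T c \<psi>
      by (rule family[OF E.ell_rep_if_exp_coord_rep[OF that]])
    show ?thesis using affine_if_constant constant_if_affine by blast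
  qed
  have hess: "hessian_structure M (g_ht \<mu> h \<tau>) (nabla_ht \<mu> h \<tau> M)"
    if const: "Ifun \<mu> \<tau> constant_on pts M"
      and s: "\<forall>p\<in>pts M. integrable (completion \<mu>) (\<lambda>x. sstar h \<tau> (p x))"
        "smooth_fun M (pts M) (Ifun \<mu> (sstar h \<tau>))"
        "\<forall>V\<in>vector_fields M. \<forall>W\<in>vector_fields M. \<forall>p\<in>pts M.
         has_bochner_integral (completion \<mu>) (\<lambda>x. V p (sstar h \<tau> \<circ> ev x)) (V p (Ifun \<mu> (sstar h \<tau>))) \<and>
         has_bochner_integral (completion \<mu>) (\<lambda>x. V p (\<lambda>q. W q (sstar h \<tau> \<circ> ev x)))
           (V p (\<lambda>q. W q (Ifun \<mu> (sstar h \<tau>))))"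
  proof -
    \<comment> \<open>The claim mentions no representation, so a global one has to be constructed
      here.\<close>
    from E.global_ell_rep obtain \<theta> T c \<psi> where rep: "E.ell_rep (pts M) \<theta> T c \<psi>" by (elim exE)
    interpret global_exponential_family h \<tau> I \<mu> M \<theta> T c \<psi> by (rule family[OF rep])
    show ?thesis by (rule hessian_structure_g_nabla[OF const s])
  qed
  have potential:
    "(let \<Psi> = (\<lambda>p. - Ifun \<mu> (sstar h \<tau>) p + \<psi> p * Ifun \<mu> \<tau> p) in
          global_potential M (g_ht \<mu> h \<tau>) (nabla_ht \<mu> h \<tau> M) \<Psi> \<and>
          (\<forall>p\<in>pts M. \<forall>p'\<in>pts M.
             integrable (completion \<mu>) (\<lambda>x. ddiv h \<tau> (p x) (p' x)) \<and>
             canonical_divergence M \<theta> \<Psi> p p' = divergence \<mu> h \<tau> p p'))"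
    if const: "Ifun \<mu> \<tau> constant_on pts M"
      and s: "\<forall>p\<in>pts M. integrable (completion \<mu>) (\<lambda>x. sstar h \<tau> (p x))"
        "smooth_fun M (pts M) (Ifun \<mu> (sstar h \<tau>))"
        "\<forall>V\<in>vector_fields M. \<forall>W\<in>vector_fields M. \<forall>p\<in>pts M.
         has_bochner_integral (completion \<mu>) (\<lambda>x. V p (sstar h \<tau> \<circ> ev x)) (V p (Ifun \<mu> (sstar h \<tau>))) \<and>
         has_bochner_integral (completion \<mu>) (\<lambda>x. V p (\<lambda>q. W q (sstar h \<tau> \<circ> ev x)))
           (V p (\<lambda>q. W q (Ifun \<mu> (sstar h \<tau>))))"
      and r: "exp_coord_rep h \<tau> I M (pts M) \<theta> T c \<psi>" for \<theta> T c \<psi>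
  proof -
    interpret global_exponential_family h \<tau> I \<mu> M \<theta> T c \<psi>
      by (rule family[OF E.ell_rep_if_exp_coord_rep[OF r]])
    have pot: "potential = (\<lambda>p. - Ifun \<mu> (sstar h \<tau>) p + \<psi> p * Ifun \<mu> \<tau> p)"
      using potential_def by blast
    show ?thesis
      unfolding Let_def pot[symmetric] divergence_def
      using global_potential_potential[OF const s] divergence_has_integral[OF const s]
      by (simp add: has_bochner_integral_iff)
  qed
  show ?thesis
    by (intro conjI[OF allI[OF allI[OF allI[OF allI[OF impI[OF part1]]]]]] impI conjI allI;
        (elim conjE)?; (rule hess | rule potential)?; assumption)
qed

end
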